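(* Let $G$ be a complex semisimple Lie group. Then every unipotent element $u\in G$ is real in $G$, i.e. there exists $h\in G$ with $huh^{-1}=u^{-1}$.
   Context: An element $g$ of a group $G$ is real if $g^{-1}=hgh^{-1}$ for some $h\in G$. The unipotent elements of $G$ are the elements $\exp X$ with $X$ a nilpotent element of the Lie algebra $\mathfrak{g}$ of $G$ (the exponential map is a $G$-equivariant bijection from nilpotent elements of $\mathfrak{g}$ onto unipotent elements of $G$). *)

theory Defs
  imports "HOL-Analysis.Analysis" "HOL-Algebra.Group"
begin

section \<open>Complex Lie groups\<close>

text \<open>
  A map between complex vector spaces is holomorphic on an open set if it is Frechet differentiable
  at every point with complex-linear derivative. Since a Frechet derivative is additive,
  complex linearity only has to require compatibility with the scalar multiplications
  \<open>s1\<close>, \<open>s2\<close>.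
\<close>

definition holo_on ::
  "(complex \<Rightarrow> 'e \<Rightarrow> 'e) \<Rightarrow> (complex \<Rightarrow> 'f \<Rightarrow> 'f) \<Rightarrow>
   ('e::real_normed_vector \<Rightarrow> 'f::real_normed_vector) \<Rightarrow> 'e set \<Rightarrow> bool"
  where "holo_on s1 s2 f S \<longleftrightarrow>
    (\<forall>x\<in>S. \<exists>D. (f has_derivative D) (at x) \<and> (\<forall>c v. D (s1 c v) = s2 c (D v)))"

definition scale_pair ::
  "complex \<Rightarrow> (complex^'n) \<times> (complex^'n) \<Rightarrow> (complex^'n) \<times> (complex^'n)"
  where "scale_pair c p = (c *s fst p, c *s snd p)"

text \<open>
  A chart is a pair of its domain and the coordinate map; the coordinate map is only meaningful
  on the domain.
\<close>

type_synonym ('a, 'n) chart = "'a set \<times> ('a \<Rightarrow> complex^'n)"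

abbreviation dom_chart :: "('a, 'n) chart \<Rightarrow> 'a set"
  where "dom_chart \<equiv> fst"

abbreviation coord :: "('a, 'n) chart \<Rightarrow> 'a \<Rightarrow> complex^'n"
  where "coord \<equiv> snd"

abbreviation range_chart :: "('a, 'n) chart \<Rightarrow> (complex^'n) set"
  where "range_chart c \<equiv> coord c ` dom_chart c"

definition inv_coord :: "('a, 'n) chart \<Rightarrow> complex^'n \<Rightarrow> 'a"
  where "inv_coord c = the_inv_into (dom_chart c) (coord c)"

definition is_chart :: "'a topology \<Rightarrow> ('a, 'n::finite) chart \<Rightarrow> bool"
  where "is_chart T c \<longleftrightarrow>
    openin T (dom_chart c) \<and> open (range_chart c) \<and>
    homeomorphic_map (subtopology T (dom_chart c)) (top_of_set (range_chart c)) (coord c)"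

locale complex_manifold =
  fixes T :: "'a topology" and A :: "('a, 'n::finite) chart set"
  assumes Hausdorff: "Hausdorff_space T"
    and second_countable: "second_countable T"
    and charts: "\<And>c. c \<in> A \<Longrightarrow> is_chart T c"
    and cover: "\<Union> (dom_chart ` A) = topspace T"
    and transition: "\<And>c d. c \<in> A \<Longrightarrow> d \<in> A \<Longrightarrow>
      holo_on (*s) (*s) (coord d \<circ> inv_coord c) (coord c ` (dom_chart c \<inter> dom_chart d))"

locale complex_lie_group = group G + complex_manifold T A
  for G :: "('a, 'b) monoid_scheme" (structure)
    and T :: "'a topology" and A :: "('a, 'n::finite) chart set" +
  assumes carrier: "topspace T = carrier G"
    and mult_continuous:
      "continuous_map (prod_topology T T) T (\<lambda>(x, y). x \<otimes> y)"
    and mult_holomorphic: "\<And>c d e. c \<in> A \<Longrightarrow> d \<in> A \<Longrightarrow> e \<in> A \<Longrightarrow>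
      holo_on scale_pair (*s)
        (\<lambda>(x, y). coord e (inv_coord c x \<otimes> inv_coord d y))
        {(x, y). x \<in> range_chart c \<and> y \<in> range_chart d \<and>
                 inv_coord c x \<otimes> inv_coord d y \<in> dom_chart e}"
    and inv_continuous: "continuous_map T T (\<lambda>x. inv x)"
    and inv_holomorphic: "\<And>c d. c \<in> A \<Longrightarrow> d \<in> A \<Longrightarrow>
      holo_on (*s) (*s)
        (\<lambda>x. coord d (inv (inv_coord c x)))
        {x. x \<in> range_chart c \<and> inv (inv_coord c x) \<in> dom_chart d}"

section \<open>The Lie algebra and the exponential map\<close>

text \<open>
  The tangent space of \<open>G\<close> at the identity is identified with \<^typ>\<open>complex^'n\<close> by means of a fixed
  chart around the identity. Another choice of chart changes the identification by a complex-linear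
  isomorphism (the derivative of the transition map), which is compatible with
  all the notions below.
\<close>

definition chart_one :: "('a, 'b) monoid_scheme \<Rightarrow> ('a, 'n) chart set \<Rightarrow> ('a, 'n) chart"
  where "chart_one G A = (SOME c. c \<in> A \<and> \<one>\<^bsub>G\<^esub> \<in> dom_chart c)"

text \<open>\<open>Ad g\<close> is the derivative at the identity of the conjugation \<open>x \<mapsto> g x g\<^sup>-\<^sup>1\<close>.\<close>

definition Ad :: "('a, 'b) monoid_scheme \<Rightarrow> ('a, 'n::finite) chart set \<Rightarrow>
    'a \<Rightarrow> complex^'n \<Rightarrow> complex^'n"
  where "Ad G A g =
    (let c = chart_one G A in
      frechet_derivative
        (\<lambda>x. coord c (g \<otimes>\<^bsub>G\<^esub> inv_coord c x \<otimes>\<^bsub>G\<^esub> inv\<^bsub>G\<^esub> g))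
        (at (coord c \<one>\<^bsub>G\<^esub>)))"

text \<open>
  The Lie bracket is \<open>[X, Y] = ad X Y\<close>, where \<open>ad\<close> is the derivative at the identity of the
  adjoint representation \<open>Ad\<close>; this is the bracket given by left-invariant vector fields.
\<close>

definition lie_bracket :: "('a, 'b) monoid_scheme \<Rightarrow> ('a, 'n::finite) chart set \<Rightarrow>
    complex^'n \<Rightarrow> complex^'n \<Rightarrow> complex^'n"
  where "lie_bracket G A X Y =
    (let c = chart_one G A in
      frechet_derivative (\<lambda>x. Ad G A (inv_coord c x) Y) (at (coord c \<one>\<^bsub>G\<^esub>)) X)"

text \<open>
  Continuous homomorphisms \<open>\<gamma>\<close> from the additive group of real numbers to \<open>G\<close> with velocity \<open>X\<close>
  at \<open>0\<close>. Continuity guarantees that \<open>\<gamma> t\<close> stays in the chart domain for small \<open>t\<close>.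
\<close>

definition one_param_subgroup :: "('a, 'b) monoid_scheme \<Rightarrow> 'a topology \<Rightarrow>
    ('a, 'n::finite) chart set \<Rightarrow> complex^'n \<Rightarrow> (real \<Rightarrow> 'a) \<Rightarrow> bool"
  where "one_param_subgroup G T A X \<gamma> \<longleftrightarrow>
    continuous_map euclideanreal T \<gamma> \<and>
    (\<forall>s t. \<gamma> (s + t) = \<gamma> s \<otimes>\<^bsub>G\<^esub> \<gamma> t) \<and>
    ((\<lambda>t. coord (chart_one G A) (\<gamma> t)) has_vector_derivative X) (at 0)"

definition lie_exp :: "('a, 'b) monoid_scheme \<Rightarrow> 'a topology \<Rightarrow>
    ('a, 'n::finite) chart set \<Rightarrow> complex^'n \<Rightarrow> 'a"
  where "lie_exp G T A X = (THE \<gamma>. one_param_subgroup G T A X \<gamma>) 1"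

section \<open>Semisimplicity and unipotent elements\<close>

text \<open>In this section \<open>br\<close> is the bracket of a Lie algebra with underlying space \<^typ>\<open>complex^'n\<close>.\<close>

definition lie_ideal ::
  "(complex^'n \<Rightarrow> complex^'n \<Rightarrow> complex^'n) \<Rightarrow> (complex^'n::finite) set \<Rightarrow> bool"
  where "lie_ideal br I \<longleftrightarrow> vec.subspace I \<and> (\<forall>x. \<forall>y\<in>I. br x y \<in> I)"

definition derived_algebra ::
  "(complex^'n \<Rightarrow> complex^'n \<Rightarrow> complex^'n) \<Rightarrow> (complex^'n::finite) set \<Rightarrow> (complex^'n) set"
  where "derived_algebra br S = vec.span {br x y |x y. x \<in> S \<and> y \<in> S}"

definition lie_solvable ::
  "(complex^'n \<Rightarrow> complex^'n \<Rightarrow> complex^'n) \<Rightarrow> (complex^'n::finite) set \<Rightarrow> bool"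
  where "lie_solvable br S \<longleftrightarrow> (\<exists>k. (derived_algebra br ^^ k) S = {0})"

definition lie_semisimple ::
  "(complex^'n \<Rightarrow> complex^'n \<Rightarrow> complex^'n::finite) \<Rightarrow> bool"
  where "lie_semisimple br \<longleftrightarrow> (\<forall>I. lie_ideal br I \<and> lie_solvable br I \<longrightarrow> I = {0})"

text \<open>An element of a semisimple Lie algebra is nilpotent if it is ad-nilpotent.\<close>

definition lie_nilpotent ::
  "(complex^'n \<Rightarrow> complex^'n \<Rightarrow> complex^'n) \<Rightarrow> complex^'n::finite \<Rightarrow> bool"
  where "lie_nilpotent br X \<longleftrightarrow> (\<exists>k. \<forall>Y. (br X ^^ k) Y = 0)"

locale complex_semisimple_lie_group = complex_lie_group G T A
  for G :: "('a, 'b) monoid_scheme" (structure)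
    and T :: "'a topology" and A :: "('a, 'n::finite) chart set" +
  assumes semisimple: "lie_semisimple (lie_bracket G A)"

definition unipotent :: "('a, 'b) monoid_scheme \<Rightarrow> 'a topology \<Rightarrow>
    ('a, 'n::finite) chart set \<Rightarrow> 'a \<Rightarrow> bool"
  where "unipotent G T A u \<longleftrightarrow>
    (\<exists>X. lie_nilpotent (lie_bracket G A) X \<and> u = lie_exp G T A X)"

definition real_element :: "('a, 'b) monoid_scheme \<Rightarrow> 'a \<Rightarrow> bool"
  where "real_element G g \<longleftrightarrow>
    (\<exists>h\<in>carrier G. h \<otimes>\<^bsub>G\<^esub> g \<otimes>\<^bsub>G\<^esub> inv\<^bsub>G\<^esub> h = inv\<^bsub>G\<^esub> g)"

end

theory Submission
  imports Defs "HOL-Complex_Analysis.Cauchy_Integral_Formula"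
    "HOL-Computational_Algebra.Fundamental_Theorem_Algebra"
begin

text \<open>
  Let \<open>u = exp X\<close> with \<open>ad X\<close> nilpotent. For \<open>Z\<close> in the kernel of \<open>ad X\<close> the map \<open>ad Z ad X\<close> is
  nilpotent, so \<open>X\<close> is orthogonal to this kernel for the Killing form; if that form is
  nondegenerate, \<open>X\<close> lies in the range of \<open>ad X\<close>. A multiple \<open>H\<close> of a preimage satisfies
  \<open>[H, X] = \<i>\<pi>X\<close>, hence \<open>Ad (exp H) X = exp (\<i>\<pi>) X = -X\<close>, and conjugation by \<open>exp H\<close> maps
  the one-parameter subgroup of \<open>X\<close> to that of \<open>-X\<close>. This uses only a part of the
  Jacobson--Morozov theorem.

  The radical of the Killing form is a solvable ideal: for \<open>x\<close> in its derived algebra, let \<open>E\<close> act as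
  the complex conjugate of the eigenvalue on each generalised eigenspace of \<open>ad x\<close>. Additivity of
  conjugation makes \<open>E\<close> a derivation, so \<open>tr (ad x \<circ> E) = 0\<close>. As this trace is the sum of the squared
  moduli of the eigenvalues, \<open>ad x\<close> is nilpotent, and Engel's theorem applies.

  On the group side, Cauchy's integral formula shows that directional derivatives of
  holomorphic maps are holomorphic. Therefore left-invariant vector fields are locally
  Lipschitz, which yields existence and uniqueness of one-parameter subgroups. The Jacobi identity
  comes from differentiating \<open>Ad g [X, Y] = [Ad g X, Ad g Y]\<close> in \<open>g\<close>, and \<open>[X, X] = 0\<close> from
  \<open>Ad (exp tX) X = X\<close>.
\<close>

section \<open>Traces and generalised eigenspaces\<close>

text \<open>Semisimplicity is given as the absence of solvable ideals, while the linear algebra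
  needs a nondegenerate Killing form; this is why the solvability of its radical has to be settled.
  Invariance puts the range of ad X inside the orthogonal complement of the kernel of ad X, and
  nondegeneracy makes the two equal, so orthogonality of \<open>X\<close> to the kernel is just what
  is wanted. Conjugate eigenvalues appear because the squares in the trace of (ad x)^2 may cancel,
  whereas squared moduli cannot. The number \<i>\<pi> is a logarithm of -1, available because the
  Lie algebra is complex: real one-parameter subgroups may have any complex multiple of a vector as
  velocity. On the group side, \<open>lie_exp\<close> is a definite description and
  \<open>lie_bracket\<close> a derivative of a derivative, both taken with total operators. Neither
  says anything until unique existence and differentiability are known, and \<open>holo_on\<close>
  provides only a derivative at each point. Likewise the Lie algebra axioms are not part of the
  definition of the bracket but have to be derived from the group.\<close>

abbreviation clinear :: "(complex^'n::finite \<Rightarrow> complex^'m::finite) \<Rightarrow> bool"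
  where "clinear \<equiv> Vector_Spaces.linear (*s) (*s)"

lemma clinearI:
  assumes "\<And>x y. f (x + y) = f x + f y" "\<And>c x. f (c *s x) = c *s f x"
  shows "clinear f"
  using assms by unfold_locales auto

lemmas clinear_simps = vec.linear_add vec.linear_scale vec.linear_diff vec.linear_neg

lemma clinear_funpow:
  fixes f :: "complex^'n::finite \<Rightarrow> complex^'n"
  shows "clinear f \<Longrightarrow> clinear (f ^^ k)"
proof (induction k)
  case 0
  show ?case by (rule clinearI) auto
next
  case (Suc k)
  then show ?case by (intro clinearI) (auto simp: clinear_simps)
qed

text \<open>Applied with \<open>W = {0}\<close>: a linear map that vanishes on a spanning set
  vanishes everywhere.\<close>

lemma clinear_span_induct:
  assumes "clinear f" "vec.subspace W" "\<And>b. b \<in> B \<Longrightarrow> f b \<in> W" "v \<in> vec.span B"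
  shows "f v \<in> W"
proof -
  have "vec.subspace {x. f x \<in> W}"
    by (rule vec.linear_subspace_linear_preimage[OF assms(1,2)])
  then have "vec.span B \<subseteq> {x. f x \<in> W}"
    by (rule vec.span_minimal[rotated]) (use assms(3) in auto)
  then show ?thesis using assms(4) by auto
qed

lemma funpow_commute_pointwise:
  assumes "\<And>v. f (g v) = g (f v)"
  shows "(f ^^ k) (g v) = g ((f ^^ k) v)"
  by (induction k) (auto simp: assms)

lemma funpow_zero_mono:
  fixes f :: "complex^'n::finite \<Rightarrow> complex^'n"
  assumes "clinear f" "(f ^^ k) v = 0" "k \<le> m"
  shows "(f ^^ m) v = 0"
proof -
  have "(f ^^ m) v = (f ^^ (m - k)) ((f ^^ k) v)"
    using assms(3) by (metis funpow_add le_add_diff_inverse2 o_apply)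
  then show ?thesis using assms by (simp add: vec.linear_0 clinear_funpow)
qed

text \<open>Read off the standard basis for an arbitrary function, so that additivity holds without
  linearity. Independence of the basis enters through \<open>lin_trace_comm\<close>.\<close>

definition lin_trace :: "(complex^'n::finite \<Rightarrow> complex^'n) \<Rightarrow> complex"
  where "lin_trace f = (\<Sum>i\<in>UNIV. f (axis i 1) $ i)"

lemma lin_trace_comm:
  assumes "clinear f" "clinear g"
  shows "lin_trace (f \<circ> g) = lin_trace (g \<circ> f)"
proof -
  have "lin_trace (f \<circ> g) = trace (matrix (f \<circ> g))"
    by (simp add: lin_trace_def trace_def matrix_def)
  also have "\<dots> = trace (matrix f ** matrix g)"
    by (rule arg_cong[OF matrix_compose_gen[OF assms(2,1)]])
  also have "\<dots> = trace (matrix g ** matrix f)"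
    by (rule trace_mul_sym)
  also have "\<dots> = trace (matrix (g \<circ> f))"
    by (rule arg_cong[OF matrix_compose_gen[OF assms, symmetric]])
  also have "\<dots> = lin_trace (g \<circ> f)"
    by (simp add: lin_trace_def trace_def matrix_def)
  finally show ?thesis .
qed

lemma lin_trace_add: "lin_trace (\<lambda>x. f x + g x) = lin_trace f + lin_trace g"
  by (simp add: lin_trace_def sum.distrib)

lemma lin_trace_diff: "lin_trace (\<lambda>x. f x - g x) = lin_trace f - lin_trace g"
  by (simp add: lin_trace_def sum_subtractf)

lemma lin_trace_cmult: "lin_trace (\<lambda>x. c *s f x) = c * lin_trace f"
  by (simp add: lin_trace_def sum_distrib_left)

text \<open>With a generalised inverse \<open>g\<close> of \<open>f\<close>, the map \<open>f \<circ> f \<circ> g\<close> has the same trace as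
  \<open>f = f \<circ> g \<circ> f\<close> but a smaller order of nilpotency.\<close>

lemma lin_trace_nilpotent:
  assumes "clinear f" "\<And>v. (f ^^ k) v = 0"
  shows "lin_trace f = 0"
  using assms
proof (induction k arbitrary: f)
  case 0
  then have "f v = 0" for v by simp
  then show ?case by (simp add: lin_trace_def)
next
  case (Suc k)
  show ?case
  proof (cases "k = 0")
    case True
    then have "f v = 0" for v using Suc.prems(2) by simp
    then show ?thesis by (simp add: lin_trace_def)
  next
    case False
    then obtain j where k: "k = Suc j" using not0_implies_Suc by blast
    obtain g where g: "clinear g" "\<And>v. f (g (f v)) = f v"
      using vec.linear_exists_right_inverse_on[OF Suc.prems(1) vec.subspace_UNIV] by auto
    define h where "h = f \<circ> (f \<circ> g)"
    have h: "clinear h"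
      unfolding h_def using Suc.prems(1) g(1) by (auto intro!: clinearI simp: clinear_simps)
    have "(h ^^ Suc j) v = (f ^^ Suc (Suc j)) (g v)" for j v
    proof (induction j)
      case (Suc j)
      have "(h ^^ Suc (Suc j)) v = h ((f ^^ Suc (Suc j)) (g v))" using Suc by simp
      also have "\<dots> = (f ^^ Suc (Suc (Suc j))) (g v)" unfolding h_def by (simp add: g(2))
      finally show ?case .
    qed (simp add: h_def)
    then have "(h ^^ k) v = 0" for v using Suc.prems(2) k by metis
    then have "lin_trace h = 0" using Suc.IH h by blast
    moreover have "lin_trace h = lin_trace ((f \<circ> g) \<circ> f)"
      unfolding h_def
      by (rule lin_trace_comm) (use Suc.prems(1) g(1) in \<open>auto intro!: clinearI simp: clinear_simps\<close>)
    moreover have "(f \<circ> g) \<circ> f = f" using g(2) by auto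
    ultimately show ?thesis by simp
  qed
qed

section \<open>Generalised eigenspaces of a linear map\<close>

definition shift :: "(complex^'n::finite \<Rightarrow> complex^'n) \<Rightarrow> complex \<Rightarrow> complex^'n \<Rightarrow> complex^'n"
  where "shift D \<mu> v = D v - \<mu> *s v"

text \<open>The exponent may depend on the vector, and \<mu> need not be an eigenvalue (the set is
  then \<open>{0}\<close>), so neither a dimension bound nor a spectrum is carried along.
  \<open>finite_uniform_power\<close> recovers a common exponent.\<close>

definition gen_eig :: "(complex^'n::finite \<Rightarrow> complex^'n) \<Rightarrow> complex \<Rightarrow> (complex^'n) set"
  where "gen_eig D \<mu> = {v. \<exists>N. (shift D \<mu> ^^ N) v = 0}"

lemma clinear_shift: "clinear D \<Longrightarrow> clinear (shift D \<mu>)"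
  unfolding shift_def[abs_def]
  by (auto intro!: clinearI simp: clinear_simps vec.scale_right_distrib vec.scale_right_diff_distrib
      vec.scale_scale mult.commute)

lemma clinear_shift_pow: "clinear D \<Longrightarrow> clinear (shift D \<mu> ^^ k)"
  by (intro clinear_funpow clinear_shift)

lemma shift_commute:
  assumes "clinear D" "clinear f" "\<And>v. f (D v) = D (f v)"
  shows "f (shift D \<mu> v) = shift D \<mu> (f v)"
  using assms by (simp add: shift_def clinear_simps)

lemma subspace_gen_eig:
  assumes "clinear D"
  shows "vec.subspace (gen_eig D \<mu>)"
proof (rule vec.subspaceI)
  show "0 \<in> gen_eig D \<mu>" by (auto simp: gen_eig_def intro: exI[of _ 0])
next
  fix x y assume "x \<in> gen_eig D \<mu>" "y \<in> gen_eig D \<mu>"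
  then obtain N M where "(shift D \<mu> ^^ N) x = 0" "(shift D \<mu> ^^ M) y = 0"
    by (auto simp: gen_eig_def)
  then have "(shift D \<mu> ^^ (max N M)) x = 0" "(shift D \<mu> ^^ (max N M)) y = 0"
    by (auto intro: funpow_zero_mono[OF clinear_shift[OF assms]])
  then have "(shift D \<mu> ^^ (max N M)) (x + y) = 0"
    by (simp add: clinear_simps clinear_shift_pow assms)
  then show "x + y \<in> gen_eig D \<mu>" by (auto simp: gen_eig_def)
next
  fix c x assume "x \<in> gen_eig D \<mu>"
  then show "c *s x \<in> gen_eig D \<mu>"
    by (auto simp: gen_eig_def clinear_simps clinear_shift_pow assms)
qed

lemma gen_eig_commute:
  assumes "clinear D" "clinear f" "\<And>v. f (D v) = D (f v)" "v \<in> gen_eig D \<mu>"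
  shows "f v \<in> gen_eig D \<mu>"
proof -
  obtain N where "(shift D \<mu> ^^ N) v = 0" using assms(4) by (auto simp: gen_eig_def)
  moreover have "(shift D \<mu> ^^ N) (f v) = f ((shift D \<mu> ^^ N) v)"
    by (rule funpow_commute_pointwise) (use shift_commute[OF assms(1-3)] in simp)
  ultimately show ?thesis using assms(2) by (auto simp: gen_eig_def vec.linear_0)
qed

text \<open>Going back from \<open>shift D \<mu> v\<close> to \<open>v\<close> costs one more power.
  This direction closes the induction in \<open>gen_eig_br\<close>.\<close>

lemma gen_eig_shift_iff:
  assumes "clinear D"
  shows "shift D \<mu> v \<in> gen_eig D \<mu> \<longleftrightarrow> v \<in> gen_eig D \<mu>"
proof
  assume "shift D \<mu> v \<in> gen_eig D \<mu>"
  then obtain N where "(shift D \<mu> ^^ N) (shift D \<mu> v) = 0" by (auto simp: gen_eig_def)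
  then have "(shift D \<mu> ^^ Suc N) v = 0" by (simp add: funpow_swap1)
  then show "v \<in> gen_eig D \<mu>" unfolding gen_eig_def by blast
next
  assume "v \<in> gen_eig D \<mu>"
  moreover have "shift D \<mu> (D v) = D (shift D \<mu> v)" for v
    using assms by (simp add: shift_def clinear_simps)
  ultimately show "shift D \<mu> v \<in> gen_eig D \<mu>"
    using gen_eig_commute[OF assms clinear_shift[OF assms]] by blast
qed

lemma gen_eig_shift:
  assumes "clinear D" "v \<in> gen_eig D \<mu>"
  shows "(shift D \<nu> ^^ k) v \<in> gen_eig D \<mu>"
proof (induction k)
  case (Suc k)
  show ?case
    by (simp, rule gen_eig_commute[OF assms(1) clinear_shift[OF assms(1)] _ Suc])
      (use assms(1) in \<open>simp add: shift_def clinear_simps\<close>)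
qed (use assms in simp)

lemma shift_pow_eigenvector:
  assumes "clinear D" "D v = \<nu> *s v"
  shows "(shift D \<mu> ^^ N) v = (\<nu> - \<mu>) ^ N *s v"
proof (induction N)
  case (Suc N)
  have "(shift D \<mu> ^^ Suc N) v = shift D \<mu> ((\<nu> - \<mu>) ^ N *s v)" using Suc by simp
  also have "\<dots> = (\<nu> - \<mu>) ^ N *s shift D \<mu> v"
    by (rule vec.linear_scale[OF clinear_shift[OF assms(1)]])
  also have "shift D \<mu> v = (\<nu> - \<mu>) *s v"
    by (simp add: shift_def assms(2) vec.scale_left_diff_distrib)
  finally have "(shift D \<mu> ^^ Suc N) v = (\<nu> - \<mu>) ^ N *s ((\<nu> - \<mu>) *s v)" .
  also have "\<dots> = (\<nu> - \<mu>) ^ Suc N *s v"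
    unfolding vec.scale_scale by (simp only: power_Suc mult.commute)
  finally show ?case .
qed simp

text \<open>The last nonzero vector among the powers of \<open>shift D \<nu>\<close> applied to
  \<open>v\<close> would be a \<nu>-eigenvector inside \<open>gen_eig D \<mu>\<close>. On it
  \<open>shift D \<mu>\<close> acts as the nonzero scalar \<nu> - \<mu>, so no power could
  annihilate it.\<close>

lemma gen_eig_inj:
  assumes D: "clinear D" and "\<nu> \<noteq> \<mu>" "v \<in> gen_eig D \<mu>" "(shift D \<nu> ^^ M) v = 0"
  shows "v = 0"
  using assms(4)
proof (induction M)
  case (Suc M)
  define w where "w = (shift D \<nu> ^^ M) v"
  have w: "w \<in> gen_eig D \<mu>" unfolding w_def by (rule gen_eig_shift[OF D assms(3)])
  have "shift D \<nu> w = 0" using Suc.prems by (simp add: w_def)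
  then have "D w = \<nu> *s w" by (simp add: shift_def)
  then have "(shift D \<mu> ^^ N) w = (\<nu> - \<mu>) ^ N *s w" for N
    using shift_pow_eigenvector[OF D, of w \<nu> N \<mu>] by simp
  moreover obtain N where "(shift D \<mu> ^^ N) w = 0" using w by (auto simp: gen_eig_def)
  ultimately have "(\<nu> - \<mu>) ^ N *s w = 0" by simp
  then have "w = 0" using assms(2) by simp
  then show ?case using Suc.IH w_def by simp
qed simp

text \<open>The maps \<open>shift D \<nu>\<close> and \<open>shift D \<mu>\<close> differ by the
  nonzero scalar \<mu> - \<nu>. By induction on the exponent \<open>shift D \<mu> v\<close> has a
  preimage \<open>w\<close> under \<open>shift D \<nu>\<close>, and then (v - w) / (\<mu> - \<nu>)
  is a preimage of \<open>v\<close>.\<close>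

lemma gen_eig_surj:
  assumes D: "clinear D" and "\<nu> \<noteq> \<mu>" "v \<in> gen_eig D \<mu>"
  shows "\<exists>w\<in>gen_eig D \<mu>. shift D \<nu> w = v"
proof -
  obtain N where "(shift D \<mu> ^^ N) v = 0" using assms(3) by (auto simp: gen_eig_def)
  then show ?thesis
  proof (induction N arbitrary: v)
    case 0
    then show ?case
      using vec.subspace_0[OF subspace_gen_eig[OF D]] vec.linear_0[OF clinear_shift[OF D]] by auto
  next
    case (Suc N)
    have v: "v \<in> gen_eig D \<mu>" using Suc.prems unfolding gen_eig_def by blast
    have "(shift D \<mu> ^^ N) (shift D \<mu> v) = 0" using Suc.prems by (simp add: funpow_swap1)
    then obtain w where w: "w \<in> gen_eig D \<mu>" "shift D \<nu> w = shift D \<mu> v" using Suc.IH by blast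
    define u where "u = inverse (\<mu> - \<nu>) *s (v - w)"
    have "u \<in> gen_eig D \<mu>" unfolding u_def
      using v w(1) subspace_gen_eig[OF D] by (intro vec.subspace_scale vec.subspace_diff)
    moreover have "shift D \<nu> u = v"
    proof -
      have "shift D \<nu> u = inverse (\<mu> - \<nu>) *s (shift D \<nu> v - shift D \<mu> v)"
        unfolding u_def using w(2) by (simp add: clinear_simps clinear_shift[OF D])
      also have "shift D \<nu> v - shift D \<mu> v = (\<mu> - \<nu>) *s v"
        by (simp add: shift_def vec.scale_left_diff_distrib)
      finally have "shift D \<nu> u = inverse (\<mu> - \<nu>) *s ((\<mu> - \<nu>) *s v)" .
      then show ?thesis using assms(2) unfolding vec.scale_scale by simp
    qed
    ultimately show ?case by blast
  qed
qed

text \<open>A power of \<open>shift D l\<close> kills the summand \<open>w l\<close> and keeps every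
  other summand in its own eigenspace. The shorter relation forces the images to vanish, and
  \<open>gen_eig_inj\<close> carries this back to the summands.\<close>

lemma gen_eig_independent:
  assumes D: "clinear D" and "finite L" "\<And>\<nu>. \<nu> \<in> L \<Longrightarrow> w \<nu> \<in> gen_eig D \<nu>" "(\<Sum>\<nu>\<in>L. w \<nu>) = 0"
    and "\<mu> \<in> L"
  shows "w \<mu> = 0"
  using assms(2-5)
proof (induction L arbitrary: w \<mu> rule: finite_induct)
  case (insert l L)
  obtain N where N: "(shift D l ^^ N) (w l) = 0" using insert.prems(1)[of l]
    by (auto simp: gen_eig_def)
  have lin: "clinear (shift D l ^^ N)" by (rule clinear_shift_pow[OF D])
  have *: "w \<nu> = 0" if "\<nu> \<in> L" for \<nu>
  proof -
    have "(\<Sum>\<nu>\<in>L. (shift D l ^^ N) (w \<nu>)) = (shift D l ^^ N) (\<Sum>\<nu>\<in>L. w \<nu>)"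
      by (simp add: vec.linear_sum[OF lin])
    also have "(\<Sum>\<nu>\<in>L. w \<nu>) = - w l"
      using insert.prems(2) insert.hyps by (simp add: eq_neg_iff_add_eq_0 add.commute)
    also have "(shift D l ^^ N) (- w l) = 0"
      using N by (simp add: vec.linear_neg[OF lin])
    finally have "(shift D l ^^ N) (w \<nu>) = 0"
      using insert.IH[of "\<lambda>\<nu>. (shift D l ^^ N) (w \<nu>)" \<nu>] insert.prems(1) that
        gen_eig_shift[OF D] by blast
    moreover have "l \<noteq> \<nu>" using insert.hyps that by auto
    ultimately show ?thesis using gen_eig_inj[OF D, of l \<nu> "w \<nu>" N] insert.prems(1) that by simp
  qed
  moreover have "w l = 0" using insert.prems(2) insert.hyps * by simp
  ultimately show ?case using insert.prems(3) by auto
qed simp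

text \<open>Dependence of a sequence, not of a set: a repeated vector shrinks the set of values but
  is itself a relation, with coefficients 1 and -1.\<close>

lemma lin_dependent_seq:
  fixes x :: "nat \<Rightarrow> complex^'n::finite"
  shows "\<exists>c. (\<exists>k\<le>CARD('n). c k \<noteq> 0) \<and> (\<Sum>k\<le>CARD('n). c k *s x k) = 0"
proof (cases "inj_on x {..CARD('n)}")
  case True
  have "vec.dim (x ` {..CARD('n)}) \<le> CARD('n)"
    using vec.dim_subset[OF subset_UNIV, of "x ` {..CARD('n)}"] by (simp only: vec_dim_card)
  then have "vec.dependent (x ` {..CARD('n)})"
    by (intro vec.dependent_biggerset_general) (simp add: card_image[OF True])
  then obtain u where u: "\<exists>v\<in>x ` {..CARD('n)}. u v \<noteq> 0" "(\<Sum>v\<in>x ` {..CARD('n)}. u v *s v) = 0"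
    by (subst (asm) vec.dependent_finite) auto
  then show ?thesis
    by (intro exI[of _ "\<lambda>k. u (x k)"]) (auto simp: sum.reindex[OF True])
next
  case False
  then obtain i j where ij: "i \<le> CARD('n)" "j \<le> CARD('n)" "i \<noteq> j" "x i = x j"
    by (auto simp: inj_on_def)
  define c where "c k = (if k = i then 1 else if k = j then -1 else (0::complex))" for k
  have "(\<Sum>k\<le>CARD('n). c k *s x k) = (\<Sum>k\<in>{i, j}. c k *s x k)"
    using ij by (intro sum.mono_neutral_right) (auto simp: c_def)
  also have "\<dots> = 0" using ij by (simp add: c_def)
  finally show ?thesis using ij(1) by (intro exI[of _ c]) (auto simp: c_def intro!: exI[of _ i])
qed

text \<open>The vector p(D) v. It serves to strip linear factors one at a time from a polynomial
  that annihilates \<open>v\<close>.\<close>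

definition poly_act :: "(complex^'n::finite \<Rightarrow> complex^'n) \<Rightarrow> complex poly \<Rightarrow> complex^'n \<Rightarrow> complex^'n"
  where "poly_act D p v = (\<Sum>k\<le>degree p. coeff p k *s (D ^^ k) v)"

lemma poly_act_eq:
  assumes "degree p \<le> n"
  shows "poly_act D p v = (\<Sum>k\<le>n. coeff p k *s (D ^^ k) v)"
  unfolding poly_act_def using assms
  by (intro sum.mono_neutral_left) (auto simp: coeff_eq_0)

lemma poly_act_root:
  assumes D: "clinear D"
  shows "poly_act D ([:- z, 1:] * q) v = shift D z (poly_act D q v)"
proof -
  have eq: "[:- z, 1:] * q = pCons 0 q - smult z q" by simp
  have "poly_act D ([:- z, 1:] * q) v
      = (\<Sum>k\<le>Suc (degree q). coeff (pCons 0 q - smult z q) k *s (D ^^ k) v)"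
    unfolding eq by (intro poly_act_eq degree_diff_le) (auto simp: degree_pCons_le intro: le_trans[OF degree_smult_le])
  also have "\<dots> = (\<Sum>k\<le>Suc (degree q). coeff (pCons 0 q) k *s (D ^^ k) v)
      - (\<Sum>k\<le>Suc (degree q). (z * coeff q k) *s (D ^^ k) v)"
    by (simp only: coeff_diff coeff_smult vec.scale_left_diff_distrib sum_subtractf)
  also have "(\<Sum>k\<le>Suc (degree q). coeff (pCons 0 q) k *s (D ^^ k) v)
      = D (\<Sum>k\<le>degree q. coeff q k *s (D ^^ k) v)"
    by (subst sum.atMost_Suc_shift) (simp add: vec.linear_sum[OF D] vec.linear_scale[OF D])
  also have "(\<Sum>k\<le>Suc (degree q). (z * coeff q k) *s (D ^^ k) v)
      = z *s (\<Sum>k\<le>degree q. coeff q k *s (D ^^ k) v)"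
    by (simp add: coeff_eq_0 vec.scale_sum_right)
  finally show ?thesis by (simp add: shift_def poly_act_def)
qed

text \<open>For \<mu> different from \<open>z\<close>, \<open>gen_eig D \<mu>\<close> lies in its
  own image under \<open>shift D z\<close>. So the span \<open>W\<close> lies in the image of
  \<open>W\<close> under \<open>shift D z\<close> plus \<open>gen_eig D z\<close>. If
  \<open>a\<close> in \<open>W\<close> is the preimage occurring in \<open>shift D z v\<close>, then
  v - a is mapped into \<open>gen_eig D z\<close> and hence belongs to it.\<close>

lemma span_gen_eig_shift:
  assumes D: "clinear D" and v: "shift D z v \<in> vec.span (\<Union>\<mu>. gen_eig D \<mu>)"
  shows "v \<in> vec.span (\<Union>\<mu>. gen_eig D \<mu>)"
proof -
  define W where "W = vec.span (\<Union>\<mu>. gen_eig D \<mu>)"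
  define U where "U = {shift D z a + b |a b. a \<in> W \<and> b \<in> gen_eig D z}"
  have W: "vec.subspace W" unfolding W_def by (rule vec.subspace_span)
  have W': "gen_eig D \<mu> \<subseteq> W" for \<mu> unfolding W_def using vec.span_superset by fastforce
  note E = subspace_gen_eig[OF D, of z]
  note S = clinear_shift[OF D, of z]
  have UI: "u \<in> U" if "u = shift D z a + b" "a \<in> W" "b \<in> gen_eig D z" for u a b
    using that unfolding U_def by blast
  have "vec.subspace U"
  proof (rule vec.subspaceI)
    show "0 \<in> U" by (rule UI[of _ 0 0]) (use W E in \<open>auto simp: vec.linear_0[OF S] vec.subspace_0\<close>)
  next
    fix x y assume "x \<in> U" "y \<in> U"
    then obtain a b a' b' where "x = shift D z a + b" "a \<in> W" "b \<in> gen_eig D z"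
      "y = shift D z a' + b'" "a' \<in> W" "b' \<in> gen_eig D z"
      unfolding U_def by blast
    then show "x + y \<in> U"
      by (intro UI[of _ "a + a'" "b + b'"]) (use W E in \<open>auto simp: vec.linear_add[OF S] vec.subspace_add\<close>)
  next
    fix c x assume "x \<in> U"
    then obtain a b where "x = shift D z a + b" "a \<in> W" "b \<in> gen_eig D z"
      unfolding U_def by blast
    then show "c *s x \<in> U"
      by (intro UI[of _ "c *s a" "c *s b"])
        (use W E in \<open>auto simp: vec.linear_scale[OF S] vec.subspace_scale vec.scale_right_distrib\<close>)
  qed
  moreover have "gen_eig D \<mu> \<subseteq> U" for \<mu>
  proof
    fix x assume x: "x \<in> gen_eig D \<mu>"
    show "x \<in> U"
    proof (cases "\<mu> = z")
      case True
      show ?thesis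
        by (rule UI[of _ 0 x]) (use x True vec.subspace_0[OF W] in \<open>auto simp: vec.linear_0[OF S]\<close>)
    next
      case False
      then obtain w where "w \<in> gen_eig D \<mu>" "shift D z w = x" using gen_eig_surj[OF D, of z \<mu> x] x
        by auto
      then show ?thesis
        by (intro UI[of _ w 0]) (use W' vec.subspace_0[OF E] in auto)
    qed
  qed
  ultimately have "W \<subseteq> U" unfolding W_def by (intro vec.span_minimal) auto
  then obtain a b where ab: "shift D z v = shift D z a + b" "a \<in> W" "b \<in> gen_eig D z"
    using v unfolding W_def[symmetric] U_def by blast
  then have "shift D z (v - a) \<in> gen_eig D z" by (simp add: vec.linear_diff[OF S])
  then have "v - a \<in> W" using W' gen_eig_shift_iff[OF D] by blast
  then have "v - a + a \<in> W" using ab(2) W vec.subspace_add by blast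
  then show ?thesis unfolding W_def by simp
qed

text \<open>The vectors v, D v, ... up to the power \<open>CARD('n)\<close> are one too many to be
  independent, so a nonzero polynomial kills \<open>v\<close>. Each root is removed by
  \<open>span_gen_eig_shift\<close>, until degree 0 leaves a nonzero multiple of
  \<open>v\<close>.\<close>

lemma span_gen_eig:
  fixes D :: "complex^'n::finite \<Rightarrow> complex^'n"
  assumes D: "clinear D"
  shows "vec.span (\<Union>\<mu>. gen_eig D \<mu>) = UNIV"
proof -
  define W where "W = vec.span (\<Union>\<mu>. gen_eig D \<mu>)"
  have W: "vec.subspace W" unfolding W_def by (rule vec.subspace_span)
  have *: "v \<in> W" if "p \<noteq> 0" "poly_act D p v \<in> W" for p v
    using that
  proof (induction "degree p" arbitrary: p)
    case 0
    then have "coeff p 0 *s v \<in> W" "coeff p 0 \<noteq> 0"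
      by (auto simp: poly_act_def) (metis 0 leading_coeff_0_iff)
    then have "inverse (coeff p 0) *s (coeff p 0 *s v) \<in> W" using W vec.subspace_scale by blast
    then show ?case using \<open>coeff p 0 \<noteq> 0\<close> by simp
  next
    case (Suc d)
    then have "\<not> constant (poly p)" by (simp add: constant_degree)
    then obtain z where "poly p z = 0" using fundamental_theorem_of_algebra by blast
    then obtain q where q: "p = [:- z, 1:] * q" by (auto simp: poly_eq_0_iff_dvd dvd_def)
    then have "q \<noteq> 0" using Suc.prems by auto
    moreover have "d = degree q"
      using Suc.hyps(2) \<open>q \<noteq> 0\<close> unfolding q by (subst (asm) degree_mult_eq) auto
    moreover have "poly_act D q v \<in> W"
      using Suc.prems(2) span_gen_eig_shift[OF D] unfolding q poly_act_root[OF D] W_def by blast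
    ultimately show ?case using Suc.hyps(1) by blast
  qed
  have "v \<in> W" for v
  proof -
    obtain c i where c: "i \<le> CARD('n)" "c i \<noteq> 0" "(\<Sum>k\<le>CARD('n). c k *s (D ^^ k) v) = 0"
      using lin_dependent_seq[of "\<lambda>k. (D ^^ k) v"] by blast
    define p where "p = (\<Sum>k\<le>CARD('n). monom (c k) k)"
    have cf: "coeff p k = (if k \<le> CARD('n) then c k else 0)" for k
      unfolding p_def by (simp add: coeff_sum)
    have "p \<noteq> 0" using cf[of i] c by auto
    moreover have "degree p \<le> CARD('n)" by (rule degree_le) (simp add: cf)
    then have "poly_act D p v = 0" using c(3) by (simp add: poly_act_eq cf)
    ultimately show ?thesis using * vec.subspace_0[OF W] by metis
  qed
  then show ?thesis unfolding W_def by blast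
qed

lemma gen_eig_basis:
  fixes D :: "complex^'n::finite \<Rightarrow> complex^'n"
  assumes "clinear D"
  shows "\<exists>B \<mu>. finite B \<and> vec.independent B \<and> vec.span B = UNIV \<and> card B = CARD('n) \<and>
    (\<forall>b\<in>B. b \<in> gen_eig D (\<mu> b))"
proof -
  obtain B where B: "B \<subseteq> (\<Union>\<mu>. gen_eig D \<mu>)" "vec.independent B" "(\<Union>\<mu>. gen_eig D \<mu>) \<subseteq> vec.span B"
    by (rule vec.maximal_independent_subset)
  have sp: "vec.span B = UNIV"
    using vec.span_mono[OF B(3)] unfolding span_gen_eig[OF assms] vec.span_span by blast
  have "\<forall>b\<in>B. \<exists>\<mu>. b \<in> gen_eig D \<mu>" using B(1) by blast
  then obtain \<mu> where \<mu>: "\<And>b. b \<in> B \<Longrightarrow> b \<in> gen_eig D (\<mu> b)" by metis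
  have "vec.dim (vec.span B) = card B"
    using vec.dim_eq_card_independent[OF B(2)] by (simp only: vec.dim_span)
  then have "card B = CARD('n)" by (simp only: sp vec_dim_card)
  then show ?thesis using vec.finiteI_independent[OF B(2)] B(2) sp \<mu> by metis
qed

text \<open>\<open>E\<close> is \<open>h\<close> applied to the semisimple part of \<open>D\<close>.
  It is prescribed on an adapted basis; that every generalised eigenvector is scaled accordingly
  rests on the uniqueness of its decomposition.\<close>

lemma gen_eig_operator:
  fixes D :: "complex^'a::finite \<Rightarrow> complex^'a"
  assumes D: "clinear D"
  shows "\<exists>E. clinear E \<and> (\<forall>\<mu>. \<forall>v\<in>gen_eig D \<mu>. E v = h \<mu> *s v)"
proof -
  obtain B m where B: "finite B" "vec.independent B" "vec.span B = UNIV" "card B = CARD('a)"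
    and m: "\<And>b. b \<in> B \<Longrightarrow> b \<in> gen_eig D (m b)"
    using gen_eig_basis[OF D] by blast
  obtain E where E: "clinear E" "\<forall>b\<in>B. E b = h (m b) *s b"
    using vec.linear_independent_extend[OF B(2), of "\<lambda>b. h (m b) *s b"] by blast
  have "E v = h \<mu> *s v" if v: "v \<in> gen_eig D \<mu>" for \<mu> v
  proof -
    have "v \<in> range (\<lambda>c. \<Sum>b\<in>B. c b *s b)"
      unfolding vec.span_finite[OF B(1), symmetric] B(3) by simp
    then obtain c where c: "v = (\<Sum>b\<in>B. c b *s b)" by (rule rangeE)
    \<comment> \<open>No basis vector need carry the label \<mu>, so it is added by hand.\<close>
    define L where "L = insert \<mu> (m ` B)"
    define w where "w l = (\<Sum>b\<in>{b\<in>B. m b = l}. c b *s b)" for l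
    \<comment> \<open>The rival decomposition of \<open>v\<close>, concentrated at \<mu>;
      independence identifies it with \<open>w\<close>.\<close>
    define w' where "w' l = (if l = \<mu> then v else 0)" for l
    have fin: "finite L" unfolding L_def using B(1) by simp
    have grp: "(\<Sum>l\<in>L. \<Sum>b\<in>{b\<in>B. m b = l}. f b) = sum f B" for f :: "_ \<Rightarrow> complex^'a"
      by (rule sum.group[OF B(1) fin]) (auto simp: L_def)
    have sw: "(\<Sum>l\<in>L. w l) = v" unfolding w_def grp by (rule c[symmetric])
    have sw': "(\<Sum>l\<in>L. w' l) = v" unfolding w'_def using fin by (simp add: sum.delta L_def)
    have "w l - w' l \<in> gen_eig D l" for l
      unfolding w_def w'_def
      by (intro vec.subspace_diff vec.subspace_sum subspace_gen_eig D)
        (use m v vec.subspace_scale[OF subspace_gen_eig[OF D]] vec.subspace_0[OF subspace_gen_eig[OF D]] in auto)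
    moreover have "(\<Sum>l\<in>L. w l - w' l) = 0" by (simp add: sum_subtractf sw sw')
    ultimately have eq: "w l = w' l" if "l \<in> L" for l
      using gen_eig_independent[OF D fin, of "\<lambda>l. w l - w' l" l] that by simp
    have "E v = (\<Sum>b\<in>B. c b *s (h (m b) *s b))"
      unfolding c vec.linear_sum[OF E(1)] vec.linear_scale[OF E(1)] using E(2) by simp
    also have "\<dots> = (\<Sum>l\<in>L. \<Sum>b\<in>{b\<in>B. m b = l}. c b *s (h (m b) *s b))" by (rule grp[symmetric])
    also have "\<dots> = (\<Sum>l\<in>L. h l *s w l)"
      unfolding w_def by (intro sum.cong) (auto simp: vec.scale_sum_right mult.commute)
    also have "\<dots> = (\<Sum>l\<in>L. if l = \<mu> then h \<mu> *s v else 0)"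
      by (intro sum.cong) (auto simp: eq w'_def)
    also have "\<dots> = h \<mu> *s v" using fin by (simp add: sum.delta L_def)
    finally show ?thesis .
  qed
  then show ?thesis using E(1) by blast
qed

lemma finite_uniform_power:
  fixes f :: "complex^'n::finite \<Rightarrow> complex^'n"
  assumes "clinear f" "finite B" "\<And>b. b \<in> B \<Longrightarrow> \<exists>N. (f ^^ N) b = 0" "vec.span B = UNIV"
  shows "\<exists>N. \<forall>v. (f ^^ N) v = 0"
proof -
  obtain N where N: "\<And>b. b \<in> B \<Longrightarrow> (f ^^ N b) b = 0" using assms(3) by metis
  define M where "M = Max (insert 0 (N ` B))"
  have "(f ^^ M) b = 0" if "b \<in> B" for b
    by (rule funpow_zero_mono[OF assms(1) N[OF that]]) (use that assms(2) in \<open>simp add: M_def\<close>)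
  then have "(f ^^ M) v = 0" for v
    using clinear_span_induct[OF clinear_funpow[OF assms(1)] vec.subspace_single_0, of B M v] assms(4)
    by auto
  then show ?thesis by blast
qed

text \<open>\<open>lin_trace\<close> knows only the standard basis. With \<open>P\<close> sending
  that basis to \<open>B\<close> and \<open>Q\<close> undoing this, cyclicity turns the trace of
  \<open>M\<close> into that of \<open>Q \<circ> (M \<circ> P)\<close>, which is diagonal in the
  standard basis.\<close>

lemma lin_trace_diag:
  fixes M :: "complex^'n::finite \<Rightarrow> complex^'n"
  assumes M: "clinear M" and B: "finite B" "vec.independent B" "vec.span B = UNIV" "card B
      = CARD('n)"
    and d: "\<And>b. b \<in> B \<Longrightarrow> M b = d b *s b"
  shows "lin_trace M = (\<Sum>b\<in>B. d b)"
proof -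
  obtain \<pi> :: "'n \<Rightarrow> complex^'n" where \<pi>: "bij_betw \<pi> UNIV B"
    using finite_same_card_bij[of "UNIV :: 'n set" B] B(1,4) by auto
  define P where "P x = (\<Sum>i\<in>UNIV. x $ i *s \<pi> i)" for x :: "complex^'n"
  have P: "clinear P" unfolding P_def
    by (rule clinearI)
      (auto simp: vec.scale_left_distrib sum.distrib vec.scale_sum_right)
  have Pax: "P (axis i 1) = \<pi> i" for i
    unfolding P_def by (simp add: axis_def if_distrib[of "\<lambda>c. c *s _"] sum.delta cong: if_cong)
  obtain Q where Q: "clinear Q" "\<forall>b\<in>B. Q b = axis (inv_into UNIV \<pi> b) 1"
    using vec.linear_independent_extend[OF B(2), of "\<lambda>b. axis (inv_into UNIV \<pi> b) 1"] by blast
  have inv: "inv_into UNIV \<pi> (\<pi> i) = i" for i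
    using \<pi> by (simp add: bij_betw_def inv_into_f_f)
  have \<pi>B: "\<pi> i \<in> B" for i using \<pi> by (auto simp: bij_betw_def)
  have "P (Q b) = b" if b: "b \<in> B" for b
  proof -
    obtain i where "b = \<pi> i" using \<pi> b by (auto simp: bij_betw_def)
    then show ?thesis using Q(2) \<pi>B inv Pax by simp
  qed
  then have PQ: "P (Q v) = v" for v
    using vec.linear_eq_on[OF Vector_Spaces.linear_compose[OF Q(1) P] vec.linear_ident, of v B] B(3)
    by auto
  have MP: "clinear (M \<circ> P)" using Vector_Spaces.linear_compose[OF P M] .
  have "M = (M \<circ> P) \<circ> Q" using PQ by auto
  then have "lin_trace M = lin_trace (Q \<circ> (M \<circ> P))"
    using lin_trace_comm[OF MP Q(1)] by simp
  also have "\<dots> = (\<Sum>i\<in>UNIV. d (\<pi> i))"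
    unfolding lin_trace_def
    by (intro sum.cong) (simp_all add: Pax d[OF \<pi>B] vec.linear_scale[OF Q(1)] Q(2) \<pi>B inv)
  also have "\<dots> = (\<Sum>b\<in>B. d b)" using \<pi> by (rule sum.reindex_bij_betw)
  finally show ?thesis .
qed

text \<open>The trace in the hypothesis is the sum of the squared moduli of the eigenvalues of \<open>D\<close>.\<close>

lemma nilpotent_if_trace_conj_zero:
  fixes D E :: "complex^'n::finite \<Rightarrow> complex^'n"
  assumes D: "clinear D" and E: "clinear E"
    and Ev: "\<And>\<mu> v. v \<in> gen_eig D \<mu> \<Longrightarrow> E v = cnj \<mu> *s v"
    and tr: "lin_trace (D \<circ> E) = 0"
  shows "\<exists>N. \<forall>v. (D ^^ N) v = 0"
proof -
  obtain B m where B: "finite B" "vec.independent B" "vec.span B = UNIV" "card B = CARD('n)"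
    and m: "\<And>b. b \<in> B \<Longrightarrow> b \<in> gen_eig D (m b)"
    using gen_eig_basis[OF D] by blast
  obtain M where M: "clinear M" "\<And>\<mu> v. v \<in> gen_eig D \<mu> \<Longrightarrow> M v = (\<mu> * cnj \<mu>) *s v"
    using gen_eig_operator[OF D, of "\<lambda>\<mu>. \<mu> * cnj \<mu>"] by blast
  \<comment> \<open>\<open>M\<close> is the semisimple part of \<open>D \<circ> E\<close>: on
    \<open>gen_eig D \<mu>\<close> the difference is a multiple of \<open>shift D \<mu>\<close>,
    hence nilpotent, and so the two traces agree.\<close>
  define F where "F v = (D \<circ> E) v - M v" for v
  have DE: "clinear (D \<circ> E)" using Vector_Spaces.linear_compose[OF E D] .
  have F: "clinear F" unfolding F_def by (rule vec.linear_compose_sub[OF DE M(1)])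
  have Fv: "F v = cnj \<mu> *s shift D \<mu> v" if "v \<in> gen_eig D \<mu>" for \<mu> v
    using that by (simp add: F_def Ev M(2) vec.linear_scale[OF D] shift_def
        vec.scale_right_diff_distrib mult.commute)
  have Fpow: "(F ^^ k) v = cnj \<mu> ^ k *s (shift D \<mu> ^^ k) v" if "v \<in> gen_eig D \<mu>" for \<mu> v k
  proof (induction k)
    case (Suc k)
    have "(F ^^ Suc k) v = cnj \<mu> ^ k *s F ((shift D \<mu> ^^ k) v)"
      using Suc by (simp add: vec.linear_scale[OF F])
    also have "F ((shift D \<mu> ^^ k) v) = cnj \<mu> *s (shift D \<mu> ^^ Suc k) v"
      using Fv[OF gen_eig_shift[OF D that]] by simp
    finally show ?case by (simp add: mult.commute)
  qed simp
  have "\<exists>N. (F ^^ N) b = 0" if b: "b \<in> B" for b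
  proof -
    obtain N where "(shift D (m b) ^^ N) b = 0" using m[OF b] by (auto simp: gen_eig_def)
    then show ?thesis using Fpow[OF m[OF b], of N] by (intro exI[of _ N]) simp
  qed
  then obtain N where "\<And>v. (F ^^ N) v = 0"
    using finite_uniform_power[OF F B(1) _ B(3)] by blast
  then have "lin_trace F = 0" by (rule lin_trace_nilpotent[OF F])
  moreover have "lin_trace F = lin_trace (D \<circ> E) - lin_trace M"
    unfolding F_def by (rule lin_trace_diff)
  ultimately have "lin_trace M = 0" using tr by simp
  then have "(\<Sum>b\<in>B. m b * cnj (m b)) = 0"
    using lin_trace_diag[OF M(1) B, of "\<lambda>b. m b * cnj (m b)"] M(2)[OF m] by simp
  then have "of_real (\<Sum>b\<in>B. (cmod (m b))\<^sup>2) = (0::complex)"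
    by (simp only: of_real_sum complex_norm_square)
  then have "(\<Sum>b\<in>B. (cmod (m b))\<^sup>2) = 0" by (simp only: of_real_eq_0_iff)
  then have m0: "m b = 0" if "b \<in> B" for b
    using that B(1) by (subst (asm) sum_nonneg_eq_0_iff) auto
  have "\<exists>N. (D ^^ N) b = 0" if "b \<in> B" for b
  proof -
    have "shift D 0 = D" by (auto simp: shift_def)
    then show ?thesis using m[OF that] m0[OF that] by (auto simp: gen_eig_def)
  qed
  then show ?thesis using finite_uniform_power[OF D B(1) _ B(3)] by blast
qed

section \<open>Lie algebras and the Killing form\<close>

text \<open>Jacobi is put as the derivation rule for \<open>br x\<close>, the form in which it
  arises from the group and is used below.\<close>

locale complex_lie_algebra =
  fixes br :: "complex^'n::finite \<Rightarrow> complex^'n \<Rightarrow> complex^'n"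
  assumes linear_left: "\<And>y. clinear (\<lambda>x. br x y)"
    and linear_right: "\<And>x. clinear (br x)"
    and alternating: "\<And>x. br x x = 0"
    and jacobi: "\<And>x y z. br x (br y z) = br (br x y) z + br y (br x z)"
begin

lemmas br_simps = vec.linear_add[OF linear_left] vec.linear_scale[OF linear_left]
  vec.linear_diff[OF linear_left] vec.linear_neg[OF linear_left] vec.linear_0[OF linear_left]
  vec.linear_add[OF linear_right] vec.linear_scale[OF linear_right]
  vec.linear_diff[OF linear_right] vec.linear_neg[OF linear_right] vec.linear_0[OF linear_right]

lemma br_anti: "br x y = - br y x"
proof -
  have "br (x + y) (x + y) = br x x + br y x + (br x y + br y y)"
    by (simp only: br_simps)
  then have "br x y + br y x = 0" unfolding alternating by (simp add: add.commute)
  then show ?thesis by (simp only: eq_neg_iff_add_eq_0)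
qed

definition killing :: "complex^'n \<Rightarrow> complex^'n \<Rightarrow> complex"
  where "killing x y = lin_trace (br x \<circ> br y)"

lemma killing_add: "killing (x + y) z = killing x z + killing y z"
  unfolding killing_def comp_def br_simps by (rule lin_trace_add)

lemma killing_scale: "killing (c *s x) z = c * killing x z"
  unfolding killing_def comp_def br_simps by (rule lin_trace_cmult)

lemma killing_sym: "killing x y = killing y x"
  unfolding killing_def by (rule lin_trace_comm[OF linear_right linear_right])

lemma linear_right_comp: "clinear (br x \<circ> br y)"
  by (rule Vector_Spaces.linear_compose[OF linear_right linear_right])

text \<open>For a derivation, E \<circ> ad b - ad b \<circ> E = ad (E b). Expanding ad [a, b] as a
  commutator and cycling the trace leaves minus the trace of ad a \<circ> ad (E b). An inner
  \<open>E\<close> gives invariance of the Killing form; the conjugation operator gives nilpotency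
  on the derived radical.\<close>

lemma trace_commutator_derivation:
  assumes E: "clinear E" "\<And>a b. E (br a b) = br (E a) b + br a (E b)"
  shows "lin_trace (br (br a b) \<circ> E) = - killing a (E b)"
proof -
  note aE = Vector_Spaces.linear_compose[OF E(1) linear_right[of a]]
  have "br (br a b) \<circ> E = (\<lambda>x. (br a \<circ> br b \<circ> E) x - (br b \<circ> (br a \<circ> E)) x)"
    by (rule ext) (simp add: jacobi[of a b])
  then have "lin_trace (br (br a b) \<circ> E)
      = lin_trace (br a \<circ> br b \<circ> E) - lin_trace (br b \<circ> (br a \<circ> E))"
    by (simp only: lin_trace_diff)
  also have "lin_trace (br b \<circ> (br a \<circ> E)) = lin_trace ((br a \<circ> E) \<circ> br b)"
    by (rule lin_trace_comm[OF linear_right aE])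
  also have "lin_trace (br a \<circ> br b \<circ> E) - lin_trace ((br a \<circ> E) \<circ> br b)
      = lin_trace (\<lambda>x. (br a \<circ> br b \<circ> E) x - ((br a \<circ> E) \<circ> br b) x)"
    by (rule lin_trace_diff[symmetric])
  also have "(\<lambda>x. (br a \<circ> br b \<circ> E) x - ((br a \<circ> E) \<circ> br b) x)
      = (\<lambda>x. (-1) *s (br a \<circ> br (E b)) x)"
    by (auto simp: E(2) br_simps)
  also have "lin_trace (\<lambda>x. (-1) *s (br a \<circ> br (E b)) x) = - killing a (E b)"
    by (simp add: lin_trace_cmult killing_def del: vec.scale_minus_left comp_apply)
  finally show ?thesis .
qed

lemma killing_invariant: "killing (br a b) y = - killing b (br a y)"
proof -
  have "br y (br b x) = br (br y b) x + br b (br y x)" for b x by (rule jacobi)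
  then have "lin_trace (br (br b a) \<circ> br y) = - killing b (br y a)"
    by (intro trace_commutator_derivation linear_right)
  then have "killing (br b a) y = - killing b (br y a)" by (simp only: killing_def)
  also have "br b a = (-1) *s br a b" using br_anti[of b a] by simp
  also have "br y a = (-1) *s br a y" using br_anti[of y a] by simp
  finally show ?thesis
    unfolding killing_scale killing_sym[of b "(-1) *s br a y"] killing_sym[of "br a y" b]
    by (simp add: minus_equation_iff)
qed

text \<open>Shifting [x, y] by \<nu> + \<mu> gives [shift x, y] + [x, shift y], with
  \<open>x\<close> shifted by \<nu> and \<open>y\<close> by \<mu>. Each term lowers one exponent, so
  induction on the sum of the exponents replaces the binomial formula.\<close>

lemma gen_eig_br:
  assumes D: "clinear D" "\<And>a b. D (br a b) = br (D a) b + br a (D b)"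
    and "x \<in> gen_eig D \<nu>" "y \<in> gen_eig D \<mu>"
  shows "br x y \<in> gen_eig D (\<nu> + \<mu>)"
proof -
  obtain N M where "(shift D \<nu> ^^ N) x = 0" "(shift D \<mu> ^^ M) y = 0"
    using assms(3,4) by (auto simp: gen_eig_def)
  then show ?thesis
  proof (induction "N + M" arbitrary: N M x y)
    case 0
    then have "br x y = 0" by (simp add: br_simps)
    then show ?case using vec.subspace_0[OF subspace_gen_eig[OF D(1)]] by simp
  next
    case (Suc k)
    note E = subspace_gen_eig[OF D(1), of "\<nu> + \<mu>"]
    have 1: "br (shift D \<nu> x) y \<in> gen_eig D (\<nu> + \<mu>)"
    proof (cases N)
      case 0
      then have "shift D \<nu> x = 0" using Suc.prems(1) vec.linear_0[OF clinear_shift[OF D(1)]] by simp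
      then show ?thesis using vec.subspace_0[OF E] by (simp add: br_simps)
    next
      case (Suc N')
      then have "(shift D \<nu> ^^ N') (shift D \<nu> x) = 0" using Suc.prems(1) by (simp add: funpow_swap1)
      then show ?thesis using Suc.hyps(1)[of N' M] Suc Suc.hyps(2) Suc.prems(2) by auto
    qed
    have 2: "br x (shift D \<mu> y) \<in> gen_eig D (\<nu> + \<mu>)"
    proof (cases M)
      case 0
      then have "shift D \<mu> y = 0" using Suc.prems(2) vec.linear_0[OF clinear_shift[OF D(1)]] by simp
      then show ?thesis using vec.subspace_0[OF E] by (simp add: br_simps)
    next
      case (Suc M')
      then have "(shift D \<mu> ^^ M') (shift D \<mu> y) = 0" using Suc.prems(2) by (simp add: funpow_swap1)
      then show ?thesis using Suc.hyps(1)[of N M'] Suc Suc.hyps(2) Suc.prems(1) by auto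
    qed
    have "shift D (\<nu> + \<mu>) (br x y) = br (shift D \<nu> x) y + br x (shift D \<mu> y)"
      by (simp add: shift_def D(2) br_simps vec.scale_left_distrib)
    then have "shift D (\<nu> + \<mu>) (br x y) \<in> gen_eig D (\<nu> + \<mu>)"
      using vec.subspace_add[OF E 1 2] by simp
    then show ?case using gen_eig_shift_iff[OF D(1)] by blast
  qed
qed

text \<open>The defect \<open>F\<close> of the derivation rule is bilinear, so it may be tested on
  generalised eigenvectors. There the bracket has weight \<nu> + \<mu>, and the rule becomes
  additivity of \<open>h\<close>.\<close>

lemma derivation_on_gen_eig:
  assumes D: "clinear D" "\<And>a b. D (br a b) = br (D a) b + br a (D b)"
    and E: "clinear E" "\<And>\<mu> v. v \<in> gen_eig D \<mu> \<Longrightarrow> E v = h \<mu> *s v"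
    and h: "\<And>a b. h (a + b) = h a + h b"
  shows "E (br a b) = br (E a) b + br a (E b)"
proof -
  define F where "F a b = E (br a b) - br (E a) b - br a (E b)" for a b
  have lin_r: "clinear (F a)" for a
    unfolding F_def
    by (rule clinearI)
      (simp_all add: br_simps clinear_simps E(1) vec.scale_right_distrib vec.scale_right_diff_distrib)
  have lin_l: "clinear (\<lambda>a. F a b)" for b
    unfolding F_def
    by (rule clinearI)
      (simp_all add: br_simps clinear_simps E(1) vec.scale_right_distrib vec.scale_right_diff_distrib)
  have 0: "F a b = 0" if "a \<in> gen_eig D \<nu>" "b \<in> gen_eig D \<mu>" for a b \<nu> \<mu>
    using gen_eig_br[OF D that] that
    by (simp add: F_def E(2) h br_simps vec.scale_left_distrib)
  have 1: "F a b = 0" if "a \<in> gen_eig D \<nu>" for a b \<nu>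
    using clinear_span_induct[OF lin_r vec.subspace_single_0, of "\<Union>\<mu>. gen_eig D \<mu>" a b]
      0[OF that] span_gen_eig[OF D(1)] by auto
  have "F a b = 0"
    using clinear_span_induct[OF lin_l vec.subspace_single_0, of "\<Union>\<mu>. gen_eig D \<mu>" b a]
      1 span_gen_eig[OF D(1)] by auto
  then show ?thesis by (simp add: F_def algebra_simps)
qed

section \<open>Cartan's criterion for the radical of the Killing form\<close>

definition killing_radical :: "(complex^'n) set"
  where "killing_radical = {x. \<forall>y. killing x y = 0}"

lemma ideal_killing_radical: "lie_ideal br killing_radical"
proof -
  have "vec.subspace killing_radical"
  proof (rule vec.subspaceI)
    show "0 \<in> killing_radical" using killing_scale[of 0 0] by (simp add: killing_radical_def)
  qed (auto simp: killing_radical_def killing_add killing_scale)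
  then show ?thesis by (auto simp: lie_ideal_def killing_radical_def killing_invariant)
qed

text \<open>By \<open>trace_commutator_derivation\<close> a generator [a, b] contributes minus
  \<open>killing a (E b)\<close>, which vanishes because \<open>a\<close> lies in the radical,
  wherever \<open>E b\<close> lies.\<close>

lemma derived_killing_radical_nilpotent:
  assumes x: "x \<in> derived_algebra br killing_radical"
  shows "\<exists>N. \<forall>v. (br x ^^ N) v = 0"
proof -
  obtain E where E: "clinear E" "\<And>\<mu> v. v \<in> gen_eig (br x) \<mu> \<Longrightarrow> E v = cnj \<mu> *s v"
    using gen_eig_operator[OF linear_right, of x cnj] by blast
  have der: "E (br a b) = br (E a) b + br a (E b)" for a b
    by (rule derivation_on_gen_eig[OF linear_right jacobi E]) auto
  \<comment> \<open>\<open>E\<close> belongs to the given element and stays fixed; the bound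
    variable ranges over all elements whose trace against this \<open>E\<close> vanishes.\<close>
  have "vec.subspace {x. lin_trace (br x \<circ> E) = 0}"
  proof (rule vec.subspaceI)
    show "0 \<in> {x. lin_trace (br x \<circ> E) = 0}" by (simp add: lin_trace_def br_simps)
  qed (auto simp: comp_def br_simps lin_trace_add lin_trace_cmult)
  then have "derived_algebra br killing_radical \<subseteq> {x. lin_trace (br x \<circ> E) = 0}"
    unfolding derived_algebra_def
    by (rule vec.span_minimal[rotated])
      (auto simp: trace_commutator_derivation[OF E(1) der] killing_radical_def)
  then have "lin_trace (br x \<circ> E) = 0" using x by blast
  then show ?thesis using nilpotent_if_trace_conj_zero[OF linear_right E] by blast
qed

section \<open>Engel's theorem for the adjoint action\<close>

definition act :: "(complex^'n) set \<Rightarrow> (complex^'n) set \<Rightarrow> (complex^'n) set"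
  where "act M V = vec.span {br m v |m v. m \<in> M \<and> v \<in> V}"

lemma subspace_act: "vec.subspace (act M V)"
  unfolding act_def by (rule vec.subspace_span)

lemma act_memI: "m \<in> M \<Longrightarrow> v \<in> V \<Longrightarrow> br m v \<in> act M V"
  unfolding act_def by (rule vec.span_base) blast

lemma act_subset:
  assumes "vec.subspace W" "\<And>m v. m \<in> M \<Longrightarrow> v \<in> V \<Longrightarrow> br m v \<in> W"
  shows "act M V \<subseteq> W"
  unfolding act_def by (rule vec.span_minimal) (use assms in auto)

lemma act_mono: "M \<subseteq> M' \<Longrightarrow> V \<subseteq> V' \<Longrightarrow> act M V \<subseteq> act M' V'"
  by (rule act_subset[OF subspace_act]) (auto intro: act_memI)

lemma subspace_act_pow: "vec.subspace ((act M ^^ k) UNIV)"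
  by (cases k) (auto simp: subspace_act)

lemma act_pow_decseq: "(act M ^^ Suc k) UNIV \<subseteq> (act M ^^ k) UNIV"
  by (induction k) (auto intro: act_mono[THEN subsetD])

text \<open>Since [x, [m, v]] = [[x, m], v] + [m, [x, v]], an element that normalises
  \<open>M\<close> preserves every term of the chain.\<close>

lemma act_pow_invariant:
  assumes "\<And>m. m \<in> M \<Longrightarrow> br x m \<in> M" "v \<in> (act M ^^ k) UNIV"
  shows "br x v \<in> (act M ^^ k) UNIV"
  using assms(2)
proof (induction k arbitrary: v)
  case (Suc k)
  let ?V = "(act M ^^ k) UNIV"
  have "vec.subspace {v. br x v \<in> act M ?V}"
    by (rule vec.linear_subspace_linear_preimage[OF linear_right subspace_act])
  then have "act M ?V \<subseteq> {v. br x v \<in> act M ?V}"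
  proof (rule act_subset)
    fix m v assume "m \<in> M" "v \<in> ?V"
    then have "br (br x m) v + br m (br x v) \<in> act M ?V"
      by (intro vec.subspace_add subspace_act act_memI assms(1) Suc.IH)
    then show "br m v \<in> {v. br x v \<in> act M ?V}" by (simp add: jacobi[of x m])
  qed
  then show ?case using Suc.prems by auto
qed simp

text \<open>The k-th term of the chain is spanned by the values of all k-fold products of operators
  ad m. So long products of different elements have to vanish, which is more than nilpotency of each
  single one; Engel's theorem bridges this gap.\<close>

definition acts_nilpotently :: "(complex^'n) set \<Rightarrow> bool"
  where "acts_nilpotently M \<longleftrightarrow> (\<exists>k. (act M ^^ k) UNIV = {0})"

text \<open>\<open>M\<close> acts as zero on each quotient of \<open>V i\<close> by
  \<open>V (Suc i)\<close>, so there \<open>m + c *s x\<close> acts as a multiple of ad x, and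
  \<open>n\<close> steps give zero. If the chain of \<open>M\<close> reaches zero after
  \<open>k\<close> steps, the new one does after n * k.\<close>

lemma acts_nilpotently_extend:
  assumes M: "vec.subspace M" "acts_nilpotently M"
    and x: "\<And>m. m \<in> M \<Longrightarrow> br x m \<in> M" "\<And>v. (br x ^^ n) v = 0"
  shows "acts_nilpotently {m + c *s x |m c. m \<in> M}"
proof -
  define M' where "M' = {m + c *s x |m c. m \<in> M}"
  define V where "V i = (act M ^^ i) UNIV" for i
  have V: "vec.subspace (V i)" for i unfolding V_def by (rule subspace_act_pow)
  have xV: "br x v \<in> V i" if "v \<in> V i" for v i
    using act_pow_invariant[OF x(1)] that unfolding V_def by blast
  have xV': "(br x ^^ j) v \<in> V i" if "v \<in> V i" for v i j
    by (induction j) (use that xV in auto)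
  have MV: "br m v \<in> V (Suc i)" if "m \<in> M" "v \<in> V i" for m v i
    using act_memI[OF that] unfolding V_def by simp
  have V_dec: "V (Suc i) \<subseteq> V i" for i
    unfolding V_def by (rule act_pow_decseq)
  \<comment> \<open>Computing modulo \<open>V (Suc i)\<close>: after \<open>j\<close> steps only the
    j-th power of ad x survives.\<close>
  have step: "(act M' ^^ j) (V i) \<subseteq> {w + (br x ^^ j) v |w v. w \<in> V (Suc i) \<and> v \<in> V i}" for i j
  proof (induction j)
    case 0
    have "v = 0 + (br x ^^ 0) v" for v by simp
    then show ?case using vec.subspace_0[OF V] by fastforce
  next
    case (Suc j)
    let ?W = "\<lambda>j. {w + (br x ^^ j) v |w v. w \<in> V (Suc i) \<and> v \<in> V i}"
    have lin: "clinear (br x ^^ j)" for j by (rule clinear_funpow[OF linear_right])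
    have W: "vec.subspace (?W j)" for j
    proof -
      have "?W j = {w + u |w u. w \<in> V (Suc i) \<and> u \<in> (br x ^^ j) ` V i}" by blast
      then show ?thesis
        using vec.subspace_sums[OF V vec.linear_subspace_image[OF lin V]] by simp
    qed
    have "act M' ((act M' ^^ j) (V i)) \<subseteq> act M' (?W j)" by (rule act_mono[OF subset_refl Suc])
    also have "\<dots> \<subseteq> ?W (Suc j)"
    proof (rule act_subset[OF W])
      fix a b assume "a \<in> M'" "b \<in> ?W j"
      then obtain m c w v where a: "a = m + c *s x" "m \<in> M"
        and b: "b = w + (br x ^^ j) v" "w \<in> V (Suc i)" "v \<in> V i"
        unfolding M'_def by blast
      have "br a b = (br m w + br m ((br x ^^ j) v) + c *s br x w) + (br x ^^ Suc j) (c *s v)"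
        by (simp add: a(1) b(1) br_simps clinear_simps lin vec.scale_right_distrib add_ac)
      moreover have "br m w + br m ((br x ^^ j) v) + c *s br x w \<in> V (Suc i)"
        using MV[OF a(2) b(2)] V_dec MV[OF a(2) xV'[OF b(3)]] xV[OF b(2)] V
        by (intro vec.subspace_add vec.subspace_scale) auto
      moreover have "c *s v \<in> V i" using V b(3) vec.subspace_scale by blast
      ultimately show "br a b \<in> ?W (Suc j)" by blast
    qed
    finally show ?case by simp
  qed
  have "(act M' ^^ n) (V i) \<subseteq> V (Suc i)" for i
    using step[of n i] x(2) by auto
  moreover have mono: "(act M' ^^ n) A \<subseteq> (act M' ^^ n) B" if "A \<subseteq> B" for A B n
    by (induction n) (use that in \<open>auto intro: act_mono[THEN subsetD, OF subset_refl]\<close>)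
  ultimately have "(act M' ^^ (n * i)) UNIV \<subseteq> V i" for i
  proof (induction i)
    case (Suc i)
    have "(act M' ^^ (n * Suc i)) UNIV = (act M' ^^ n) ((act M' ^^ (n * i)) UNIV)"
      by (simp add: funpow_add)
    also have "\<dots> \<subseteq> (act M' ^^ n) (V i)" using Suc by blast
    finally show ?case using Suc by blast
  qed (simp add: V_def)
  moreover obtain k where "V k = {0}" using M(2) unfolding acts_nilpotently_def V_def by blast
  ultimately have "(act M' ^^ (n * k)) UNIV \<subseteq> {0}" by metis
  then have "(act M' ^^ (n * k)) UNIV = {0}" using vec.subspace_0[OF subspace_act_pow] by blast
  then show ?thesis unfolding acts_nilpotently_def M'_def by blast
qed

lemma subspace_add_line:
  assumes "vec.subspace M"
  shows "vec.subspace {m + c *s x |m c. m \<in> M}"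
proof -
  have "{m + c *s x |m c. m \<in> M} = {m + u |m u. m \<in> M \<and> u \<in> vec.span {x}}"
    by (auto simp: vec.span_singleton)
  then show ?thesis using vec.subspace_sums[OF assms vec.subspace_span] by simp
qed

text \<open>\<open>M\<close> is a subalgebra of \<open>P\<close> of largest dimension among those
  for which the claim holds. If it is not \<open>P\<close>, there is a last stage of its chain that
  meets \<open>P\<close> outside \<open>M\<close>. An \<open>x\<close> found there is pushed by
  \<open>M\<close> to the next stage, hence into \<open>M\<close>; so \<open>x\<close> normalises
  \<open>M\<close>, and adjoining it contradicts maximality.\<close>

lemma engel:
  assumes P: "vec.subspace P" "\<And>x y. x \<in> P \<Longrightarrow> y \<in> P \<Longrightarrow> br x y \<in> P"
    and nil: "\<And>x. x \<in> P \<Longrightarrow> \<exists>N. \<forall>v. (br x ^^ N) v = 0"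
  shows "acts_nilpotently P"
proof -
  define good where "good M \<longleftrightarrow> M \<subseteq> P \<and> vec.subspace M \<and> (\<forall>x\<in>M. \<forall>y\<in>M. br x y \<in> M)
    \<and> acts_nilpotently M" for M
  have "act {0} UNIV = {0}"
    using act_subset[of "{0}" "{0}" UNIV] vec.subspace_0[OF subspace_act, of "{0}" UNIV]
      vec.subspace_single_0 by (auto simp: br_simps)
  then have "(act {0} ^^ 1) UNIV = {0}" by simp
  then have "acts_nilpotently {0}" unfolding acts_nilpotently_def by blast
  then have g0: "good {0}"
    using vec.subspace_0[OF P(1)] vec.subspace_single_0 by (simp add: good_def br_simps)
  have bound: "\<forall>M. good M \<longrightarrow> vec.dim M < Suc (CARD('n))"
    by (metis vec.dim_subset[OF subset_UNIV] vec_dim_card less_Suc_eq_le)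
  obtain M where M: "good M" and max: "\<And>M'. good M' \<Longrightarrow> vec.dim M' \<le> vec.dim M"
    using ex_has_greatest_nat[of good "{0}" vec.dim, OF g0 bound] by blast
  have sM: "vec.subspace M" and cM: "\<And>x y. x \<in> M \<Longrightarrow> y \<in> M \<Longrightarrow> br x y \<in> M"
    and nM: "acts_nilpotently M" and MP: "M \<subseteq> P"
    using M by (auto simp: good_def)
  have "P \<subseteq> M"
  proof (rule ccontr)
    assume "\<not> P \<subseteq> M"
    define Q where "Q k \<longleftrightarrow> (act M ^^ k) UNIV \<inter> P \<subseteq> M" for k
    obtain K where "(act M ^^ K) UNIV = {0}" using nM unfolding acts_nilpotently_def by blast
    then have "Q K" using vec.subspace_0[OF sM] by (auto simp: Q_def)
    moreover have "\<not> Q 0" using \<open>\<not> P \<subseteq> M\<close> by (simp add: Q_def)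
    ultimately obtain k where k: "\<not> Q k" "Q (Suc k)"
      using ex_least_nat_less[of Q K] by blast
    then obtain x where x: "x \<in> (act M ^^ k) UNIV" "x \<in> P" "x \<notin> M" by (auto simp: Q_def)
    have mx: "br m x \<in> M" if "m \<in> M" for m
    proof -
      have "br m x \<in> (act M ^^ Suc k) UNIV" using act_memI[OF that x(1)] by simp
      moreover have "br m x \<in> P" using P(2) x(2) MP that by blast
      ultimately show ?thesis using k(2) by (auto simp: Q_def)
    qed
    have xm: "br x m \<in> M" if "m \<in> M" for m
      using vec.subspace_neg[OF sM mx[OF that]] br_anti[of x m] by simp
    obtain n where n: "\<And>v. (br x ^^ n) v = 0" using nil[OF x(2)] by blast
    define M' where "M' = {m + c *s x |m c. m \<in> M}"
    have sM': "vec.subspace M'" unfolding M'_def by (rule subspace_add_line[OF sM])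
    have MM': "m + c *s x \<in> M'" if "m \<in> M" for m c using that unfolding M'_def by blast
    have "M' \<subseteq> P" unfolding M'_def using MP P(1) x(2)
      by (auto intro!: vec.subspace_add vec.subspace_scale)
    moreover have "br a b \<in> M'" if "a \<in> M'" "b \<in> M'" for a b
    proof -
      obtain m c m' c' where ab: "a = m + c *s x" "b = m' + c' *s x" "m \<in> M" "m' \<in> M"
        using \<open>a \<in> M'\<close> \<open>b \<in> M'\<close> unfolding M'_def by blast
      have "br a b = br m m' + c' *s br m x + c *s br x m'"
        by (simp add: ab(1,2) br_simps alternating vec.scale_right_distrib)
      also have "\<dots> \<in> M" using ab(3,4) cM mx xm sM
        by (intro vec.subspace_add vec.subspace_scale) auto
      finally show ?thesis using MM'[of "br a b" 0] by simp
    qed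
    moreover have "acts_nilpotently M'"
      unfolding M'_def by (rule acts_nilpotently_extend[OF sM nM xm n])
    ultimately have "good M'" using sM' by (simp add: good_def)
    then have "vec.dim M' \<le> vec.dim M" by (rule max)
    moreover have "M \<subseteq> M'" using MM'[of _ 0] by auto
    ultimately have "M = M'" using vec.subspace_dim_equal[OF sM sM'] by blast
    moreover have "x \<in> M'" using MM'[OF vec.subspace_0[OF sM], of 1] by simp
    ultimately show False using x(3) by simp
  qed
  then show ?thesis using nM MP by simp
qed

text \<open>Every bracket of elements of \<open>P\<close> stays in \<open>P\<close> and descends one
  step in Engel's chain, so the derived series dies with the chain.\<close>

lemma derived_pow_subset_act_pow:
  assumes P: "vec.subspace P" "\<And>x y. x \<in> P \<Longrightarrow> y \<in> P \<Longrightarrow> br x y \<in> P"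
  shows "(derived_algebra br ^^ k) P \<subseteq> P \<inter> (act P ^^ k) UNIV"
proof (induction k)
  case (Suc k)
  let ?D = "(derived_algebra br ^^ k) P"
  have "derived_algebra br ?D = act ?D ?D" by (simp add: derived_algebra_def act_def)
  moreover have "act ?D ?D \<subseteq> act P ((act P ^^ k) UNIV)" by (rule act_mono) (use Suc in auto)
  moreover have "act ?D ?D \<subseteq> P" by (rule act_subset[OF P(1)]) (use Suc P(2) in blast)
  ultimately show ?case by auto
qed simp

lemma solvable_killing_radical: "lie_solvable br killing_radical"
proof -
  define P where "P = derived_algebra br killing_radical"
  have P: "vec.subspace P" unfolding P_def derived_algebra_def by (rule vec.subspace_span)
  have sub: "vec.subspace killing_radical"
    and id: "\<And>x y. y \<in> killing_radical \<Longrightarrow> br x y \<in> killing_radical"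
    using ideal_killing_radical by (auto simp: lie_ideal_def)
  have PS: "P \<subseteq> killing_radical"
    unfolding P_def derived_algebra_def by (rule vec.span_minimal) (use sub id in auto)
  have cl: "br x y \<in> P" if "x \<in> P" "y \<in> P" for x y
    unfolding P_def derived_algebra_def
    by (rule vec.span_base) (use that PS in blast)
  have "acts_nilpotently P"
    by (rule engel[OF P cl]) (auto simp: P_def intro!: derived_killing_radical_nilpotent)
  then obtain k where "(act P ^^ k) UNIV = {0}" unfolding acts_nilpotently_def by blast
  then have "(derived_algebra br ^^ k) P \<subseteq> {0}"
    using derived_pow_subset_act_pow[OF P cl, of k] by blast
  \<comment> \<open>Solvability asks for equality with \<open>{0}\<close>, so membership of 0 has to
    be checked as well.\<close>
  moreover have "0 \<in> (derived_algebra br ^^ k) P"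
  proof (cases k)
    case (Suc j)
    then show ?thesis by (auto simp: derived_algebra_def intro: vec.span_zero)
  qed (use vec.subspace_0[OF P] in simp)
  ultimately have "(derived_algebra br ^^ Suc k) killing_radical = {0}"
    by (simp only: P_def funpow_Suc_right comp_def) blast
  then show ?thesis unfolding lie_solvable_def by blast
qed

text \<open>Outside the range, \<open>X\<close> would be detected by a functional that vanishes on
  the range. Nondegeneracy represents this functional by some \<open>Z\<close>, and invariance makes
  [X, Z] orthogonal to everything, so \<open>Z\<close> commutes with \<open>X\<close>. Then the
  nilpotent map ad Z \<circ> ad X has trace 0, although this trace is the value of the functional at
  \<open>X\<close>.\<close>

lemma nilpotent_in_range_ad:
  assumes ss: "lie_semisimple br" and nil: "lie_nilpotent br X"
  shows "\<exists>W. br X W = X"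
proof (rule ccontr)
  assume "\<nexists>W. br X W = X"
  then have nX: "X \<notin> range (br X)" by (metis imageE)
  have sub: "vec.subspace (range (br X))"
    by (rule vec.linear_subspace_image[OF linear_right vec.subspace_UNIV])
  have rad: "killing_radical = {0}"
    using ss ideal_killing_radical solvable_killing_radical by (auto simp: lie_semisimple_def)
  obtain B where B: "B \<subseteq> range (br X)" "vec.independent B" "range (br X) \<subseteq> vec.span B"
    by (rule vec.maximal_independent_subset)
  have spB: "vec.span B = range (br X)"
    using B(1,3) vec.span_minimal[OF B(1) sub] by blast
  then have "vec.independent (insert X B)"
    using nX B(2) by (simp add: vec.independent_insert)
  \<comment> \<open>\<open>f\<close> is vector-valued because \<open>clinear\<close> relates vector
    types; the functional is the i-th coordinate chosen below.\<close>
  then obtain f where f: "clinear f" "\<forall>x\<in>insert X B. f x = (if x = X then X else 0)"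
    using vec.linear_independent_extend[of "insert X B" "\<lambda>x. if x = X then X else 0"] by blast
  have "f b = 0" if "b \<in> B" for b using f(2) that nX B(1) by auto
  then have fR: "f (br X Y) = 0" for Y
    using clinear_span_induct[OF f(1) vec.subspace_single_0, of B "br X Y"] spB by auto
  have fX: "f X = X" using f(2) by simp
  have "X \<noteq> 0" using nX linear_right[of X] vec.linear_0[of "br X"] by (metis rangeI)
  then obtain i where i: "X $ i \<noteq> 0" by (auto simp: vec_eq_iff)
  \<comment> \<open>\<open>k Z\<close> lists the coordinates of the functional
    \<open>killing Z\<close>. Nondegeneracy makes this square system injective, hence
    surjective.\<close>
  define k where "k Z = (\<chi> j. killing Z (axis j 1))" for Z
  have k: "clinear k" unfolding k_def
    by (rule clinearI) (simp_all add: vec_eq_iff killing_add killing_scale)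
  have killing_add_r: "killing Z (x + y) = killing Z x + killing Z y"
    and killing_scale_r: "killing Z (c *s x) = c * killing Z x" for Z x y c
    by (simp_all add: killing_sym[of Z] killing_add killing_scale)
  have kill: "killing Z y = (\<Sum>j\<in>UNIV. y $ j * k Z $ j)" for Z y
  proof -
    \<comment> \<open>A scalar-valued map is stored as a constant vector so that
      \<open>clinear\<close> applies.\<close>
    have kl: "clinear (\<lambda>y. \<chi> j::'n. killing Z y)" for Z
      by (rule clinearI) (simp_all add: vec_eq_iff killing_add_r killing_scale_r)
    have "(\<chi> j::'n. killing Z y) = (\<chi> j. killing Z (\<Sum>j\<in>UNIV. y $ j *s axis j 1))"
      by (simp only: basis_expansion)
    also have "\<dots> = (\<Sum>j\<in>UNIV. y $ j *s (\<chi> l. killing Z (axis j 1)))"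
      by (simp only: vec.linear_sum[OF kl] vec.linear_scale[OF kl])
    finally show ?thesis by (simp add: vec_eq_iff k_def)
  qed
  have "inj k"
  proof (subst vec.linear_inj_iff_eq_0[OF k], intro allI impI)
    fix Z assume "k Z = 0"
    then have "Z \<in> killing_radical" by (simp add: killing_radical_def kill)
    then show "Z = 0" using rad by simp
  qed
  then have "surj k" by (rule vec.linear_injective_imp_surjective[OF k _ refl])
  then obtain Z where Z: "k Z = (\<chi> j. f (axis j 1) $ i)" by (metis surjD)
  have fk: "killing Z y = f y $ i" for y
  proof -
    have "f y = (\<Sum>j\<in>UNIV. y $ j *s f (axis j 1))"
      by (subst basis_expansion[of y, symmetric], simp only: vec.linear_sum[OF f(1)] vec.linear_scale[OF f(1)])
    then show ?thesis by (simp add: kill Z)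
  qed
  have "killing (br X Z) Y = 0" for Y
    by (simp add: killing_invariant fk fR)
  then have XZ: "br X Z = 0" using rad by (auto simp: killing_radical_def)
  obtain N where N: "\<And>v. (br X ^^ N) v = 0" using nil by (auto simp: lie_nilpotent_def)
  have comm: "br Z (br X v) = br X (br Z v)" for v
    using jacobi[of X Z v] XZ by (simp add: br_simps)
  have "((br Z \<circ> br X) ^^ j) v = (br Z ^^ j) ((br X ^^ j) v)" for j v
  proof (induction j)
    case (Suc j)
    have "((br Z \<circ> br X) ^^ Suc j) v = br Z (br X (((br Z \<circ> br X) ^^ j) v))" by simp
    also have "\<dots> = br Z (br X ((br Z ^^ j) ((br X ^^ j) v)))" by (simp only: Suc)
    also have "br X ((br Z ^^ j) ((br X ^^ j) v)) = (br Z ^^ j) (br X ((br X ^^ j) v))"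
      by (rule funpow_commute_pointwise[symmetric]) (rule comm)
    finally show ?case by simp
  qed simp
  then have "((br Z \<circ> br X) ^^ N) v = 0" for v
    using N vec.linear_0[OF clinear_funpow[OF linear_right]] by simp
  then have "killing Z X = 0"
    unfolding killing_def by (rule lin_trace_nilpotent[OF linear_right_comp])
  then show False using fk[of X] fX i by simp
qed

end

section \<open>Holomorphic maps of several variables\<close>

lemma holo_onD:
  assumes "holo_on s1 s2 f U" "x \<in> U"
  shows "(f has_derivative frechet_derivative f (at x)) (at x)"
    and "frechet_derivative f (at x) (s1 c v) = s2 c (frechet_derivative f (at x) v)"
proof -
  obtain D where D: "(f has_derivative D) (at x)" "\<And>c v. D (s1 c v) = s2 c (D v)"
    using assms unfolding holo_on_def by blast
  have "frechet_derivative f (at x) = D" using frechet_derivative_at[OF D(1)] by simp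
  then show "(f has_derivative frechet_derivative f (at x)) (at x)"
    "frechet_derivative f (at x) (s1 c v) = s2 c (frechet_derivative f (at x) v)"
    using D by auto
qed

lemma holo_on_continuous: "holo_on s1 s2 f U \<Longrightarrow> continuous_on U f"
  by (rule has_derivative_continuous_on[of _ _ "\<lambda>x. frechet_derivative f (at x)"])
    (auto intro: has_derivative_at_withinI holo_onD)

lemma holo_on_cong:
  assumes "open U" "\<And>x. x \<in> U \<Longrightarrow> f x = g x" "holo_on s1 s2 f U"
  shows "holo_on s1 s2 g U"
  using assms(3) has_derivative_transform_within_open[OF _ assms(1)] assms(2)
  unfolding holo_on_def by metis

lemma has_derivative_vecI:
  fixes f :: "'e::real_normed_vector \<Rightarrow> complex^'m::finite"
  assumes "\<And>i. ((\<lambda>x. f x $ i) has_derivative (\<lambda>v. D v $ i)) (at x)"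
  shows "(f has_derivative D) (at x)"
proof (subst has_derivative_componentwise_within, intro ballI)
  fix b :: "complex^'m" assume "b \<in> Basis"
  then obtain i c where b: "b = axis i c" by (auto simp: Basis_vec_def)
  show "((\<lambda>x. f x \<bullet> b) has_derivative (\<lambda>x. D x \<bullet> b)) (at x)"
    unfolding b inner_axis by (rule has_derivative_inner_left[OF assms])
qed

text \<open>Covers functions of one vector and of a pair of vectors at once: a real Euclidean space
  with a complex scaling, interpreted later for both.\<close>

locale complex_scaling =
  fixes s :: "complex \<Rightarrow> 'e::euclidean_space \<Rightarrow> 'e"
  assumes scale_bounded: "bounded_bilinear s"
begin

lemma scale_left: "bounded_linear (\<lambda>z. s z v)"
  by (rule bounded_bilinear.bounded_linear_left[OF scale_bounded])

lemma scale_zero: "s 0 v = 0"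
  by (rule bounded_bilinear.zero_left[OF scale_bounded])

text \<open>One radius serves all points near \<open>x0\<close>, so the circle in the integral
  formula can stay fixed while the point varies.\<close>

lemma uniform_disc:
  assumes "open U" "x0 \<in> U"
  shows "\<exists>\<delta>>0. \<exists>r>0. \<forall>x\<in>ball x0 \<delta>. \<forall>z\<in>cball 0 r. x + s z v \<in> U"
proof -
  obtain e where e: "e > 0" "ball x0 e \<subseteq> U" using assms open_contains_ball by blast
  have "continuous_on UNIV (\<lambda>z. s z v)" using scale_left by (simp add: linear_continuous_on)
  then have "isCont (\<lambda>z. s z v) 0" by (simp add: continuous_on_eq_continuous_at)
  then obtain d where d: "d > 0" "\<And>z. dist z 0 < d \<Longrightarrow> dist (s z v) (s 0 v) < e / 2"
    using e(1) unfolding continuous_at_eps_delta by (metis half_gt_zero)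
  have "x + s z v \<in> U" if "x \<in> ball x0 (e / 2)" "z \<in> cball 0 (d / 2)" for x z
  proof -
    have "norm (s z v) < e / 2" using d(2)[of z] d(1) that(2) by (simp add: scale_zero)
    moreover have "dist x0 (x + s z v) \<le> dist x0 x + norm (s z v)"
      by (metis dist_triangle dist_add_cancel add.right_neutral dist_0_norm)
    ultimately show ?thesis using that(1) e(2) by auto
  qed
  then show ?thesis using e(1) d(1) by (meson half_gt_zero)
qed

lemma line_has_field_derivative:
  assumes f: "holo_on s (*) f U" and "x + s z v \<in> U"
  shows "((\<lambda>z. f (x + s z v)) has_field_derivative frechet_derivative f (at (x + s z v)) v) (at z)"
proof -
  have "((\<lambda>z. x + s z v) has_derivative (\<lambda>h. s h v)) (at z)"
    using bounded_linear.has_derivative[OF scale_left has_derivative_ident]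
    by (auto intro!: derivative_eq_intros)
  from has_derivative_compose[OF this holo_onD(1)[OF assms]]
  have "((\<lambda>z. f (x + s z v)) has_derivative
      (\<lambda>h. frechet_derivative f (at (x + s z v)) (s h v))) (at z)" .
  then show ?thesis
    unfolding holo_onD(2)[OF assms] has_field_derivative_def
        by (simp add: mult.commute[of _ "frechet_derivative _ _ _"])
qed

text \<open>Cauchy's formula for the first derivative at 0 along the complex line through
  \<open>x\<close>, with kernel 1 / u^2. For u = circlepath 0 r t one has du = 2\<pi>\<i> u dt,
  which cancels the constant and one factor u. The right-hand side no longer differentiates
  \<open>f\<close>.\<close>

lemma dir_deriv_integral:
  assumes f: "holo_on s (*) f U" and r: "r > 0" "\<And>z. z \<in> cball 0 r \<Longrightarrow> x + s z v \<in> U"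
  shows "frechet_derivative f (at x) v
    = integral (cbox 0 1) (\<lambda>t. f (x + s (circlepath 0 r t) v) / circlepath 0 r t)"
proof -
  let ?g = "\<lambda>z. f (x + s z v)"
  have d: "(?g has_field_derivative frechet_derivative f (at (x + s z v)) v) (at z)"
    if "z \<in> cball 0 r" for z
    using line_has_field_derivative[OF f] r(2) that by blast
  have "contour_integral (circlepath 0 r) (\<lambda>u. ?g u / (u - 0)\<^sup>2) = 2 * pi * \<i> * deriv ?g 0"
  proof (rule Cauchy_contour_integral_circlepath_2)
    show "continuous_on (cball 0 r) ?g"
      using d by (meson DERIV_isCont continuous_at_imp_continuous_on)
    show "?g holomorphic_on ball 0 r"
      unfolding holomorphic_on_def field_differentiable_def
      by (intro ballI exI, rule has_field_derivative_at_within, rule d) simp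
  qed (use r in simp)
  moreover have "deriv ?g 0 = frechet_derivative f (at x) v"
    using DERIV_imp_deriv[OF d[of 0]] r(1) by (simp add: scale_zero)
  ultimately have "frechet_derivative f (at x) v
      = contour_integral (circlepath 0 r) (\<lambda>u. ?g u / u\<^sup>2) / (2 * pi * \<i>)"
    by simp
  also have "\<dots> = integral {0..1} (\<lambda>t. ?g (circlepath 0 r t) / (circlepath 0 r t)\<^sup>2 *
      (2 * pi * \<i> * circlepath 0 r t)) / (2 * pi * \<i>)"
    unfolding contour_integral_integral vector_derivative_circlepath
        by (simp add: circlepath mult_ac)
  also have "(\<lambda>t. ?g (circlepath 0 r t) / (circlepath 0 r t)\<^sup>2 * (2 * pi * \<i> * circlepath 0 r t))
      = (\<lambda>t. (2 * pi * \<i>) * (?g (circlepath 0 r t) / circlepath 0 r t))"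
    by (rule ext) (simp add: power2_eq_square)
  also have "integral {0..1} \<dots> = (2 * pi * \<i>) * integral {0..1} (\<lambda>t. ?g (circlepath 0 r t) / circlepath 0 r t)"
    by (rule integral_mult_right)
  finally show ?thesis by simp
qed

lemma circlepath_nonzero: "r > 0 \<Longrightarrow> circlepath 0 r t \<noteq> 0"
  by (simp add: circlepath)

lemma circlepath_in_cball: "r > 0 \<Longrightarrow> circlepath 0 r t \<in> cball 0 r"
  by (simp add: circlepath norm_mult)

lemma continuous_on_circlepath': "continuous_on S (circlepath 0 r)"
  by (simp add: circlepath) (intro continuous_intros)

lemma continuous_on_Cauchy_kernel:
  assumes g: "continuous_on U g" and r: "r > 0"
    and "\<And>x z. x \<in> B \<Longrightarrow> z \<in> cball 0 r \<Longrightarrow> x + s z v \<in> U"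
  shows "continuous_on (B \<times> cbox 0 1) (\<lambda>(x, t). g (x + s (circlepath 0 r t) v) / circlepath 0 r t)"
proof -
  have c: "continuous_on (B \<times> cbox 0 1) (\<lambda>p. circlepath 0 r (snd p))"
    by (rule continuous_on_compose2[OF continuous_on_circlepath'[of UNIV] continuous_on_snd[OF continuous_on_id]]) auto
  then have "continuous_on (B \<times> cbox 0 1) (\<lambda>p. fst p + s (circlepath 0 r (snd p)) v)"
    by (intro continuous_on_add continuous_on_fst continuous_on_id bounded_linear.continuous_on[OF scale_left])
  then have "continuous_on (B \<times> cbox 0 1) (\<lambda>p. g (fst p + s (circlepath 0 r (snd p)) v))"
    by (rule continuous_on_compose2[OF g]) (use assms(3) circlepath_in_cball[OF r] in auto)
  then show ?thesis
    using continuous_on_divide[OF _ c] circlepath_nonzero[OF r] by (auto simp: case_prod_unfold)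
qed

text \<open>\<open>holo_on\<close> asks only for a derivative at each point; its continuity is read
  off the integral formula, whose integrand contains only the continuous \<open>f\<close>.\<close>

lemma continuous_on_dir_deriv:
  assumes f: "holo_on s (*) f U" and U: "open U"
  shows "continuous_on U (\<lambda>x. frechet_derivative f (at x) v)"
proof -
  have "isCont (\<lambda>x. frechet_derivative f (at x) v) x0" if "x0 \<in> U" for x0
  proof -
    obtain \<delta> r where *: "\<delta> > 0" "r > 0" "\<forall>x\<in>ball x0 \<delta>. \<forall>z\<in>cball 0 r. x + s z v \<in> U"
      using uniform_disc[OF U \<open>x0 \<in> U\<close>] by blast
    have "continuous_on (ball x0 \<delta>) (\<lambda>x. integral (cbox 0 1)
        (\<lambda>t. f (x + s (circlepath 0 r t) v) / circlepath 0 r t))"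
      by (intro integral_continuous_on_param continuous_on_Cauchy_kernel[OF holo_on_continuous[OF f] *(2)])
        (use *(3) in blast)
    then have "continuous_on (ball x0 \<delta>) (\<lambda>x. frechet_derivative f (at x) v)"
      by (rule continuous_on_eq) (rule dir_deriv_integral[OF f *(2), symmetric], use *(3) in blast)
    then show ?thesis using *(1) by (simp add: continuous_on_eq_continuous_at)
  qed
  then show ?thesis by (simp add: continuous_at_imp_continuous_on)
qed

text \<open>Differentiation under the integral in Cauchy's formula. The radius is part of the
  conclusion so that complex linearity can afterwards be checked inside the integral.\<close>

lemma dir_deriv_has_derivative:
  assumes f: "holo_on s (*) f U" and U: "open U" and x0: "x0 \<in> U"
  shows "\<exists>r>0. (\<forall>z\<in>cball 0 r. x0 + s z v \<in> U) \<and>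
    ((\<lambda>x. frechet_derivative f (at x) v) has_derivative
      (\<lambda>w. integral (cbox 0 1) (\<lambda>t. frechet_derivative f (at (x0 + s (circlepath 0 r t) v)) w / circlepath 0 r t)))
    (at x0)"
proof -
  obtain \<delta> r where *: "\<delta> > 0" "r > 0" "\<forall>x\<in>ball x0 \<delta>. \<forall>z\<in>cball 0 r. x + s z v \<in> U"
    using uniform_disc[OF U x0] by blast
  let ?B = "ball x0 \<delta>"
  define F where "F x t = f (x + s (circlepath 0 r t) v) / circlepath 0 r t" for x t
  define F' where "F' x t = Blinfun (\<lambda>w. frechet_derivative f
      (at (x + s (circlepath 0 r t) v)) w / circlepath 0 r t)" for x t
  have inU: "x + s (circlepath 0 r t) v \<in> U" if "x \<in> ?B" for x t
    using *(3) circlepath_in_cball[OF *(2)] that by blast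
  have F': "blinfun_apply (F' x t) = (\<lambda>w. frechet_derivative f
      (at (x + s (circlepath 0 r t) v)) w / circlepath 0 r t)"
    if "x \<in> ?B" for x t
    unfolding F'_def
    by (intro bounded_linear_Blinfun_apply bounded_linear_compose[OF bounded_linear_divide]
        has_derivative_bounded_linear[OF holo_onD(1)[OF f inU[OF that]]])
  have der: "((\<lambda>x. F x t) has_derivative blinfun_apply (F' x t)) (at x within ?B)" if "x \<in> ?B"
    for x t
  proof -
    have "((\<lambda>x. x + s (circlepath 0 r t) v) has_derivative (\<lambda>w. w)) (at x)"
      by (auto intro!: derivative_eq_intros)
    from has_derivative_compose[OF this holo_onD(1)[OF f inU[OF that]]]
    have "((\<lambda>x. f (x + s (circlepath 0 r t) v)) has_derivative
        frechet_derivative f (at (x + s (circlepath 0 r t) v))) (at x)" .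
    then have "((\<lambda>x. F x t) has_derivative blinfun_apply (F' x t)) (at x)"
      unfolding F'[OF that] F_def by (rule bounded_linear.has_derivative[OF bounded_linear_divide])
    then show ?thesis by (rule has_derivative_at_withinI)
  qed
  \<comment> \<open>The Leibniz rule wants the derivative continuous as an operator. In finite
    dimension basis directions suffice, and \<open>continuous_on_dir_deriv\<close> covers
    these.\<close>
  have cont': "continuous_on (?B \<times> cbox 0 1) (\<lambda>(x, t). F' x t)"
  proof (rule continuous_on_blinfun_componentwise)
    fix b :: 'e assume "b \<in> Basis"
    have "continuous_on (?B \<times> cbox 0 1) (\<lambda>(x, t). frechet_derivative f
        (at (x + s (circlepath 0 r t) v)) b / circlepath 0 r t)"
      by (rule continuous_on_Cauchy_kernel[OF continuous_on_dir_deriv[OF f U] *(2)]) (use *(3) in blast)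
    then show "continuous_on (?B \<times> cbox 0 1) (\<lambda>p. blinfun_apply (case p of (x, t) \<Rightarrow> F' x t) b)"
      by (rule continuous_on_eq) (auto simp: F')
  qed
  have contF: "continuous_on (?B \<times> cbox 0 1) (\<lambda>(x, t). F x t)"
    unfolding F_def by (rule continuous_on_Cauchy_kernel[OF holo_on_continuous[OF f] *(2)]) (use *(3) in blast)
  have sl: "continuous_on (cbox 0 1) (\<lambda>t. h x t)"
    if "continuous_on (?B \<times> cbox 0 1) (\<lambda>(x, t). h x t)" "x \<in> ?B"
    for h :: "'e \<Rightarrow> real \<Rightarrow> 'z::real_normed_vector" and x
  proof -
    have "continuous_on (cbox 0 1) (\<lambda>t. (x, t))" by (intro continuous_intros)
    moreover have "(\<lambda>t. (x, t)) ` cbox 0 1 \<subseteq> ?B \<times> cbox 0 1" using that(2) by blast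
    ultimately show ?thesis
      using continuous_on_compose2[OF that(1), of "cbox 0 1" "\<lambda>t. (x, t)"]
          by (simp only: case_prod_conv)
  qed
  have "((\<lambda>x. integral (cbox 0 1) (F x)) has_derivative integral (cbox 0 1) (F' x0))
      (at x0 within ?B)"
  proof (rule leibniz_rule[OF der _ cont'])
    show "F x integrable_on cbox 0 1" if "x \<in> ?B" for x
      by (rule integrable_continuous[OF sl[OF contF that]])
  qed (use *(1) in auto)
  then have "((\<lambda>x. integral (cbox 0 1) (F x)) has_derivative integral (cbox 0 1) (F' x0)) (at x0)"
    using *(1) at_within_open[of x0 ?B] by simp
  moreover have "integral (cbox 0 1) (F x) = frechet_derivative f (at x) v" if "x \<in> ?B" for x
    unfolding F_def by (rule dir_deriv_integral[OF f *(2), symmetric]) (use *(3) that in blast)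
  ultimately have "((\<lambda>x. frechet_derivative f (at x) v)
      has_derivative blinfun_apply (integral (cbox 0 1) (F' x0))) (at x0)"
    using *(1) by (auto intro: has_derivative_transform_within_open[OF _ open_ball[of x0 \<delta>]])
  moreover have "blinfun_apply (integral (cbox 0 1) (F' x0)) = (\<lambda>w. integral (cbox 0 1)
      (\<lambda>t. frechet_derivative f (at (x0 + s (circlepath 0 r t) v)) w / circlepath 0 r t))"
  proof
    fix w
    have "x0 \<in> ?B" using *(1) by simp
    then have "F' x0 integrable_on cbox 0 1" using integrable_continuous[OF sl[OF cont']] by blast
    then show "blinfun_apply (integral (cbox 0 1) (F' x0)) w = integral (cbox 0 1)
      (\<lambda>t. frechet_derivative f (at (x0 + s (circlepath 0 r t) v)) w / circlepath 0 r t)"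
      using F'[OF \<open>x0 \<in> ?B\<close>] by (simp add: blinfun_apply_integral)
  qed
  ultimately show ?thesis using * by (intro exI[of _ r]) auto
qed

lemma holo_dir_deriv_scalar:
  assumes f: "holo_on s (*) f U" and U: "open U"
  shows "holo_on s (*) (\<lambda>x. frechet_derivative f (at x) v) U"
  unfolding holo_on_def
proof
  fix x assume x: "x \<in> U"
  obtain r where r: "r > 0" "\<forall>z\<in>cball 0 r. x + s z v \<in> U"
    and d: "((\<lambda>x. frechet_derivative f (at x) v) has_derivative
      (\<lambda>w. integral (cbox 0 1) (\<lambda>t. frechet_derivative f (at (x + s (circlepath 0 r t) v)) w / circlepath 0 r t))) (at x)"
    (is "(_ has_derivative ?D) _")
    using dir_deriv_has_derivative[OF f U x] by blast
  have "?D (s c w) = c * ?D w" for c w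
  proof -
    have "x + s (circlepath 0 r t) v \<in> U" for t using r circlepath_in_cball by blast
    then have "?D (s c w) = integral (cbox 0 1) (\<lambda>t. c * (frechet_derivative f
        (at (x + s (circlepath 0 r t) v)) w / circlepath 0 r t))"
      by (simp add: holo_onD(2)[OF f])
    then show ?thesis by (simp only: integral_mult_right)
  qed
  then show "\<exists>D. ((\<lambda>x. frechet_derivative f (at x) v) has_derivative D) (at x) \<and> (\<forall>c w. D (s c w)
      = c * D w)"
    using d by blast
qed

lemma holo_on_vec_iff:
  fixes f :: "'e \<Rightarrow> complex^'m::finite"
  shows "holo_on s (*s) f U \<longleftrightarrow> (\<forall>i. holo_on s (*) (\<lambda>x. f x $ i) U)"
proof
  assume f: "holo_on s (*s) f U"
  show "\<forall>i. holo_on s (*) (\<lambda>x. f x $ i) U"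
    unfolding holo_on_def
  proof (intro allI ballI)
    fix i x assume x: "x \<in> U"
    have "((\<lambda>x. f x $ i) has_derivative (\<lambda>v. frechet_derivative f (at x) v $ i)) (at x)"
      by (rule bounded_linear.has_derivative[OF bounded_linear_vec_nth holo_onD(1)[OF f x]])
    then show "\<exists>D. ((\<lambda>x. f x $ i) has_derivative D) (at x) \<and> (\<forall>c v. D (s c v) = c * D v)"
      by (intro exI conjI) (auto simp: holo_onD(2)[OF f x])
  qed
next
  assume f: "\<forall>i. holo_on s (*) (\<lambda>x. f x $ i) U"
  show "holo_on s (*s) f U"
    unfolding holo_on_def
  proof
    fix x assume x: "x \<in> U"
    let ?D = "\<lambda>v. \<chi> i. frechet_derivative (\<lambda>x. f x $ i) (at x) v"
    have "(f has_derivative ?D) (at x)"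
      by (rule has_derivative_vecI) (simp add: holo_onD(1)[OF f[rule_format] x])
    moreover have "?D (s c v) = c *s ?D v" for c v
      by (simp add: vec_eq_iff holo_onD(2)[OF f[rule_format] x])
    ultimately show "\<exists>D. (f has_derivative D) (at x) \<and> (\<forall>c v. D (s c v) = c *s D v)" by blast
  qed
qed

lemma frechet_derivative_vec_nth:
  fixes f :: "'e \<Rightarrow> complex^'m::finite"
  assumes "holo_on s (*s) f U" "x \<in> U"
  shows "frechet_derivative (\<lambda>x. f x $ i) (at x) v = frechet_derivative f (at x) v $ i"
  using frechet_derivative_at[OF bounded_linear.has_derivative[OF bounded_linear_vec_nth holo_onD(1)[OF assms]], symmetric]
  by metis

lemma holo_dir_deriv:
  fixes f :: "'e \<Rightarrow> complex^'m::finite"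
  assumes f: "holo_on s (*s) f U" and U: "open U"
  shows "holo_on s (*s) (\<lambda>x. frechet_derivative f (at x) v) U"
proof (subst holo_on_vec_iff, intro allI)
  fix i
  have "holo_on s (*) (\<lambda>x. frechet_derivative (\<lambda>x. f x $ i) (at x) v) U"
    using f holo_dir_deriv_scalar[OF _ U] holo_on_vec_iff by blast
  then show "holo_on s (*) (\<lambda>x. frechet_derivative f (at x) v $ i) U"
    by (rule holo_on_cong[OF U, rotated]) (rule frechet_derivative_vec_nth[OF f])
qed

end

section \<open>Ordinary differential equations\<close>

text \<open>Picard's contraction on bounded continuous functions on the whole line. Clamping time to
  [-\<epsilon>, \<epsilon>] keeps the images bounded and globally defined, so the fixed point
  theorem applies to the full type.\<close>

lemma ode_exists_bounded:
  fixes W :: "'a::euclidean_space \<Rightarrow> 'a"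
  assumes lip: "\<And>x y. norm (W x - W y) \<le> L * norm (x - y)" and bd: "\<And>x. norm (W x) \<le> M"
    and "0 \<le> L" "0 < \<epsilon>" "4 * L * \<epsilon> \<le> 1 / 2"
  obtains x where "x 0 = p" "\<And>t. norm (x t - p) \<le> 4 * M * \<epsilon>"
    "\<And>t. \<bar>t\<bar> < \<epsilon> \<Longrightarrow> (x has_vector_derivative W (x t)) (at t)"
proof -
  have M: "0 \<le> M" using bd[of 0] norm_ge_zero order_trans by blast
  have contW: "continuous_on UNIV W"
    using lip by (intro lipschitz_on_continuous_on[of L] lipschitz_onI)
      (auto simp: dist_norm \<open>0 \<le> L\<close>)
  define cl where "cl t = max (- \<epsilon>) (min \<epsilon> t)" for t
  have cl: "cl t \<in> {- \<epsilon>..\<epsilon>}" for t using \<open>0 < \<epsilon>\<close> by (auto simp: cl_def)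
  have contcl: "continuous_on UNIV cl" unfolding cl_def by (intro continuous_intros)
  define G where "G x t = integral {- \<epsilon>..t} (\<lambda>r. W (apply_bcontfun x r))" for x :: "real \<Rightarrow>\<^sub>C 'a"
    and t
  have contWx: "continuous_on S (\<lambda>r. W (apply_bcontfun x r))" for x :: "real \<Rightarrow>\<^sub>C 'a" and S
    by (rule continuous_on_compose2[OF contW continuous_on_apply_bcontfun]) simp
  have G_der: "(G x has_vector_derivative W (apply_bcontfun x t)) (at t within {- \<epsilon>..\<epsilon>})"
    if "t \<in> {- \<epsilon>..\<epsilon>}" for x t
    unfolding G_def by (rule integral_has_vector_derivative[OF contWx that])
  have G_bound: "norm (G x t) \<le> 2 * M * \<epsilon>" if "t \<in> {- \<epsilon>..\<epsilon>}" for x t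
  proof -
    have "norm (G x t) \<le> M * (t - (- \<epsilon>))"
      unfolding G_def by (rule integral_bound) (use that contWx bd in auto)
    also have "\<dots> \<le> M * (2 * \<epsilon>)" using that M by (intro mult_left_mono) auto
    finally show ?thesis by simp
  qed
  have G_lip: "norm (G x t - G y t) \<le> 2 * L * \<epsilon> * dist x y" if "t \<in> {- \<epsilon>..\<epsilon>}" for x y t
  proof -
    have "G x t - G y t = integral {- \<epsilon>..t} (\<lambda>r. W (apply_bcontfun x r) - W (apply_bcontfun y r))"
      unfolding G_def by (intro integral_diff[symmetric] integrable_continuous_real contWx)
    also have "norm \<dots> \<le> (L * dist x y) * (t - (- \<epsilon>))"
    proof (rule integral_bound)
      fix r
      have "norm (W (apply_bcontfun x r) - W (apply_bcontfun y r))
          \<le> L * dist (apply_bcontfun x r) (apply_bcontfun y r)"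
        using lip by (simp add: dist_norm)
      also have "\<dots> \<le> L * dist x y" using \<open>0 \<le> L\<close> by (intro mult_left_mono dist_bounded)
      finally show "norm (W (apply_bcontfun x r) - W (apply_bcontfun y r)) \<le> L * dist x y" .
    qed (use that in \<open>auto intro: continuous_on_diff contWx\<close>)
    also have "\<dots> \<le> (L * dist x y) * (2 * \<epsilon>)"
      using that \<open>0 \<le> L\<close> by (intro mult_left_mono) auto
    finally show ?thesis by (simp add: mult_ac)
  qed
  have e0: "0 \<in> {- \<epsilon>..\<epsilon>}" using \<open>0 < \<epsilon>\<close> by auto
  \<comment> \<open>Integrating from -\<epsilon> and subtracting the value at 0 handles both signs
    of time. Two terms over intervals of length at most 2\<epsilon> account for the factor
    4.\<close>
  define \<phi> where "\<phi> x t = p + G x (cl t) - G x 0" for x t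
  have \<phi>_bound: "norm (\<phi> x t - p) \<le> 4 * M * \<epsilon>" for x t
    using norm_triangle_ineq4[of "G x (cl t)" "G x 0"] G_bound[OF cl, of x t] G_bound[OF e0, of x]
    by (simp add: \<phi>_def)
  have \<phi>_bcont: "\<phi> x \<in> bcontfun" for x
  proof (rule bcontfun_normI)
    have "continuous_on {- \<epsilon>..\<epsilon>} (G x)"
      by (rule continuous_on_vector_derivative[OF G_der])
    then have "continuous_on UNIV (\<lambda>t. G x (cl t))"
      by (rule continuous_on_compose2[OF _ contcl]) (use cl in auto)
    then show "continuous_on UNIV (\<phi> x)" unfolding \<phi>_def by (intro continuous_intros)
    show "norm (\<phi> x t) \<le> norm p + 4 * M * \<epsilon>" for t
      using norm_triangle_ineq[of p "\<phi> x t - p"] \<phi>_bound[of x t] by simp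
  qed
  define \<Phi> where "\<Phi> x = Bcontfun (\<phi> x)" for x
  have \<Phi>: "apply_bcontfun (\<Phi> x) = \<phi> x" for x
    unfolding \<Phi>_def by (rule Bcontfun_inverse[OF \<phi>_bcont])
  have "dist (\<Phi> x) (\<Phi> y) \<le> 1 / 2 * dist x y" for x y
  proof (rule dist_bound)
    fix t
    have "dist (\<phi> x t) (\<phi> y t) = norm ((G x (cl t) - G y (cl t)) - (G x 0 - G y 0))"
      by (simp add: \<phi>_def dist_norm algebra_simps)
    also have "\<dots> \<le> norm (G x (cl t) - G y (cl t)) + norm (G x 0 - G y 0)"
      by (rule norm_triangle_ineq4)
    also have "\<dots> \<le> (4 * L * \<epsilon>) * dist x y"
      using G_lip[OF cl, of x t y] G_lip[OF e0, of x y] by simp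
    also have "\<dots> \<le> 1 / 2 * dist x y"
      using assms(5) by (intro mult_right_mono) auto
    finally show "dist (apply_bcontfun (\<Phi> x) t) (apply_bcontfun (\<Phi> y) t) \<le> 1 / 2 * dist x y"
      by (simp add: \<Phi>)
  qed
  then obtain x where x: "\<Phi> x = x"
    using banach_fix_type[of "1/2" \<Phi>] by auto
  have xt: "apply_bcontfun x t = \<phi> x t" for t using \<Phi>[of x] x by simp
  show ?thesis
  proof (rule that[of "apply_bcontfun x"])
    show "apply_bcontfun x 0 = p" using \<open>0 < \<epsilon>\<close> unfolding xt by (simp add: \<phi>_def cl_def)
    show "norm (apply_bcontfun x t - p) \<le> 4 * M * \<epsilon>" for t unfolding xt by (rule \<phi>_bound)
    fix t :: real assume t: "\<bar>t\<bar> < \<epsilon>"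
    then have "(G x has_vector_derivative W (apply_bcontfun x t)) (at t within {- \<epsilon><..<\<epsilon>})"
      by (intro has_vector_derivative_within_subset[OF G_der]) auto
    then have "(G x has_vector_derivative W (apply_bcontfun x t)) (at t)"
      using t by (subst (asm) at_within_open) auto
    then have "((\<lambda>r. p + G x r - G x 0) has_vector_derivative W (apply_bcontfun x t)) (at t)"
      by (auto intro!: derivative_eq_intros)
    then show "(apply_bcontfun x has_vector_derivative W (apply_bcontfun x t)) (at t)"
      by (rule has_vector_derivative_transform_within_open[of _ _ _ "{- \<epsilon><..<\<epsilon>}"])
        (use t in \<open>auto simp: xt \<phi>_def cl_def\<close>)
  qed
qed

text \<open>Composition with the projection onto the ball, which is 1-Lipschitz, makes the field
  globally Lipschitz and bounded. The solution found for it stays in the ball, where the field is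
  \<open>V\<close>.\<close>

lemma ode_exists:
  fixes V :: "'a::euclidean_space \<Rightarrow> 'a"
  assumes "R > 0" and lip: "\<And>x y. x \<in> cball p R \<Longrightarrow> y \<in> cball p R \<Longrightarrow> norm (V x - V y)
      \<le> L * norm (x - y)"
  shows "\<exists>\<epsilon> x. \<epsilon> > 0 \<and> x 0 = p \<and> (\<forall>t. x t \<in> cball p R) \<and>
    (\<forall>t. \<bar>t\<bar> < \<epsilon> \<longrightarrow> (x has_vector_derivative V (x t)) (at t))"
proof -
  define L' where "L' = max L 0"
  define \<rho> where "\<rho> = closest_point (cball p R)"
  define W where "W y = V (\<rho> y)" for y
  define M where "M = norm (V p) + L' * R"
  \<comment> \<open>Gives both 4 L' \<epsilon> \<le> 1/2 and 4 M \<epsilon> \<le> R; the summand 1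
    keeps the denominator positive.\<close>
  define \<epsilon> where "\<epsilon> = min 1 R / (8 * (L' + M + 1))"
  have ne: "cball p R \<noteq> {}" using \<open>R > 0\<close> by simp
  have \<rho>: "\<rho> y \<in> cball p R" for y unfolding \<rho>_def by (rule closest_point_in_set[OF closed_cball ne])
  have lip': "norm (V x - V y) \<le> L' * norm (x - y)" if "x \<in> cball p R" "y \<in> cball p R" for x y
  proof -
    have "L * norm (x - y) \<le> L' * norm (x - y)" by (intro mult_right_mono) (auto simp: L'_def)
    then show ?thesis using lip[OF that] by simp
  qed
  have L': "0 \<le> L'" by (simp add: L'_def)
  then have M: "0 \<le> M" using \<open>R > 0\<close> by (simp add: M_def)
  have "0 < \<epsilon>" using L' M \<open>R > 0\<close> by (simp add: \<epsilon>_def)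
  have lipW: "norm (W x - W y) \<le> L' * norm (x - y)" for x y
  proof -
    have "norm (W x - W y) \<le> L' * norm (\<rho> x - \<rho> y)" unfolding W_def by (rule lip'[OF \<rho> \<rho>])
    also have "\<dots> \<le> L' * norm (x - y)"
      using closest_point_lipschitz[OF convex_cball closed_cball ne, of x y] L'
      by (intro mult_left_mono) (auto simp: \<rho>_def dist_norm)
    finally show ?thesis .
  qed
  have bdW: "norm (W x) \<le> M" for x
  proof -
    have "norm (W x) \<le> norm (V p) + norm (V (\<rho> x) - V p)"
      using norm_triangle_ineq[of "V p" "V (\<rho> x) - V p"] by (simp add: W_def)
    also have "norm (V (\<rho> x) - V p) \<le> L' * norm (\<rho> x - p)"
      using \<open>R > 0\<close> by (intro lip' \<rho>) auto
    also have "\<dots> \<le> L' * R" using \<rho>[of x] L'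
      by (intro mult_left_mono) (auto simp: dist_norm norm_minus_commute)
    finally show ?thesis by (simp add: M_def)
  qed
  have D: "8 * (L' + M + 1) > 0" using L' M by simp
  have "\<epsilon> * (8 * (L' + M + 1)) = min 1 R" using D by (simp add: \<epsilon>_def)
  then have e: "8 * (L' * \<epsilon>) + 8 * (M * \<epsilon>) + 8 * \<epsilon> = min 1 R" by (simp add: algebra_simps)
  have "0 \<le> L' * \<epsilon>" "0 \<le> M * \<epsilon>" using L' M \<open>0 < \<epsilon>\<close> by auto
  then have "4 * L' * \<epsilon> \<le> 1 / 2" "4 * M * \<epsilon> \<le> R" using e \<open>0 < \<epsilon>\<close> \<open>R > 0\<close> by linarith+
  obtain x where x: "x 0 = p" "\<And>t. norm (x t - p) \<le> 4 * M * \<epsilon>"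
    "\<And>t. \<bar>t\<bar> < \<epsilon> \<Longrightarrow> (x has_vector_derivative W (x t)) (at t)"
    using ode_exists_bounded[OF lipW bdW L' \<open>0 < \<epsilon>\<close> \<open>4 * L' * \<epsilon> \<le> 1 / 2\<close>, of p] by blast
  have in_ball: "x t \<in> cball p R" for t
    using x(2)[of t] \<open>4 * M * \<epsilon> \<le> R\<close> by (simp add: dist_norm norm_minus_commute)
  then have "W (x t) = V (x t)" for t by (simp add: W_def \<rho>_def closest_point_self)
  then show ?thesis using x(1,3) in_ball \<open>0 < \<epsilon>\<close> by (intro exI[of _ \<epsilon>] exI[of _ x]) auto
qed

text \<open>Gronwall's argument: by the Lipschitz bound exp (-2 L t) |u - v|^2 has nonpositive
  derivative, and it starts at 0.\<close>

lemma ode_unique_forward: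
  fixes V :: "'a::euclidean_space \<Rightarrow> 'a"
  assumes lip: "\<And>x y. x \<in> S \<Longrightarrow> y \<in> S \<Longrightarrow> norm (V x - V y) \<le> L * norm (x - y)"
    and u: "\<And>t. 0 \<le> t \<Longrightarrow> t \<le> b \<Longrightarrow> u t \<in> S \<and> (u has_vector_derivative V (u t)) (at t)"
    and v: "\<And>t. 0 \<le> t \<Longrightarrow> t \<le> b \<Longrightarrow> v t \<in> S \<and> (v has_vector_derivative V (v t)) (at t)"
    and "u 0 = v 0" "0 \<le> b"
  shows "u b = v b"
proof -
  define f where "f t = exp (- 2 * L * t) * ((u t - v t) \<bullet> (u t - v t))" for t
  have "f b \<le> f 0"
  proof (rule DERIV_nonpos_imp_nonincreasing[OF \<open>0 \<le> b\<close>])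
    fix t assume t: "0 \<le> t" "t \<le> b"
    let ?w = "u t - v t" and ?w' = "V (u t) - V (v t)"
    have d: "((\<lambda>t. u t - v t) has_derivative (\<lambda>h. h *\<^sub>R ?w')) (at t)"
      using has_vector_derivative_diff[of u "V (u t)" "at t" v "V (v t)"] u[OF t] v[OF t]
      by (simp add: has_vector_derivative_def)
    define g where "g t = (u t - v t) \<bullet> (u t - v t)" for t
    have "(g has_real_derivative 2 * (?w \<bullet> ?w')) (at t)"
      using has_derivative_inner[OF d d] unfolding g_def has_field_derivative_def
      by (rule has_derivative_eq_rhs) (simp add: fun_eq_iff inner_commute)
    then have "((\<lambda>t. exp (- 2 * L * t) * g t) has_real_derivative
        exp (- 2 * L * t) * (2 * (?w \<bullet> ?w') - 2 * L * g t)) (at t)"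
      by (auto intro!: derivative_eq_intros simp: right_diff_distrib)
    then have "(f has_real_derivative exp (- 2 * L * t) * (2 * (?w \<bullet> ?w') - 2 * L * (?w \<bullet> ?w)))
        (at t)"
      unfolding f_def g_def .
    moreover have "?w \<bullet> ?w' \<le> L * (?w \<bullet> ?w)"
    proof -
      have "?w \<bullet> ?w' \<le> norm ?w * norm ?w'" by (rule norm_cauchy_schwarz)
      also have "\<dots> \<le> norm ?w * (L * norm ?w)"
        using lip[of "u t" "v t"] u[OF t] v[OF t] by (intro mult_left_mono) auto
      finally show ?thesis by (simp add: power2_norm_eq_inner[symmetric] power2_eq_square mult_ac)
    qed
    then have "exp (- 2 * L * t) * (2 * (?w \<bullet> ?w') - 2 * L * (?w \<bullet> ?w)) \<le> 0"
      by (intro mult_nonneg_nonpos) auto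
    ultimately show "\<exists>y. (f has_real_derivative y) (at t) \<and> y \<le> 0" by blast
  qed
  then have "exp (- 2 * L * b) * ((u b - v b) \<bullet> (u b - v b)) \<le> 0"
    using \<open>u 0 = v 0\<close> by (simp add: f_def)
  then have "(u b - v b) \<bullet> (u b - v b) \<le> 0" by (simp add: mult_le_0_iff)
  then show ?thesis using inner_gt_zero_iff[of "u b - v b"] by (metis eq_iff_diff_eq_0 not_le)
qed

text \<open>Negative times follow by reversing time, which replaces \<open>V\<close> by its
  negative.\<close>

lemma ode_unique:
  fixes V :: "'a::euclidean_space \<Rightarrow> 'a"
  assumes lip: "\<And>x y. x \<in> S \<Longrightarrow> y \<in> S \<Longrightarrow> norm (V x - V y) \<le> L * norm (x - y)"
    and u: "\<And>t. \<bar>t\<bar> < b \<Longrightarrow> u t \<in> S \<and> (u has_vector_derivative V (u t)) (at t)"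
    and v: "\<And>t. \<bar>t\<bar> < b \<Longrightarrow> v t \<in> S \<and> (v has_vector_derivative V (v t)) (at t)"
    and "u 0 = v 0" "\<bar>t\<bar> < b"
  shows "u t = v t"
proof (cases "0 \<le> t")
  case True
  then show ?thesis
    by (intro ode_unique_forward[OF lip u v assms(4)]) (use assms(5) in auto)
next
  case False
  have rev: "((\<lambda>r. u (- r)) has_vector_derivative - V (u (- r))) (at r)"
    if "(u has_vector_derivative V (u (- r))) (at (- r))" for u :: "real \<Rightarrow> 'a" and r
  proof -
    have "(uminus has_vector_derivative -1) (at r)"
      by (auto simp: has_real_derivative_iff_has_vector_derivative[symmetric] intro!: derivative_eq_intros)
    from vector_diff_chain_at[OF this that] show ?thesis by (simp add: comp_def)
  qed
  have "(\<lambda>r. u (- r)) (- t) = (\<lambda>r. v (- r)) (- t)"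
  proof (rule ode_unique_forward[where V = "\<lambda>x. - V x" and S = S and L = L and b = "- t"
        and u = "\<lambda>r. u (- r)" and v = "\<lambda>r. v (- r)"])
    show "norm (- V x - - V y) \<le> L * norm (x - y)" if "x \<in> S" "y \<in> S" for x y
      using lip[OF that] by (simp add: norm_minus_commute)
    show "u (- r) \<in> S \<and> ((\<lambda>r. u (- r)) has_vector_derivative - V (u (- r))) (at r)"
      if "0 \<le> r" "r \<le> - t" for r
      using u[of "- r"] rev[of u r] that assms(5) by simp
    show "v (- r) \<in> S \<and> ((\<lambda>r. v (- r)) has_vector_derivative - V (v (- r))) (at r)"
      if "0 \<le> r" "r \<le> - t" for r
      using v[of "- r"] rev[of v r] that assms(5) by simp
  qed (use assms(4) False in auto)
  then show ?thesis by simp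
qed

context complex_scaling
begin

text \<open>Directional derivatives are continuous by Cauchy's formula, hence bounded on a compact
  ball; finitely many basis directions then bound the operator norm.\<close>

lemma holo_on_lipschitz:
  fixes f :: "'e \<Rightarrow> complex^'m::finite"
  assumes f: "holo_on s (*s) f U" and U: "open U" and p: "p \<in> U"
  shows "\<exists>R>0. \<exists>L. cball p R \<subseteq> U \<and> (\<forall>x\<in>cball p R. \<forall>y\<in>cball p R. norm (f x - f y)
      \<le> L * norm (x - y))"
proof -
  obtain R where R: "R > 0" "cball p R \<subseteq> U" using U p open_contains_cball by blast
  have "\<exists>B. \<forall>x\<in>cball p R. norm (frechet_derivative f (at x) b) \<le> B" for b
  proof -
    have "continuous_on (cball p R) (\<lambda>x. frechet_derivative f (at x) b)"
      using holo_on_continuous[OF holo_dir_deriv[OF f U]] R(2) continuous_on_subset by blast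
    then have "bounded ((\<lambda>x. frechet_derivative f (at x) b) ` cball p R)"
      by (intro compact_imp_bounded compact_continuous_image compact_cball)
    then show ?thesis by (auto simp: bounded_iff)
  qed
  then obtain B where B: "\<And>b x. x \<in> cball p R \<Longrightarrow> norm (frechet_derivative f (at x) b) \<le> B b" by metis
  have "norm (f x - f y) \<le> (\<Sum>b\<in>Basis. B b) * norm (x - y)" if "x \<in> cball p R" "y \<in> cball p R"
    for x y
  proof (rule differentiable_bound[OF convex_cball _ _ that])
    fix x assume x: "x \<in> cball p R"
    then have xU: "x \<in> U" using R(2) by blast
    let ?D = "frechet_derivative f (at x)"
    show "(f has_derivative ?D) (at x within cball p R)"
      using holo_onD(1)[OF f xU] by (rule has_derivative_at_withinI)
    show "onorm ?D \<le> (\<Sum>b\<in>Basis. B b)"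
    proof (rule onorm_le)
      fix w
      have lin: "linear ?D" using holo_onD(1)[OF f xU] by (rule has_derivative_linear)
      have "?D w = ?D (\<Sum>b\<in>Basis. (w \<bullet> b) *\<^sub>R b)" by (simp add: euclidean_representation)
      also have "\<dots> = (\<Sum>b\<in>Basis. (w \<bullet> b) *\<^sub>R ?D b)"
        by (simp add: linear_sum[OF lin] linear_scale[OF lin])
      also have "norm \<dots> \<le> (\<Sum>b\<in>Basis. norm w * B b)"
      proof (rule sum_norm_le)
        fix b :: 'e assume b: "b \<in> Basis"
        have "\<bar>w \<bullet> b\<bar> * norm (?D b) \<le> norm w * B b"
          by (intro mult_mono Basis_le_norm b B x) auto
        then show "norm ((w \<bullet> b) *\<^sub>R ?D b) \<le> norm w * B b" by simp
      qed
      finally show "norm (?D w) \<le> (\<Sum>b\<in>Basis. B b) * norm w"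
        by (simp add: sum_distrib_left mult.commute)
    qed
  qed
  then show ?thesis using R by blast
qed

end

section \<open>Complex Lie groups in charts\<close>

lemma bounded_bilinear_vec_scale: "bounded_bilinear ((*s) :: complex \<Rightarrow> complex^'n::finite \<Rightarrow> _)"
proof -
  have "linear (\<lambda>c. c *s v)" "linear (\<lambda>v. c *s v)" for c :: complex and v :: "complex^'n"
    by (auto intro!: linearI simp: vec_eq_iff algebra_simps)
  then show ?thesis unfolding bilinear_conv_bounded_bilinear[symmetric] bilinear_def by blast
qed

interpretation vec_scaling: complex_scaling "(*s) :: complex \<Rightarrow> complex^'n::finite \<Rightarrow> _"
  by (rule complex_scaling.intro[OF bounded_bilinear_vec_scale])

lemma bounded_bilinear_scale_pair: "bounded_bilinear (scale_pair :: complex \<Rightarrow> (complex^'n::finite) \<times> _ \<Rightarrow> _)"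
proof -
  have "linear (\<lambda>c. scale_pair c v)" "linear (\<lambda>v. scale_pair c v)" for c :: complex
    and v :: "(complex^'n) \<times> _"
    by (auto intro!: linearI simp: vec_eq_iff algebra_simps scale_pair_def)
  then show ?thesis unfolding bilinear_conv_bounded_bilinear[symmetric] bilinear_def by blast
qed

interpretation pair_scaling: complex_scaling "scale_pair :: complex \<Rightarrow> (complex^'n::finite) \<times> _ \<Rightarrow> _"
  by (rule complex_scaling.intro[OF bounded_bilinear_scale_pair])

lemma holo_on_compose:
  assumes f: "holo_on s1 s2 f U" and g: "holo_on s2 s3 g V" and "f ` U \<subseteq> V"
  shows "holo_on s1 s3 (\<lambda>x. g (f x)) U"
  unfolding holo_on_def
proof
  fix x assume x: "x \<in> U"
  then have fx: "f x \<in> V" using assms(3) by blast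
  show "\<exists>D. ((\<lambda>x. g (f x)) has_derivative D) (at x) \<and> (\<forall>c v. D (s1 c v) = s3 c (D v))"
    by (intro exI conjI, rule has_derivative_compose[OF holo_onD(1)[OF f x] holo_onD(1)[OF g fx]])
      (simp add: holo_onD(2)[OF f x] holo_onD(2)[OF g fx])
qed

lemma holo_on_Pair:
  assumes f: "holo_on s (*s) f U" and g: "holo_on s (*s) g U"
  shows "holo_on s scale_pair (\<lambda>x. (f x, g x)) U"
  unfolding holo_on_def
proof
  fix x assume x: "x \<in> U"
  show "\<exists>D. ((\<lambda>x. (f x, g x)) has_derivative D) (at x) \<and> (\<forall>c v. D (s c v) = scale_pair c (D v))"
    by (intro exI conjI, rule has_derivative_Pair[OF holo_onD(1)[OF f x] holo_onD(1)[OF g x]])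
      (simp add: holo_onD(2)[OF f x] holo_onD(2)[OF g x] scale_pair_def)
qed

lemma holo_on_subset: "holo_on s1 s2 f U \<Longrightarrow> V \<subseteq> U \<Longrightarrow> holo_on s1 s2 f V"
  by (auto simp: holo_on_def)

lemma holo_on_fst: "holo_on scale_pair (*s) fst U"
  unfolding holo_on_def by (intro ballI exI[of _ fst]) (auto simp: scale_pair_def intro!: derivative_eq_intros)

lemma holo_on_Pair_left: "holo_on (*s) scale_pair (\<lambda>y. (a, y)) U"
  unfolding holo_on_def
  by (intro ballI exI[of _ "\<lambda>v. (0, v)"]) (auto simp: scale_pair_def intro!: derivative_eq_intros)

lemma holo_on_Pair_right: "holo_on (*s) scale_pair (\<lambda>y. (y, a)) U"
  unfolding holo_on_def
  by (intro ballI exI[of _ "\<lambda>v. (v, 0)"]) (auto simp: scale_pair_def intro!: derivative_eq_intros)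

lemma has_derivative_snd_slot:
  assumes "holo_on s1 s2 F U" "(a, b) \<in> U"
  shows "((\<lambda>y. F (a, y)) has_derivative (\<lambda>v. frechet_derivative F (at (a, b)) (0, v))) (at b)"
proof -
  have "((\<lambda>y. (a, y)) has_derivative (\<lambda>v. (0, v))) (at b)" by (auto intro!: derivative_eq_intros)
  from has_derivative_compose[OF this holo_onD(1)[OF assms]] show ?thesis .
qed

lemma open_continuous_preimage:
  assumes "continuous_map (top_of_set S) T f" "open S" "openin T U"
  shows "open {x \<in> S. f x \<in> U}"
  using openin_continuous_map_preimage[OF assms(1,3)] assms(2) openin_open_trans by fastforce

context complex_manifold
begin

lemma chart_facts:
  assumes "c \<in> A"
  shows "openin T (dom_chart c)" "open (range_chart c)" "inj_on (coord c) (dom_chart c)"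
    "continuous_map (subtopology T (dom_chart c)) (top_of_set (range_chart c)) (coord c)"
    "dom_chart c \<subseteq> topspace T"
proof -
  have c: "is_chart T c" using charts assms by blast
  then show o: "openin T (dom_chart c)" and "open (range_chart c)" by (auto simp: is_chart_def)
  show sub: "dom_chart c \<subseteq> topspace T" using openin_subset[OF o] .
  have h: "homeomorphic_map (subtopology T (dom_chart c)) (top_of_set (range_chart c)) (coord c)"
    using c by (simp add: is_chart_def)
  then show "inj_on (coord c) (dom_chart c)"
    using homeomorphic_imp_injective_map sub by (fastforce simp: Int_absorb1)
  show "continuous_map (subtopology T (dom_chart c)) (top_of_set (range_chart c)) (coord c)"
    by (rule homeomorphic_imp_continuous_map[OF h])
qed

lemma inv_coord_coord: "c \<in> A \<Longrightarrow> g \<in> dom_chart c \<Longrightarrow> inv_coord c (coord c g) = g"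
  unfolding inv_coord_def by (rule the_inv_into_f_f[OF chart_facts(3)])

lemma coord_inv_coord: "c \<in> A \<Longrightarrow> x \<in> range_chart c \<Longrightarrow> coord c (inv_coord c x) = x"
  unfolding inv_coord_def by (rule f_the_inv_into_f[OF chart_facts(3)])

lemma inv_coord_dom: "c \<in> A \<Longrightarrow> x \<in> range_chart c \<Longrightarrow> inv_coord c x \<in> dom_chart c"
  unfolding inv_coord_def by (rule the_inv_into_into[OF chart_facts(3)]) auto

lemma continuous_map_inv_coord:
  assumes "c \<in> A"
  shows "continuous_map (top_of_set (range_chart c)) T (inv_coord c)"
proof -
  have sub: "dom_chart c \<subseteq> topspace T" by (rule chart_facts(5)[OF assms])
  have "homeomorphic_map (subtopology T (dom_chart c)) (top_of_set (range_chart c)) (coord c)"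
    using charts[OF assms] by (simp add: is_chart_def)
  then obtain g where g: "homeomorphic_maps (subtopology T (dom_chart c)) (top_of_set (range_chart c)) (coord c) g"
    by (auto simp: homeomorphic_map_maps)
  then have "continuous_map (top_of_set (range_chart c)) (subtopology T (dom_chart c)) g"
    by (simp add: homeomorphic_maps_def)
  then have cg: "continuous_map (top_of_set (range_chart c)) T g"
    by (rule continuous_map_into_fulltopology)
  have "g x = inv_coord c x" if x: "x \<in> range_chart c" for x
  proof -
    obtain h where h: "h \<in> dom_chart c" "x = coord c h" using x by blast
    then have "g (coord c h) = h" using g sub by (auto simp: homeomorphic_maps_def)
    then show ?thesis using h inv_coord_coord[OF assms h(1)] by simp
  qed
  then show ?thesis by (intro continuous_map_eq[OF cg]) auto
qed

end

context complex_lie_group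
begin

section \<open>The chart at the identity, and translations in charts\<close>

definition c1 :: "('a, 'n) chart" where "c1 = chart_one G A"

definition \<phi> :: "'a \<Rightarrow> complex^'n" where "\<phi> = coord c1"

definition \<psi> :: "complex^'n \<Rightarrow> 'a" where "\<psi> = inv_coord c1"

definition e1 :: "complex^'n" where "e1 = \<phi> \<one>"

lemma chart_at:
  assumes "g \<in> carrier G"
  shows "\<exists>c\<in>A. g \<in> dom_chart c"
  using assms cover carrier by auto

lemma c1: "c1 \<in> A" "\<one> \<in> dom_chart c1"
proof -
  have "\<exists>c. c \<in> A \<and> \<one> \<in> dom_chart c" using chart_at[OF one_closed] by blast
  from someI_ex[OF this] show "c1 \<in> A" "\<one> \<in> dom_chart c1"
    by (auto simp: c1_def chart_one_def)
qed

lemma dom_carrier: "c \<in> A \<Longrightarrow> dom_chart c \<subseteq> carrier G"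
  using chart_facts(5) carrier by blast

lemma \<psi>_\<phi>: "g \<in> dom_chart c1 \<Longrightarrow> \<psi> (\<phi> g) = g"
  by (simp add: \<psi>_def \<phi>_def inv_coord_coord c1)

lemma \<phi>_\<psi>: "x \<in> range_chart c1 \<Longrightarrow> \<phi> (\<psi> x) = x"
  by (simp add: \<psi>_def \<phi>_def coord_inv_coord c1)

lemma \<psi>_dom: "x \<in> range_chart c1 \<Longrightarrow> \<psi> x \<in> dom_chart c1"
  by (simp add: \<psi>_def inv_coord_dom c1)

lemma \<psi>_closed: "x \<in> range_chart c1 \<Longrightarrow> \<psi> x \<in> carrier G"
  using \<psi>_dom dom_carrier[OF c1(1)] by blast

lemma \<phi>_range: "g \<in> dom_chart c1 \<Longrightarrow> \<phi> g \<in> range_chart c1"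
  by (simp add: \<phi>_def)

lemma e1: "e1 \<in> range_chart c1" "\<psi> e1 = \<one>"
  by (auto simp: e1_def \<phi>_range \<psi>_\<phi> c1)

definition mult_dom :: "('a, 'n) chart \<Rightarrow> ('a, 'n) chart \<Rightarrow> ('a, 'n) chart \<Rightarrow> ((complex^'n) \<times> (complex^'n)) set"
  where "mult_dom c d e = {(x, y). x \<in> range_chart c \<and> y \<in> range_chart d \<and>
    inv_coord c x \<otimes> inv_coord d y \<in> dom_chart e}"

text \<open>Differentiating the multiplication by \<open>holo_dir_deriv\<close> requires an open
  domain; openness comes from joint continuity of the multiplication.\<close>

lemma open_mult_dom:
  assumes "c \<in> A" "d \<in> A" "e \<in> A"
  shows "open (mult_dom c d e)"
proof -
  let ?S = "range_chart c \<times> range_chart d"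
  have 1: "continuous_map (top_of_set ?S) (top_of_set (range_chart c)) fst"
    "continuous_map (top_of_set ?S) (top_of_set (range_chart d)) snd"
    by (auto intro!: continuous_intros simp: image_subset_iff)
  have "continuous_map (top_of_set ?S) (prod_topology T T) (\<lambda>z. (inv_coord c (fst z), inv_coord d (snd z)))"
    using continuous_map_compose[OF 1(1) continuous_map_inv_coord[OF assms(1)]]
      continuous_map_compose[OF 1(2) continuous_map_inv_coord[OF assms(2)]]
    by (auto simp: continuous_map_pairwise comp_def)
  from continuous_map_compose[OF this mult_continuous]
  have "continuous_map (top_of_set ?S) T (\<lambda>z. inv_coord c (fst z) \<otimes> inv_coord d (snd z))"
    by (simp add: comp_def)
  then have "open {z \<in> ?S. inv_coord c (fst z) \<otimes> inv_coord d (snd z) \<in> dom_chart e}"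
    by (rule open_continuous_preimage) (auto intro: open_Times chart_facts assms)
  also have "{z \<in> ?S. inv_coord c (fst z) \<otimes> inv_coord d (snd z) \<in> dom_chart e} = mult_dom c d e"
    by (auto simp: mult_dom_def)
  finally show ?thesis .
qed

lemma holo_mult:
  assumes "c \<in> A" "d \<in> A" "e \<in> A"
  shows "holo_on scale_pair (*s) (\<lambda>z. coord e (inv_coord c (fst z) \<otimes> inv_coord d (snd z))) (mult_dom c d e)"
  using mult_holomorphic[OF assms] by (simp add: mult_dom_def case_prod_unfold)

lemma holo_left_translation:
  assumes "g \<in> carrier G" "c \<in> A" "e \<in> A"
  shows "open {x \<in> range_chart c. g \<otimes> inv_coord c x \<in> dom_chart e}"
    and "holo_on (*s) (*s) (\<lambda>x. coord e (g \<otimes> inv_coord c x)) {x \<in> range_chart c. g \<otimes> inv_coord c x \<in> dom_chart e}"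
proof -
  let ?V = "{x \<in> range_chart c. g \<otimes> inv_coord c x \<in> dom_chart e}"
  obtain d where d: "d \<in> A" "g \<in> dom_chart d" using chart_at[OF assms(1)] by blast
  have V: "?V = (\<lambda>x. (coord d g, x)) -` mult_dom d c e"
    using d by (auto simp: mult_dom_def inv_coord_coord)
  show "open ?V"
    unfolding V by (rule open_vimage[OF open_mult_dom]) (auto intro!: continuous_intros d assms)
  have "holo_on (*s) (*s) (\<lambda>x. coord e (inv_coord d (fst (coord d g, x)) \<otimes> inv_coord c (snd (coord d g, x)))) ?V"
    by (rule holo_on_compose[OF holo_on_Pair_left holo_mult[OF d(1) assms(2,3)]]) (use V in auto)
  then show "holo_on (*s) (*s) (\<lambda>x. coord e (g \<otimes> inv_coord c x)) ?V"
    by (simp add: inv_coord_coord d)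
qed

lemma holo_right_translation:
  assumes "g \<in> carrier G" "c \<in> A" "e \<in> A"
  shows "open {x \<in> range_chart c. inv_coord c x \<otimes> g \<in> dom_chart e}"
    and "holo_on (*s) (*s) (\<lambda>x. coord e (inv_coord c x \<otimes> g)) {x \<in> range_chart c. inv_coord c x \<otimes> g \<in> dom_chart e}"
proof -
  let ?V = "{x \<in> range_chart c. inv_coord c x \<otimes> g \<in> dom_chart e}"
  obtain d where d: "d \<in> A" "g \<in> dom_chart d" using chart_at[OF assms(1)] by blast
  have V: "?V = (\<lambda>x. (x, coord d g)) -` mult_dom c d e"
    using d by (auto simp: mult_dom_def inv_coord_coord)
  show "open ?V"
    unfolding V by (rule open_vimage[OF open_mult_dom]) (auto intro!: continuous_intros d assms)
  have "holo_on (*s) (*s) (\<lambda>x. coord e (inv_coord c (fst (x, coord d g)) \<otimes> inv_coord d (snd (x, coord d g)))) ?V"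
    by (rule holo_on_compose[OF holo_on_Pair_right holo_mult[OF assms(2) d(1) assms(3)]]) (use V in auto)
  then show "holo_on (*s) (*s) (\<lambda>x. coord e (inv_coord c x \<otimes> g)) ?V"
    by (simp add: inv_coord_coord d)
qed

section \<open>The adjoint representation\<close>

definition conj_map :: "'a \<Rightarrow> complex^'n \<Rightarrow> complex^'n"
  where "conj_map g x = \<phi> (g \<otimes> \<psi> x \<otimes> inv g)"

lemma Ad_eq: "Ad G A g = frechet_derivative (conj_map g) (at e1)"
  by (simp add: Ad_def Let_def conj_map_def[abs_def] \<phi>_def \<psi>_def c1_def e1_def)

text \<open>Conjugation passes through a chart at \<open>g\<close>, as \<open>g\<close> need not lie in the chart at the identity.\<close>

lemma holo_conj_map:
  assumes g: "g \<in> carrier G"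
  shows "\<exists>V. open V \<and> e1 \<in> V \<and> V \<subseteq> range_chart c1 \<and> (\<forall>x\<in>V. g \<otimes> \<psi> x \<otimes> inv g \<in> dom_chart c1) \<and>
    holo_on (*s) (*s) (conj_map g) V"
proof -
  obtain e where e: "e \<in> A" "g \<in> dom_chart e" using chart_at[OF g] by blast
  define V1 where "V1 = {x \<in> range_chart c1. g \<otimes> inv_coord c1 x \<in> dom_chart e}"
  define V2 where "V2 = {y \<in> range_chart e. inv_coord e y \<otimes> inv g \<in> dom_chart c1}"
  define f where "f x = coord e (g \<otimes> inv_coord c1 x)" for x
  have V1: "open V1" and f: "holo_on (*s) (*s) f V1"
    unfolding V1_def f_def using holo_left_translation[OF g c1(1) e(1)] by auto
  have V2: "open V2" and h: "holo_on (*s) (*s) (\<lambda>y. coord c1 (inv_coord e y \<otimes> inv g)) V2"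
    unfolding V2_def using holo_right_translation[OF inv_closed[OF g] e(1) c1(1)] by auto
  define V where "V = V1 \<inter> f -` V2"
  have inv_f: "inv_coord e (f x) = g \<otimes> \<psi> x" if "x \<in> V1" for x
    using that e unfolding V1_def f_def \<psi>_def by (simp add: inv_coord_coord)
  have "open V"
    unfolding V_def using continuous_open_preimage[OF holo_on_continuous[OF f] V1 V2] .
  moreover have "e1 \<in> V"
  proof -
    have "e1 \<in> V1" using e1 e g by (simp add: V1_def \<psi>_def)
    moreover have "f e1 \<in> V2"
      using inv_f[OF \<open>e1 \<in> V1\<close>] e1 e g c1 unfolding V2_def by (simp add: f_def \<psi>_def)
    ultimately show ?thesis by (simp add: V_def)
  qed
  moreover have "V \<subseteq> range_chart c1" by (auto simp: V_def V1_def)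
  moreover have "g \<otimes> \<psi> x \<otimes> inv g \<in> dom_chart c1" if "x \<in> V" for x
    using that inv_f[of x] by (auto simp: V_def V2_def)
  moreover have "holo_on (*s) (*s) (conj_map g) V"
  proof (rule holo_on_cong[OF \<open>open V\<close>])
    show "holo_on (*s) (*s) (\<lambda>x. coord c1 (inv_coord e (f x) \<otimes> inv g)) V"
      by (rule holo_on_compose[OF holo_on_subset[OF f] h]) (auto simp: V_def)
    show "coord c1 (inv_coord e (f x) \<otimes> inv g) = conj_map g x" if "x \<in> V" for x
      using that inv_f[of x] by (simp add: V_def conj_map_def \<phi>_def)
  qed
  ultimately show ?thesis by blast
qed

lemma conj_map_e1: "g \<in> carrier G \<Longrightarrow> conj_map g e1 = e1"
  by (simp add: conj_map_def e1 flip: e1_def)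

lemma Ad_has_derivative:
  assumes "g \<in> carrier G"
  shows "(conj_map g has_derivative Ad G A g) (at e1)"
  using holo_conj_map[OF assms] holo_onD(1) Ad_eq by metis

lemma clinear_if_real_linear: "linear f \<Longrightarrow> (\<And>c v. f (c *s v) = c *s f v) \<Longrightarrow> clinear f"
  by unfold_locales (auto simp: linear_add)

lemma Ad_linear:
  assumes "g \<in> carrier G"
  shows "clinear (Ad G A g)"
proof (rule clinear_if_real_linear)
  show "linear (Ad G A g)" using Ad_has_derivative[OF assms] by (rule has_derivative_linear)
  obtain V where "e1 \<in> V" "holo_on (*s) (*s) (conj_map g) V" using holo_conj_map[OF assms] by blast
  then show "Ad G A g (c *s v) = c *s Ad G A g v" for c v
    unfolding Ad_eq using holo_onD(2) by blast
qed

text \<open>Conjugation fixes \<open>e1\<close>, so the chain rule applies there. In coordinates the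
  composition law is used near \<open>e1\<close>, where conjugation by \<open>h\<close> stays in the
  chart.\<close>

lemma Ad_mult:
  assumes g: "g \<in> carrier G" and h: "h \<in> carrier G"
  shows "Ad G A (g \<otimes> h) = Ad G A g \<circ> Ad G A h"
proof -
  obtain V where V: "open V" "e1 \<in> V" "V \<subseteq> range_chart c1" "\<forall>x\<in>V. h \<otimes> \<psi> x \<otimes> inv h \<in> dom_chart c1"
    using holo_conj_map[OF h] by blast
  have "(conj_map g has_derivative Ad G A g) (at (conj_map h e1))"
    using Ad_has_derivative[OF g] by (simp add: conj_map_e1[OF h])
  from has_derivative_compose[OF Ad_has_derivative[OF h] this]
  have "((\<lambda>x. conj_map g (conj_map h x)) has_derivative (\<lambda>v. Ad G A g (Ad G A h v))) (at e1)" .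
  moreover have "conj_map g (conj_map h x) = conj_map (g \<otimes> h) x" if x: "x \<in> V" for x
  proof -
    have "\<psi> x \<in> carrier G" using V(3) x \<psi>_closed by blast
    moreover have "\<psi> (\<phi> (h \<otimes> \<psi> x \<otimes> inv h)) = h \<otimes> \<psi> x \<otimes> inv h"
      using V(4) x \<psi>_\<phi> by blast
    ultimately show ?thesis
      using g h by (simp add: conj_map_def m_assoc inv_mult_group)
  qed
  ultimately have "(conj_map (g \<otimes> h) has_derivative (\<lambda>v. Ad G A g (Ad G A h v))) (at e1)"
    using has_derivative_transform_within_open[OF _ V(1,2)] by blast
  then show ?thesis
    using has_derivative_unique[OF Ad_has_derivative[OF m_closed[OF g h]]] by (simp add: comp_def)
qed

lemma Ad_one: "Ad G A \<one> v = v"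
proof -
  have "((\<lambda>x. x) has_derivative (\<lambda>v. v)) (at e1)" by simp
  then have "(conj_map \<one> has_derivative (\<lambda>v. v)) (at e1)"
    by (rule has_derivative_transform_within_open[OF _ chart_facts(2)[OF c1(1)] e1(1)])
      (simp add: conj_map_def \<psi>_closed \<phi>_\<psi>)
  then show ?thesis using has_derivative_unique[OF Ad_has_derivative[OF one_closed]] by metis
qed

section \<open>Multiplication and conjugation in both variables near the identity\<close>

definition chart_mult :: "(complex^'n) \<times> (complex^'n) \<Rightarrow> complex^'n"
  where "chart_mult z = \<phi> (\<psi> (fst z) \<otimes> \<psi> (snd z))"

definition chart_inv :: "complex^'n \<Rightarrow> complex^'n"
  where "chart_inv x = \<phi> (inv \<psi> x)"

definition chart_conj :: "(complex^'n) \<times> (complex^'n) \<Rightarrow> complex^'n"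
  where "chart_conj z = conj_map (\<psi> (fst z)) (snd z)"

abbreviation Md :: "((complex^'n) \<times> (complex^'n)) set" where "Md \<equiv> mult_dom c1 c1 c1"

lemma Md_iff: "(x, y) \<in> Md \<longleftrightarrow> x \<in> range_chart c1 \<and> y \<in> range_chart c1 \<and> \<psi> x \<otimes> \<psi> y \<in> dom_chart c1"
  by (simp add: mult_dom_def \<psi>_def)

lemma open_Md: "open Md"
  by (rule open_mult_dom[OF c1(1) c1(1) c1(1)])

lemma holo_chart_mult: "holo_on scale_pair (*s) chart_mult Md"
  using holo_mult[OF c1(1) c1(1) c1(1)] by (simp add: chart_mult_def[abs_def] \<phi>_def \<psi>_def)

lemma open_range_c1: "open (range_chart c1)"
  by (rule chart_facts(2)[OF c1(1)])

lemma Md_e1_right: "x \<in> range_chart c1 \<Longrightarrow> (x, e1) \<in> Md"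
  by (simp add: Md_iff e1 \<psi>_closed \<psi>_dom)

lemma chart_mult_e1_right: "x \<in> range_chart c1 \<Longrightarrow> chart_mult (x, e1) = x"
  by (simp add: chart_mult_def e1 \<psi>_closed \<phi>_\<psi>)

lemma chart_mult_e1_left: "x \<in> range_chart c1 \<Longrightarrow> chart_mult (e1, x) = x"
  by (simp add: chart_mult_def e1 \<psi>_closed \<phi>_\<psi>)

lemma \<psi>_chart_mult: "(x, y) \<in> Md \<Longrightarrow> \<psi> (chart_mult (x, y)) = \<psi> x \<otimes> \<psi> y"
  by (simp add: Md_iff chart_mult_def \<psi>_\<phi>)

lemma chart_mult_range: "z \<in> Md \<Longrightarrow> chart_mult z \<in> range_chart c1"
  by (cases z) (auto simp: Md_iff chart_mult_def intro!: \<phi>_range)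

lemma holo_chart_inv:
  "open {x \<in> range_chart c1. inv (\<psi> x) \<in> dom_chart c1}"
  "holo_on (*s) (*s) chart_inv {x \<in> range_chart c1. inv (\<psi> x) \<in> dom_chart c1}"
proof -
  have "continuous_map (top_of_set (range_chart c1)) T (\<lambda>x. inv (\<psi> x))"
    using continuous_map_compose[OF continuous_map_inv_coord[OF c1(1)] inv_continuous]
    by (simp add: comp_def \<psi>_def)
  then show "open {x \<in> range_chart c1. inv (\<psi> x) \<in> dom_chart c1}"
    by (rule open_continuous_preimage[OF _ open_range_c1 chart_facts(1)[OF c1(1)]])
  show "holo_on (*s) (*s) chart_inv {x \<in> range_chart c1. inv (\<psi> x) \<in> dom_chart c1}"
    using inv_holomorphic[OF c1(1) c1(1)] by (simp add: chart_inv_def[abs_def] \<phi>_def \<psi>_def)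
qed

text \<open>In \<open>holo_conj_map\<close> the group element is fixed, whereas differentiating Ad
  in it needs holomorphy in both variables. Near \<open>(e1, e1)\<close> every intermediate product
  stays in one chart, and conjugation is composed of \<open>chart_mult\<close> and
  \<open>chart_inv\<close>.\<close>

lemma holo_chart_conj:
  "\<exists>W. open W \<and> (e1, e1) \<in> W \<and> W \<subseteq> Md \<and> holo_on scale_pair (*s) chart_conj W"
proof -
  define I where "I = {x \<in> range_chart c1. inv (\<psi> x) \<in> dom_chart c1}"
  define U where "U = Md \<inter> fst -` I"
  define P where "P z = (chart_mult z, chart_inv (fst z))" for z
  define W where "W = U \<inter> P -` Md"
  have U: "open U" unfolding U_def I_def
    by (intro open_Int open_Md open_vimage_fst holo_chart_inv(1))
  have P: "holo_on scale_pair scale_pair P U" unfolding P_def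
  proof (rule holo_on_Pair)
    show "holo_on scale_pair (*s) chart_mult U"
      by (rule holo_on_subset[OF holo_chart_mult]) (simp add: U_def)
    show "holo_on scale_pair (*s) (\<lambda>z. chart_inv (fst z)) U"
      by (rule holo_on_compose[OF holo_on_fst holo_chart_inv(2)]) (auto simp: U_def I_def)
  qed
  have W: "open W" unfolding W_def
    by (rule continuous_open_preimage[OF holo_on_continuous[OF P] U open_Md])
  have "e1 \<in> I" by (simp add: I_def e1 c1)
  then have "(e1, e1) \<in> W"
    by (simp add: W_def U_def P_def Md_e1_right e1 chart_mult_e1_right chart_inv_def Md_e1_right flip: e1_def)
  moreover have "W \<subseteq> Md" by (auto simp: W_def U_def)
  moreover have "holo_on scale_pair (*s) chart_conj W"
  proof (rule holo_on_cong[OF W])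
    show "holo_on scale_pair (*s) (\<lambda>z. chart_mult (P z)) W"
      by (rule holo_on_compose[OF holo_on_subset[OF P] holo_chart_mult]) (auto simp: W_def)
    fix z assume z: "z \<in> W"
    obtain x y where [simp]: "z = (x, y)" by force
    have "(x, y) \<in> Md" "x \<in> I" using z by (auto simp: W_def U_def)
    then show "chart_mult (P z) = chart_conj z"
      unfolding chart_conj_def conj_map_def
      by (simp add: P_def chart_mult_def[of "(chart_mult _, _)"] \<psi>_chart_mult chart_inv_def I_def \<psi>_\<phi>)
  qed
  ultimately show ?thesis using W by blast
qed

text \<open>Ad is the directional derivative of \<open>chart_conj\<close> in the direction
  \<open>(0, Y)\<close>, hence again holomorphic. This makes the bracket the value of an actual
  derivative.\<close>

lemma holo_Ad:
  "\<exists>V. open V \<and> e1 \<in> V \<and> V \<subseteq> range_chart c1 \<and> (\<forall>Y. holo_on (*s) (*s) (\<lambda>x. Ad G A (\<psi> x) Y) V)"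
proof -
  obtain W where W: "open W" "(e1, e1) \<in> W" "W \<subseteq> Md" "holo_on scale_pair (*s) chart_conj W"
    using holo_chart_conj by blast
  define V where "V = (\<lambda>x. (x, e1)) -` W"
  have V: "open V" unfolding V_def by (rule open_vimage[OF W(1)]) (auto intro!: continuous_intros)
  have VR: "V \<subseteq> range_chart c1" using W(3) by (auto simp: V_def Md_iff)
  have "holo_on (*s) (*s) (\<lambda>x. Ad G A (\<psi> x) Y) V" for Y
  proof (rule holo_on_cong[OF V])
    show "holo_on (*s) (*s) (\<lambda>x. frechet_derivative chart_conj (at (x, e1)) (0, Y)) V"
      by (rule holo_on_compose[OF holo_on_Pair_right pair_scaling.holo_dir_deriv[OF W(4,1)]])
        (auto simp: V_def)
    fix x assume x: "x \<in> V"
    then have "(x, e1) \<in> W" by (simp add: V_def)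
    from has_derivative_snd_slot[OF W(4) this]
    have "(conj_map (\<psi> x) has_derivative (\<lambda>v. frechet_derivative chart_conj (at (x, e1)) (0, v)))
        (at e1)"
      by (simp add: chart_conj_def)
    then show "frechet_derivative chart_conj (at (x, e1)) (0, Y) = Ad G A (\<psi> x) Y"
      unfolding Ad_eq using frechet_derivative_at by metis
  qed
  then show ?thesis using V VR W(2) by (intro exI[of _ V]) (auto simp: V_def)
qed

section \<open>The bracket, and its computation along curves\<close>

lemma lie_bracket_eq: "lie_bracket G A X Y = frechet_derivative (\<lambda>x. Ad G A (\<psi> x) Y) (at e1) X"
  by (simp add: lie_bracket_def Let_def \<phi>_def \<psi>_def c1_def e1_def)

lemma lie_bracket_has_derivative:
  "((\<lambda>x. Ad G A (\<psi> x) Y) has_derivative (\<lambda>X. lie_bracket G A X Y)) (at e1)"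
  using holo_Ad holo_onD(1) unfolding lie_bracket_eq[abs_def] by blast

lemma lie_bracket_linear_left: "clinear (\<lambda>X. lie_bracket G A X Y)"
proof (rule clinear_if_real_linear)
  show "linear (\<lambda>X. lie_bracket G A X Y)"
    using lie_bracket_has_derivative by (rule has_derivative_linear)
  show "lie_bracket G A (c *s v) Y = c *s lie_bracket G A v Y" for c v
    using holo_Ad holo_onD(2) unfolding lie_bracket_eq by blast
qed

lemma lie_bracket_linear_right: "clinear (lie_bracket G A X)"
proof (rule clinearI)
  obtain V where V: "open V" "e1 \<in> V" "V \<subseteq> range_chart c1" using holo_Ad by blast
  have lin: "clinear (Ad G A (\<psi> x))" if "x \<in> V" for x
    using Ad_linear \<psi>_closed V(3) that by blast
  fix Y Z c
  have "((\<lambda>x. Ad G A (\<psi> x) Y + Ad G A (\<psi> x) Z) has_derivative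
      (\<lambda>X. lie_bracket G A X Y + lie_bracket G A X Z)) (at e1)"
    by (intro has_derivative_add lie_bracket_has_derivative)
  then have "((\<lambda>x. Ad G A (\<psi> x) (Y + Z)) has_derivative
      (\<lambda>X. lie_bracket G A X Y + lie_bracket G A X Z)) (at e1)"
    by (rule has_derivative_transform_within_open[OF _ V(1,2)]) (simp add: vec.linear_add[OF lin])
  from has_derivative_unique[OF lie_bracket_has_derivative this]
  show "lie_bracket G A X (Y + Z) = lie_bracket G A X Y + lie_bracket G A X Z" by metis
  have "((\<lambda>x. c *s Ad G A (\<psi> x) Y) has_derivative (\<lambda>X. c *s lie_bracket G A X Y)) (at e1)"
    by (rule bounded_linear.has_derivative[OF bounded_bilinear.bounded_linear_right[OF bounded_bilinear_vec_scale]
      lie_bracket_has_derivative])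
  then have "((\<lambda>x. Ad G A (\<psi> x) (c *s Y)) has_derivative (\<lambda>X. c *s lie_bracket G A X Y)) (at e1)"
    by (rule has_derivative_transform_within_open[OF _ V(1,2)]) (simp add: vec.linear_scale[OF lin])
  from has_derivative_unique[OF lie_bracket_has_derivative this]
  show "lie_bracket G A X (c *s Y) = c *s lie_bracket G A X Y" by metis
qed

text \<open>Records the velocity at 0 and no homomorphism law, since the derivative of Ad depends on
  the velocity alone.\<close>

definition curve :: "complex^'n \<Rightarrow> (real \<Rightarrow> 'a) \<Rightarrow> bool"
  where "curve X \<gamma> \<longleftrightarrow> continuous_map euclideanreal T \<gamma> \<and> \<gamma> 0 = \<one> \<and>
    ((\<lambda>t. \<phi> (\<gamma> t)) has_vector_derivative X) (at 0)"

lemma curve_closed: "curve X \<gamma> \<Longrightarrow> \<gamma> t \<in> carrier G"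
  by (auto simp: curve_def continuous_map_def carrier)

lemma curve_near:
  assumes "curve X \<gamma>"
  shows "open {t. \<gamma> t \<in> dom_chart c1}" "0 \<in> {t. \<gamma> t \<in> dom_chart c1}"
  using assms openin_continuous_map_preimage[of euclideanreal T \<gamma>, OF _ chart_facts(1)[OF c1(1)]] c1(2)
  by (auto simp: curve_def)

lemma curve_Ad:
  assumes "curve X \<gamma>"
  shows "((\<lambda>t. Ad G A (\<gamma> t) Y) has_vector_derivative lie_bracket G A X Y) (at 0)"
proof -
  have 1: "((\<lambda>t. \<phi> (\<gamma> t)) has_derivative (\<lambda>h. h *\<^sub>R X)) (at 0)" and "\<phi> (\<gamma> 0) = e1"
    using assms by (auto simp: curve_def has_vector_derivative_def e1_def)
  then have "((\<lambda>x. Ad G A (\<psi> x) Y) has_derivative (\<lambda>X. lie_bracket G A X Y)) (at (\<phi> (\<gamma> 0)))"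
    using lie_bracket_has_derivative by simp
  from has_derivative_compose[OF 1 this]
  have "((\<lambda>t. Ad G A (\<psi> (\<phi> (\<gamma> t))) Y) has_derivative (\<lambda>h. lie_bracket G A (h *\<^sub>R X) Y)) (at 0)" .
  then have "((\<lambda>t. Ad G A (\<gamma> t) Y) has_derivative (\<lambda>h. lie_bracket G A (h *\<^sub>R X) Y)) (at 0)"
    by (rule has_derivative_transform_within_open[OF _ curve_near[OF assms]]) (simp add: \<psi>_\<phi>)
  moreover have "lie_bracket G A (h *\<^sub>R X) Y = h *\<^sub>R lie_bracket G A X Y" for h
    by (rule linear_scale[OF has_derivative_linear[OF lie_bracket_has_derivative]])
  ultimately show ?thesis by (simp add: has_vector_derivative_def)
qed

lemma continuous_map_group_mult:
  assumes "continuous_map X T f" "continuous_map X T g"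
  shows "continuous_map X T (\<lambda>x. f x \<otimes> g x)"
proof -
  have "continuous_map X (prod_topology T T) (\<lambda>x. (f x, g x))"
    using assms by (simp add: continuous_map_pairwise comp_def)
  from continuous_map_compose[OF this mult_continuous] show ?thesis by (simp add: comp_def)
qed

lemma curve_conj:
  assumes \<gamma>: "curve X \<gamma>" and g: "g \<in> carrier G"
  shows "curve (Ad G A g X) (\<lambda>t. g \<otimes> \<gamma> t \<otimes> inv g)"
proof -
  have "continuous_map euclideanreal T (\<lambda>t. g \<otimes> \<gamma> t \<otimes> inv g)"
    using \<gamma> g by (intro continuous_map_group_mult) (auto simp: curve_def carrier)
  moreover have "((\<lambda>t. \<phi> (g \<otimes> \<gamma> t \<otimes> inv g)) has_vector_derivative Ad G A g X) (at 0)"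
  proof -
    have 1: "((\<lambda>t. \<phi> (\<gamma> t)) has_derivative (\<lambda>h. h *\<^sub>R X)) (at 0)" and "\<phi> (\<gamma> 0) = e1"
      using \<gamma> by (auto simp: curve_def has_vector_derivative_def e1_def)
    then have "(conj_map g has_derivative Ad G A g) (at (\<phi> (\<gamma> 0)))"
      using Ad_has_derivative[OF g] by simp
    from has_derivative_compose[OF 1 this]
    have "((\<lambda>t. conj_map g (\<phi> (\<gamma> t))) has_derivative (\<lambda>h. Ad G A g (h *\<^sub>R X))) (at 0)" .
    then have "((\<lambda>t. \<phi> (g \<otimes> \<gamma> t \<otimes> inv g)) has_derivative (\<lambda>h. Ad G A g (h *\<^sub>R X))) (at 0)"
      by (rule has_derivative_transform_within_open[OF _ curve_near[OF \<gamma>]]) (simp add: \<psi>_\<phi> conj_map_def)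
    moreover have "Ad G A g (h *\<^sub>R X) = h *\<^sub>R Ad G A g X" for h
      by (rule linear_scale[OF has_derivative_linear[OF Ad_has_derivative[OF g]]])
    ultimately show ?thesis by (simp add: has_vector_derivative_def)
  qed
  ultimately show ?thesis using \<gamma> g by (simp add: curve_def)
qed

text \<open>Differentiate Ad (g \<gamma> g^-1) (Ad g Y) = Ad g (Ad \<gamma> Y) at 0. That
  \<open>X\<close> is the velocity of a curve is a premise here; one-parameter subgroups supply such
  curves later.\<close>

lemma Ad_lie_bracket:
  assumes \<gamma>: "curve X \<gamma>" and g: "g \<in> carrier G"
  shows "Ad G A g (lie_bracket G A X Y) = lie_bracket G A (Ad G A g X) (Ad G A g Y)"
proof -
  have gt: "\<gamma> t \<in> carrier G" for t by (rule curve_closed[OF \<gamma>])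
  have "bounded_linear (Ad G A g)"
    using Ad_has_derivative[OF g] by (rule has_derivative_bounded_linear)
  from bounded_linear.has_vector_derivative[OF this curve_Ad[OF \<gamma>]]
  have "((\<lambda>t. Ad G A g (Ad G A (\<gamma> t) Y)) has_vector_derivative Ad G A g (lie_bracket G A X Y))
      (at 0)" .
  moreover have "Ad G A (g \<otimes> \<gamma> t \<otimes> inv g) (Ad G A g Y) = Ad G A g (Ad G A (\<gamma> t) Y)" for t
  proof -
    have "Ad G A (g \<otimes> \<gamma> t \<otimes> inv g) (Ad G A g Y) = Ad G A (g \<otimes> \<gamma> t \<otimes> inv g \<otimes> g) Y"
      using Ad_mult[of "g \<otimes> \<gamma> t \<otimes> inv g" g] g gt by simp
    also have "g \<otimes> \<gamma> t \<otimes> inv g \<otimes> g = g \<otimes> \<gamma> t" using g gt by (simp add: m_assoc)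
    finally show ?thesis using Ad_mult[OF g gt] by simp
  qed
  then have "((\<lambda>t. Ad G A g (Ad G A (\<gamma> t) Y))
      has_vector_derivative lie_bracket G A (Ad G A g X) (Ad G A g Y)) (at 0)"
    using curve_Ad[OF curve_conj[OF \<gamma> g], of "Ad G A g Y"] by simp
  ultimately show ?thesis by (rule vector_derivative_unique_at)
qed

section \<open>One-parameter subgroups\<close>

lemma one_param_subgroup_iff:
  "one_param_subgroup G T A X \<gamma> \<longleftrightarrow> curve X \<gamma> \<and> (\<forall>s t. \<gamma> (s + t) = \<gamma> s \<otimes> \<gamma> t)"
proof -
  have "\<gamma> 0 = \<one>" if "continuous_map euclideanreal T \<gamma>" "\<forall>s t. \<gamma> (s + t) = \<gamma> s \<otimes> \<gamma> t"
  proof -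
    have "\<gamma> 0 \<in> carrier G" using that(1) by (auto simp: continuous_map_def carrier)
    moreover have "\<gamma> 0 = \<gamma> 0 \<otimes> \<gamma> 0" using that(2)[rule_format, of 0 0] by simp
    ultimately show ?thesis using l_cancel_one' by metis
  qed
  then show ?thesis
    by (auto simp: one_param_subgroup_def curve_def \<phi>_def c1_def)
qed

text \<open>The left-invariant vector field with value \<open>X\<close> at the identity, in
  coordinates: left translation by the point \<open>x\<close>, differentiated at
  \<open>e1\<close>.\<close>

definition left_field :: "complex^'n \<Rightarrow> complex^'n \<Rightarrow> complex^'n"
  where "left_field X x = frechet_derivative chart_mult (at (x, e1)) (0, X)"

lemma holo_left_field: "holo_on (*s) (*s) (left_field X) (range_chart c1)"
  unfolding left_field_def[abs_def]
  by (rule holo_on_compose[OF holo_on_Pair_right pair_scaling.holo_dir_deriv[OF holo_chart_mult open_Md]])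
    (use Md_e1_right in blast)

lemma left_field_e1: "left_field X e1 = X"
proof -
  have "((\<lambda>y. chart_mult (e1, y)) has_derivative (\<lambda>v. frechet_derivative chart_mult
      (at (e1, e1)) (0, v))) (at e1)"
    by (rule has_derivative_snd_slot[OF holo_chart_mult Md_e1_right[OF e1(1)]])
  then have "((\<lambda>y. y) has_derivative (\<lambda>v. frechet_derivative chart_mult (at (e1, e1)) (0, v)))
      (at e1)"
    by (rule has_derivative_transform_within_open[OF _ open_range_c1 e1(1)]) (rule chart_mult_e1_left)
  from has_derivative_unique[OF this has_derivative_ident]
  show ?thesis by (simp add: left_field_def fun_eq_iff)
qed

text \<open>Differentiate a (x y) = (a x) y in \<open>y\<close> at the identity. As a consequence,
  left translates of integral curves are integral curves.\<close>

lemma left_field_invariant: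
  assumes ax: "(a, x) \<in> Md"
  shows "frechet_derivative chart_mult (at (a, x)) (0, left_field X x)
      = left_field X (chart_mult (a, x))"
proof -
  let ?m = "chart_mult (a, x)"
  have R: "a \<in> range_chart c1" "x \<in> range_chart c1" "?m \<in> range_chart c1"
    using ax chart_mult_range[OF ax] by (auto simp: Md_iff)
  define V where "V = (\<lambda>y. (x, y)) -` Md \<inter> (\<lambda>y. (?m, y)) -` Md"
  have V: "open V" unfolding V_def
    by (intro open_Int open_vimage[OF open_Md] continuous_on_Pair continuous_on_const continuous_on_id)
  have eV: "e1 \<in> V" unfolding V_def using Md_e1_right R by auto
  have "((\<lambda>y. chart_mult (x, y)) has_derivative (\<lambda>v. frechet_derivative chart_mult
      (at (x, e1)) (0, v))) (at e1)"
    by (rule has_derivative_snd_slot[OF holo_chart_mult Md_e1_right[OF R(2)]])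
  moreover have "((\<lambda>y. chart_mult (a, y)) has_derivative (\<lambda>v. frechet_derivative chart_mult
      (at (a, x)) (0, v)))
      (at (chart_mult (x, e1)))"
    unfolding chart_mult_e1_right[OF R(2)] by (rule has_derivative_snd_slot[OF holo_chart_mult ax])
  ultimately have "((\<lambda>y. chart_mult (a, chart_mult (x, y))) has_derivative
      (\<lambda>v. frechet_derivative chart_mult (at (a, x)) (0, frechet_derivative chart_mult (at (x, e1)) (0, v)))) (at e1)"
    by (rule has_derivative_compose)
  then have "((\<lambda>y. chart_mult (?m, y)) has_derivative
      (\<lambda>v. frechet_derivative chart_mult (at (a, x)) (0, frechet_derivative chart_mult (at (x, e1)) (0, v)))) (at e1)"
  proof (rule has_derivative_transform_within_open[OF _ V eV])
    fix y assume y: "y \<in> V"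
    then have "(x, y) \<in> Md" "y \<in> range_chart c1" by (auto simp: V_def Md_iff)
    then show "chart_mult (a, chart_mult (x, y)) = chart_mult (?m, y)"
      using \<psi>_chart_mult[OF ax] R
      by (simp add: chart_mult_def[of "(a, chart_mult (x, y))"] chart_mult_def[of "(?m, y)"]
          \<psi>_chart_mult \<psi>_closed m_assoc)
  qed
  moreover have "((\<lambda>y. chart_mult (?m, y)) has_derivative (\<lambda>v. frechet_derivative chart_mult
      (at (?m, e1)) (0, v))) (at e1)"
    by (rule has_derivative_snd_slot[OF holo_chart_mult Md_e1_right[OF R(3)]])
  ultimately show ?thesis unfolding left_field_def using has_derivative_unique by metis
qed

lemma left_field_lipschitz:
  "\<exists>R>0. \<exists>L. cball e1 R \<subseteq> range_chart c1 \<and>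
    (\<forall>x\<in>cball e1 R. \<forall>y\<in>cball e1 R. norm (left_field X x - left_field X y) \<le> L * norm (x - y))"
  by (rule vec_scaling.holo_on_lipschitz[OF holo_left_field open_range_c1 e1(1)])

lemma chart_mult_vector_derivative:
  assumes "(a, u t) \<in> Md" "(u has_vector_derivative w) (at t)"
  shows "((\<lambda>r. chart_mult (a, u r)) has_vector_derivative frechet_derivative chart_mult
      (at (a, u t)) (0, w)) (at t)"
proof -
  let ?D = "\<lambda>v. frechet_derivative chart_mult (at (a, u t)) (0, v)"
  have D: "((\<lambda>y. chart_mult (a, y)) has_derivative ?D) (at (u t))"
    by (rule has_derivative_snd_slot[OF holo_chart_mult assms(1)])
  have "(u has_derivative (\<lambda>h. h *\<^sub>R w)) (at t)" using assms(2)
    by (simp add: has_vector_derivative_def)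
  from has_derivative_compose[OF this D]
  have "((\<lambda>r. chart_mult (a, u r)) has_derivative (\<lambda>h. ?D (h *\<^sub>R w))) (at t)" .
  moreover have "?D (h *\<^sub>R w) = h *\<^sub>R ?D w" for h
    by (rule linear_scale[OF has_derivative_linear[OF D]])
  ultimately show ?thesis by (simp add: has_vector_derivative_def)
qed

text \<open>Differentiate \<gamma> (t + s) = \<gamma> t \<gamma> s in \<open>s\<close> at 0, then
  shift the time.\<close>

lemma one_param_ode:
  assumes \<gamma>: "curve X \<gamma>" "\<And>s t. \<gamma> (s + t) = \<gamma> s \<otimes> \<gamma> t" and t: "\<gamma> t \<in> dom_chart c1"
  shows "((\<lambda>t. \<phi> (\<gamma> t)) has_vector_derivative left_field X (\<phi> (\<gamma> t))) (at t)"
proof -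
  have \<gamma>0: "\<phi> (\<gamma> 0) = e1" using \<gamma>(1) by (simp add: curve_def e1_def)
  have "(\<phi> (\<gamma> t), \<phi> (\<gamma> 0)) \<in> Md" unfolding \<gamma>0 by (rule Md_e1_right[OF \<phi>_range[OF t]])
  moreover have "((\<lambda>t. \<phi> (\<gamma> t)) has_vector_derivative X) (at 0)" using \<gamma>(1) by (simp add: curve_def)
  ultimately have "((\<lambda>s. chart_mult (\<phi> (\<gamma> t), \<phi> (\<gamma> s)))
      has_vector_derivative left_field X (\<phi> (\<gamma> t))) (at 0)"
    unfolding left_field_def using chart_mult_vector_derivative[of "\<phi> (\<gamma> t)" "\<lambda>s. \<phi> (\<gamma> s)" 0 X] \<gamma>0
        by simp
  then have "((\<lambda>s. \<phi> (\<gamma> (t + s))) has_vector_derivative left_field X (\<phi> (\<gamma> t))) (at 0)"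
    by (rule has_vector_derivative_transform_within_open[OF _ curve_near[OF \<gamma>(1)]])
      (simp add: chart_mult_def \<psi>_\<phi> t \<gamma>(2))
  moreover have "((\<lambda>r. r - t) has_vector_derivative 1) (at t)"
    by (auto simp: has_real_derivative_iff_has_vector_derivative[symmetric] intro!: derivative_eq_intros)
  ultimately have "((\<lambda>s. \<phi> (\<gamma> (t + s))) \<circ> (\<lambda>r. r - t)
      has_vector_derivative 1 *\<^sub>R left_field X (\<phi> (\<gamma> t))) (at t)"
    by (intro vector_diff_chain_at) auto
  then show ?thesis by (simp add: comp_def)
qed

lemma one_param_nat_pow:
  assumes \<gamma>: "curve X \<gamma>" "\<And>s t. \<gamma> (s + t) = \<gamma> s \<otimes> \<gamma> t"
  shows "\<gamma> (real n * t) = \<gamma> t [^] n"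
proof (induction n)
  case 0
  then show ?case using \<gamma>(1) by (simp add: curve_def)
next
  case (Suc n)
  have "\<gamma> (real (Suc n) * t) = \<gamma> (real n * t + t)" by (simp add: algebra_simps)
  then show ?case using \<gamma>(2) Suc by simp
qed

lemma curve_in_ball:
  assumes \<gamma>: "curve X \<gamma>" and R: "R > 0"
  shows "\<exists>b>0. \<forall>t. \<bar>t\<bar> < b \<longrightarrow> \<gamma> t \<in> dom_chart c1 \<and> \<phi> (\<gamma> t) \<in> cball e1 R"
proof -
  have "isCont (\<lambda>t. \<phi> (\<gamma> t)) 0"
    using \<gamma> by (auto simp: curve_def intro: has_vector_derivative_continuous)
  moreover have "\<phi> (\<gamma> 0) = e1" using \<gamma> by (simp add: curve_def e1_def)
  ultimately obtain d where d: "d > 0" "\<And>t. dist t 0 < d \<Longrightarrow> dist (\<phi> (\<gamma> t)) e1 < R"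
    unfolding continuous_at_eps_delta using R by metis
  obtain d' where d': "d' > 0" "ball 0 d' \<subseteq> {t. \<gamma> t \<in> dom_chart c1}"
    using curve_near[OF \<gamma>] open_contains_ball by blast
  show ?thesis
  proof (intro exI[of _ "min d d'"] conjI allI impI)
    fix t :: real assume t: "\<bar>t\<bar> < min d d'"
    then show "\<gamma> t \<in> dom_chart c1" using d'(2) by (auto simp: subset_iff)
    have "dist (\<phi> (\<gamma> t)) e1 < R" using d(2)[of t] t by simp
    then show "\<phi> (\<gamma> t) \<in> cball e1 R" by (simp add: dist_commute)
  qed (use d(1) d'(1) in simp)
qed

text \<open>Near 0 both curves solve the same differential equation. Elsewhere \<gamma> t is the
  n-th power of \<gamma> (t / n), so the values near 0 decide.\<close>

lemma one_param_unique:
  assumes \<gamma>: "curve X \<gamma>" "\<And>s t. \<gamma> (s + t) = \<gamma> s \<otimes> \<gamma> t"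
    and \<eta>: "curve X \<eta>" "\<And>s t. \<eta> (s + t) = \<eta> s \<otimes> \<eta> t"
  shows "\<gamma> = \<eta>"
proof -
  obtain R L where R: "R > 0"
    and lip: "\<And>x y. x \<in> cball e1 R \<Longrightarrow> y \<in> cball e1 R \<Longrightarrow> norm (left_field X x - left_field X y)
        \<le> L * norm (x - y)"
    using left_field_lipschitz[of X] by blast
  obtain b1 where b1: "b1 > 0" "\<And>t. \<bar>t\<bar> < b1 \<Longrightarrow> \<gamma> t \<in> dom_chart c1 \<and> \<phi> (\<gamma> t) \<in> cball e1 R"
    using curve_in_ball[OF \<gamma>(1) R] by blast
  obtain b2 where b2: "b2 > 0" "\<And>t. \<bar>t\<bar> < b2 \<Longrightarrow> \<eta> t \<in> dom_chart c1 \<and> \<phi> (\<eta> t) \<in> cball e1 R"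
    using curve_in_ball[OF \<eta>(1) R] by blast
  define b where "b = min b1 b2"
  have b: "b > 0" using b1(1) b2(1) by (simp add: b_def)
  have near: "\<gamma> t = \<eta> t" if t: "\<bar>t\<bar> < b" for t
  proof -
    have "\<phi> (\<gamma> t) = \<phi> (\<eta> t)"
    proof (rule ode_unique[OF lip, where b = b and u = "\<lambda>t. \<phi> (\<gamma> t)" and v = "\<lambda>t. \<phi> (\<eta> t)"])
      show "\<phi> (\<gamma> r) \<in> cball e1 R \<and> ((\<lambda>t. \<phi> (\<gamma> t)) has_vector_derivative left_field X (\<phi> (\<gamma> r)))
          (at r)"
        if "\<bar>r\<bar> < b" for r
        using b1(2)[of r] one_param_ode[OF \<gamma>, of r] that by (simp add: b_def)
      show "\<phi> (\<eta> r) \<in> cball e1 R \<and> ((\<lambda>t. \<phi> (\<eta> t)) has_vector_derivative left_field X (\<phi> (\<eta> r)))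
          (at r)"
        if "\<bar>r\<bar> < b" for r
        using b2(2)[of r] one_param_ode[OF \<eta>, of r] that by (simp add: b_def)
      show "\<phi> (\<gamma> 0) = \<phi> (\<eta> 0)" using \<gamma>(1) \<eta>(1) by (simp add: curve_def)
    qed (assumption, assumption, rule t)
    moreover have "\<psi> (\<phi> (\<gamma> t)) = \<gamma> t" "\<psi> (\<phi> (\<eta> t)) = \<eta> t"
      using b1(2)[of t] b2(2)[of t] t by (auto simp: b_def \<psi>_\<phi>)
    ultimately show ?thesis by metis
  qed
  show ?thesis
  proof
    fix t
    obtain n :: nat where n: "\<bar>t\<bar> / b < real n" using reals_Archimedean2 by blast
    moreover have "0 \<le> \<bar>t\<bar> / b" using b by simp
    ultimately have "0 < n" by (cases n) auto
    have "\<bar>t / n\<bar> < b" using n b \<open>0 < n\<close> by (simp add: field_simps)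
    then have "\<gamma> (real n * (t / n)) = \<eta> (real n * (t / n))"
      unfolding one_param_nat_pow[OF \<gamma>] one_param_nat_pow[OF \<eta>] using near by simp
    then show "\<gamma> t = \<eta> t" using \<open>0 < n\<close> by simp
  qed
qed

lemma continuous_map_nat_pow:
  assumes "continuous_map X T f"
  shows "continuous_map X T (\<lambda>x. f x [^] (n::nat))"
  using assms by (induction n) (auto intro: continuous_map_group_mult simp: carrier)

text \<open>The extension is \<open>\<gamma> t = \<sigma> (t / n) ^ n\<close> for large \<open>n\<close>; the choice of \<open>n\<close> is immaterial.\<close>

lemma local_hom_extend:
  fixes \<sigma> :: "real \<Rightarrow> 'a"
  assumes "\<delta> > 0" and cl: "\<And>t. \<bar>t\<bar> < \<delta> \<Longrightarrow> \<sigma> t \<in> carrier G"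
    and hom: "\<And>s t. \<bar>s\<bar> < \<delta> \<Longrightarrow> \<bar>t\<bar> < \<delta> \<Longrightarrow> \<bar>s + t\<bar> < \<delta> \<Longrightarrow> \<sigma> (s + t) = \<sigma> s \<otimes> \<sigma> t"
    and cont: "continuous_map (top_of_set (ball 0 \<delta>)) T \<sigma>"
  shows "\<exists>\<gamma>. continuous_map euclideanreal T \<gamma> \<and> (\<forall>s t. \<gamma> (s + t) = \<gamma> s \<otimes> \<gamma> t) \<and> (\<forall>t. \<bar>t\<bar> < \<delta> \<longrightarrow> \<gamma> t
      = \<sigma> t)"
proof -
  have "\<sigma> 0 = \<sigma> 0 \<otimes> \<sigma> 0" using hom[of 0 0] \<open>\<delta> > 0\<close> by simp
  then have \<sigma>0: "\<sigma> 0 = \<one>" using cl[of 0] \<open>\<delta> > 0\<close> l_cancel_one' by (metis abs_zero)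
  have mult: "\<sigma> (real k * r) = \<sigma> r [^] k" if "\<bar>real k * r\<bar> < \<delta>" for k :: nat and r
    using that
  proof (induction k)
    case 0
    then show ?case by (simp add: \<sigma>0)
  next
    case (Suc k)
    have "\<bar>real (Suc k) * r\<bar> = real (Suc k) * \<bar>r\<bar>" "\<bar>real k * r\<bar> = real k * \<bar>r\<bar>"
      by (simp_all only: abs_mult abs_of_nat)
    moreover have "real (Suc k) * \<bar>r\<bar> = real k * \<bar>r\<bar> + \<bar>r\<bar>"
      by (simp add: distrib_right)
    moreover have "0 \<le> real k * \<bar>r\<bar>" by simp
    ultimately have le: "\<bar>real k * r\<bar> \<le> \<bar>real (Suc k) * r\<bar>" "\<bar>r\<bar> \<le> \<bar>real (Suc k) * r\<bar>"
      by linarith+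
    have eq: "real (Suc k) * r = real k * r + r" by (simp add: algebra_simps)
    have "\<sigma> (real k * r + r) = \<sigma> (real k * r) \<otimes> \<sigma> r"
      using le_less_trans[OF le(1) Suc.prems] le_less_trans[OF le(2) Suc.prems] Suc.prems
      unfolding eq by (rule hom)
    then show ?case unfolding eq using Suc le by simp
  qed
  define ok where "ok n t \<longleftrightarrow> \<bar>t\<bar> < real n * \<delta>" for n :: nat and t
  have ok_pos: "0 < n" if "ok n t" for n t
    using that unfolding ok_def by (cases n) auto
  have ok_div: "\<bar>t / n\<bar> < \<delta>" if "ok n t" for n t
    using that ok_pos[OF that] by (simp add: ok_def field_simps)
  have ok_ex: "\<exists>n. ok n t" for t
    using reals_Archimedean2[of "\<bar>t\<bar> / \<delta>"] \<open>\<delta> > 0\<close> by (auto simp: ok_def field_simps)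
  have ok_mono: "ok m t" if "ok n t" "n \<le> m" for n m t
  proof -
    have "real n * \<delta> \<le> real m * \<delta>" using that(2) \<open>\<delta> > 0\<close> by (intro mult_right_mono) auto
    then show ?thesis using that(1) by (simp add: ok_def)
  qed
  have refine: "\<sigma> (t / n) [^] n = \<sigma> (t / (real n * real m)) [^] (m * n)" if "ok n t" "0 < m"
    for n m :: nat and t
  proof -
    have n: "0 < n" using ok_pos that by blast
    have eq: "real m * (t / (real n * real m)) = t / n" using that(2) by simp
    have "\<sigma> (t / n) = \<sigma> (t / (real n * real m)) [^] m"
      using mult[of m "t / (real n * real m)"] ok_div[OF that(1)] unfolding eq by blast
    moreover have "\<bar>t / (real n * real m)\<bar> < \<delta>"
    proof (rule ok_div[of "n * m", unfolded of_nat_mult])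
      show "ok (n * m) t" using ok_mono[OF that(1)] that(2) by simp
    qed
    ultimately show ?thesis using cl by (simp add: nat_pow_pow)
  qed
  \<comment> \<open>Both powers equal the one taken at the common refinement n * m.\<close>
  have indep: "\<sigma> (t / n) [^] n = \<sigma> (t / m) [^] m" if "ok n t" "ok m t" for n m t
    using refine[OF that(1) ok_pos[OF that(2)]] refine[OF that(2) ok_pos[OF that(1)]]
    by (simp add: mult.commute)
  define N where "N t = (SOME n. ok n t)" for t
  define \<gamma> where "\<gamma> t = \<sigma> (t / real (N t)) [^] N t" for t
  have \<gamma>: "\<gamma> t = \<sigma> (t / n) [^] n" if "ok n t" for n t
    unfolding \<gamma>_def by (rule indep[OF _ that]) (unfold N_def, rule someI[of "\<lambda>n. ok n t", OF that])
  have "\<gamma> (s + t) = \<gamma> s \<otimes> \<gamma> t" for s t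
  proof -
    obtain n where n: "ok n (\<bar>s\<bar> + \<bar>t\<bar>)" using ok_ex by blast
    then have o: "ok n s" "ok n t" "ok n (s + t)" by (auto simp: ok_def)
    have d: "\<bar>s / n\<bar> < \<delta>" "\<bar>t / n\<bar> < \<delta>" "\<bar>s / n + t / n\<bar> < \<delta>" "\<bar>t / n + s / n\<bar> < \<delta>"
      using ok_div[OF o(1)] ok_div[OF o(2)] ok_div[OF o(3)]
          by (auto simp: add_divide_distrib add.commute)
    have h: "\<sigma> ((s + t) / n) = \<sigma> (s / n) \<otimes> \<sigma> (t / n)"
      unfolding add_divide_distrib by (rule hom[OF d(1,2,3)])
    \<comment> \<open>Distributing the power over the product needs commutativity, which follows
      from the symmetry of s + t in the local law.\<close>
    have "\<sigma> (s / n) \<otimes> \<sigma> (t / n) = \<sigma> (t / n) \<otimes> \<sigma> (s / n)"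
      using hom[OF d(1,2,3)] hom[OF d(2,1,4)] by (simp add: add.commute)
    then show ?thesis
      unfolding \<gamma>[OF o(1)] \<gamma>[OF o(2)] \<gamma>[OF o(3)] h
          by (rule pow_mult_distrib[OF _ cl[OF d(1)] cl[OF d(2)]])
  qed
  moreover have "\<gamma> t = \<sigma> t" if t: "\<bar>t\<bar> < \<delta>" for t
    using \<gamma>[of 1 t] t cl[OF t] by (simp add: ok_def)
  moreover have "continuous_map euclideanreal T \<gamma>"
  proof -
    have cn: "continuous_map (top_of_set {t. ok n t}) T (\<lambda>t. \<sigma> (t / n) [^] n)" for n
    proof (rule continuous_map_nat_pow)
      have "continuous_on {t. ok n t} (\<lambda>t. t / real n)"
        unfolding divide_inverse by (intro continuous_intros)
      then have "continuous_map (top_of_set {t. ok n t}) (top_of_set (ball 0 \<delta>)) (\<lambda>t. t / real n)"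
        using ok_div by auto
      from continuous_map_compose[OF this cont]
      show "continuous_map (top_of_set {t. ok n t}) T (\<lambda>t. \<sigma> (t / n))" by (simp add: comp_def)
    qed
    have op: "open {t. ok n t}" for n
      unfolding ok_def by (intro open_Collect_less continuous_intros)
    have "\<gamma> t \<in> topspace T" for t
    proof -
      obtain n where n: "ok n t" using ok_ex by blast
      show ?thesis unfolding \<gamma>[OF n] carrier by (rule nat_pow_closed[OF cl[OF ok_div[OF n]]])
    qed
    moreover have "open {t. \<gamma> t \<in> U}" if U: "openin T U" for U
    proof -
      have "{t. \<gamma> t \<in> U} = (\<Union>n. {t \<in> {t. ok n t}. \<sigma> (t / n) [^] n \<in> U})"
        using \<gamma> ok_ex by fastforce
      then show ?thesis using open_continuous_preimage[OF cn op U] by (auto intro!: open_UN)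
    qed
    ultimately show ?thesis by (auto simp: continuous_map_def)
  qed
  ultimately show ?thesis by blast
qed

text \<open>An integral curve \<open>x\<close> from the identity is a local homomorphism: as
  functions of \<open>t\<close>, x (s + t) and the product of x s and x t are both integral curves
  starting at x s. \<open>local_hom_extend\<close> then makes it global.\<close>

lemma one_param_exists:
  "\<exists>\<gamma>. curve X \<gamma> \<and> (\<forall>s t. \<gamma> (s + t) = \<gamma> s \<otimes> \<gamma> t)"
proof -
  obtain R L where R: "R > 0" "cball e1 R \<subseteq> range_chart c1"
    and lip: "\<And>x y. x \<in> cball e1 R \<Longrightarrow> y \<in> cball e1 R \<Longrightarrow> norm (left_field X x - left_field X y)
        \<le> L * norm (x - y)"
    using left_field_lipschitz[of X] by blast
  obtain \<epsilon> x where \<epsilon>: "\<epsilon> > 0" and x0: "x 0 = e1" and xR: "\<And>t. x t \<in> cball e1 R"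
    and dx: "\<And>t. \<bar>t\<bar> < \<epsilon> \<Longrightarrow> (x has_vector_derivative left_field X (x t)) (at t)"
    using ode_exists[OF R(1) lip] by metis
  have xr: "x t \<in> range_chart c1" for t using xR R(2) by blast
  have cx: "isCont x t" if "\<bar>t\<bar> < \<epsilon>" for t using dx[OF that]
    by (rule has_vector_derivative_continuous)
  \<comment> \<open>On \<open>W\<close> products remain in the ball where the field is Lipschitz, as
    the uniqueness argument requires.\<close>
  define W where "W = Md \<inter> chart_mult -` ball e1 R"
  have "open W" unfolding W_def
    by (rule continuous_open_preimage[OF holo_on_continuous[OF holo_chart_mult] open_Md open_ball])
  moreover have "(e1, e1) \<in> W" using Md_e1_right[OF e1(1)] R(1)
    by (simp add: W_def chart_mult_e1_right[OF e1(1)])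
  ultimately obtain U V where "open U" "open V" "(e1, e1) \<in> U \<times> V" "U \<times> V \<subseteq> W"
    by (rule open_prod_elim)
  then have UV: "open U" "open V" "e1 \<in> U" "e1 \<in> V" "U \<times> V \<subseteq> W" by auto
  have "\<exists>d>0. \<forall>t. dist t 0 < d \<longrightarrow> x t \<in> U \<inter> V"
  proof -
    have "open (U \<inter> V)" "x 0 \<in> U \<inter> V" using UV x0 by auto
    then obtain e where e: "e > 0" "ball (x 0) e \<subseteq> U \<inter> V" using open_contains_ball by blast
    have "isCont x 0" using cx \<epsilon> by simp
    then obtain d where "d > 0" "\<And>t. dist t 0 < d \<Longrightarrow> dist (x t) (x 0) < e"
      unfolding continuous_at_eps_delta using e(1) by blast
    then show ?thesis using e(2) by (intro exI[of _ d]) (auto simp: dist_commute subset_iff)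
  qed
  then obtain d where d: "d > 0" "\<And>t. \<bar>t\<bar> < d \<Longrightarrow> x t \<in> U \<inter> V" by auto
  \<comment> \<open>Half of \<epsilon>, so that a sum of two parameters stays within the time of
    existence.\<close>
  define \<delta> where "\<delta> = min d (\<epsilon> / 2)"
  have \<delta>: "\<delta> > 0" using d(1) \<epsilon> by (simp add: \<delta>_def)
  have W: "(x s, x t) \<in> Md" "chart_mult (x s, x t) \<in> ball e1 R" if "\<bar>s\<bar> < \<delta>" "\<bar>t\<bar> < \<delta>" for s t
    using d(2)[of s] d(2)[of t] that UV(5) by (auto simp: \<delta>_def W_def)
  have add: "x (s + t) = chart_mult (x s, x t)" if s: "\<bar>s\<bar> < \<delta>" and t: "\<bar>t\<bar> < \<delta>" for s t
  proof (rule ode_unique[OF lip, where b = \<delta> and u = "\<lambda>t. x (s + t)"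
    and v = "\<lambda>t. chart_mult (x s, x t)"])
    fix r assume r: "\<bar>r\<bar> < \<delta>"
    then have "\<bar>r\<bar> < \<epsilon> / 2" "\<bar>s\<bar> < \<epsilon> / 2" using s by (auto simp: \<delta>_def)
    then have "\<bar>s + r\<bar> < \<epsilon>" by linarith
    then have "(x \<circ> (\<lambda>r. s + r) has_vector_derivative 1 *\<^sub>R left_field X (x (s + r))) (at r)"
      by (intro vector_diff_chain_at dx)
        (auto simp: has_real_derivative_iff_has_vector_derivative[symmetric] intro!: derivative_eq_intros)
    then show "x (s + r) \<in> cball e1 R \<and> ((\<lambda>t. x (s + t))
        has_vector_derivative left_field X (x (s + r))) (at r)"
      using xR by (simp add: comp_def)
    have "\<bar>r\<bar> < \<epsilon>" using r \<epsilon> by (simp add: \<delta>_def)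
    from chart_mult_vector_derivative[of "x s" x r, OF W(1)[OF s r] dx[OF this]]
    show "chart_mult (x s, x r) \<in> cball e1 R \<and>
      ((\<lambda>t. chart_mult (x s, x t)) has_vector_derivative left_field X (chart_mult (x s, x r))) (at r)"
      using W(2)[OF s r] left_field_invariant[OF W(1)[OF s r]] by simp
  qed (use t in \<open>auto simp: x0 chart_mult_e1_right xr\<close>)
  define \<sigma> where "\<sigma> t = \<psi> (x t)" for t
  have "\<exists>\<gamma>. continuous_map euclideanreal T \<gamma> \<and> (\<forall>s t. \<gamma> (s + t) = \<gamma> s \<otimes> \<gamma> t) \<and> (\<forall>t. \<bar>t\<bar> < \<delta> \<longrightarrow> \<gamma> t
      = \<sigma> t)"
  proof (rule local_hom_extend[OF \<delta>])
    show "\<sigma> t \<in> carrier G" for t unfolding \<sigma>_def by (rule \<psi>_closed[OF xr])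
    show "\<sigma> (s + t) = \<sigma> s \<otimes> \<sigma> t" if "\<bar>s\<bar> < \<delta>" "\<bar>t\<bar> < \<delta>" for s t
      unfolding \<sigma>_def add[OF that] by (rule \<psi>_chart_mult[OF W(1)[OF that]])
    have "continuous_on (ball 0 \<delta>) x"
      by (rule continuous_at_imp_continuous_on) (use cx \<epsilon> in \<open>auto simp: \<delta>_def\<close>)
    then have "continuous_map (top_of_set (ball 0 \<delta>)) (top_of_set (range_chart c1)) x"
      using xr by auto
    from continuous_map_compose[OF this continuous_map_inv_coord[OF c1(1)]]
    show "continuous_map (top_of_set (ball 0 \<delta>)) T \<sigma>" by (simp add: comp_def \<sigma>_def[abs_def] \<psi>_def)
  qed
  then obtain \<gamma> where \<gamma>: "continuous_map euclideanreal T \<gamma>" "\<And>s t. \<gamma> (s + t) = \<gamma> s \<otimes> \<gamma> t"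
    "\<And>t. \<bar>t\<bar> < \<delta> \<Longrightarrow> \<gamma> t = \<sigma> t" by blast
  have "\<gamma> 0 = \<one>" using \<gamma>(3)[of 0] \<delta> by (simp add: \<sigma>_def x0 e1)
  moreover have "((\<lambda>t. \<phi> (\<gamma> t)) has_vector_derivative X) (at 0)"
  proof (rule has_vector_derivative_transform_within_open[of x _ _ "ball 0 \<delta>"])
    show "(x has_vector_derivative X) (at 0)" using dx[of 0] \<epsilon> by (simp add: x0 left_field_e1)
  qed (use \<delta> in \<open>auto simp: \<gamma>(3) \<sigma>_def \<phi>_\<psi> xr\<close>)
  ultimately show ?thesis using \<gamma>(1,2) by (intro exI[of _ \<gamma>]) (auto simp: curve_def)
qed

lemma lie_exp_eq:
  assumes "one_param_subgroup G T A X \<gamma>"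
  shows "lie_exp G T A X = \<gamma> 1"
proof -
  have "(THE \<gamma>. one_param_subgroup G T A X \<gamma>) = \<gamma>"
    using assms one_param_unique unfolding one_param_subgroup_iff by (intro the_equality) blast+
  then show ?thesis by (simp add: lie_exp_def)
qed

text \<open>All \<gamma> t and \<gamma> s commute, so conjugation by \<gamma> t fixes the curve and
  therefore its velocity \<open>X\<close>.\<close>

lemma lie_bracket_self: "lie_bracket G A X X = 0"
proof -
  obtain \<gamma> where \<gamma>: "curve X \<gamma>" "\<And>s t. \<gamma> (s + t) = \<gamma> s \<otimes> \<gamma> t"
    using one_param_exists by blast
  have cl: "\<gamma> t \<in> carrier G" for t by (rule curve_closed[OF \<gamma>(1)])
  have "Ad G A (\<gamma> t) X = X" for t
  proof -
    have "\<gamma> t \<otimes> \<gamma> s \<otimes> inv \<gamma> t = \<gamma> s" for s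
    proof -
      have "\<gamma> t \<otimes> \<gamma> s = \<gamma> s \<otimes> \<gamma> t" using \<gamma>(2)[of t s] \<gamma>(2)[of s t] by (simp add: add.commute)
      then show ?thesis using cl by (simp add: m_assoc)
    qed
    then have "curve (Ad G A (\<gamma> t) X) \<gamma>" using curve_conj[OF \<gamma>(1) cl[of t]] by simp
    then show ?thesis using \<gamma>(1) unfolding curve_def by (blast intro: vector_derivative_unique_at)
  qed
  then have "((\<lambda>t. X) has_vector_derivative lie_bracket G A X X) (at (0::real))"
    using curve_Ad[OF \<gamma>(1), of X] by simp
  then show ?thesis using has_vector_derivative_const vector_derivative_unique_at by blast
qed

lemma bounded_bilinear_lie_bracket: "bounded_bilinear (lie_bracket G A)"
proof -
  have lin: "linear f" if "clinear f" for f :: "complex^'n \<Rightarrow> complex^'n"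
  proof (rule linearI)
    have eq: "r *\<^sub>R v = complex_of_real r *s v" for r and v :: "complex^'n"
      by (simp add: vec_eq_iff scaleR_conv_of_real[where 'a=complex])
    show "f (r *\<^sub>R b) = r *\<^sub>R f b" for r b
      unfolding eq by (rule vec.linear_scale[OF that])
  qed (rule vec.linear_add[OF that])
  show ?thesis
    unfolding bilinear_conv_bounded_bilinear[symmetric] bilinear_def
    using lin[OF lie_bracket_linear_left] lin[OF lie_bracket_linear_right] by simp
qed

lemma lie_bracket_jacobi:
  "lie_bracket G A X (lie_bracket G A Y Z)
    = lie_bracket G A (lie_bracket G A X Y) Z + lie_bracket G A Y (lie_bracket G A X Z)"
proof -
  obtain \<gamma> where \<gamma>: "curve X \<gamma>" using one_param_exists by blast
  \<comment> \<open>\<open>Y\<close> needs a curve too, because \<open>Ad_lie_bracket\<close> takes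
    its first argument as a velocity.\<close>
  obtain \<eta> where \<eta>: "curve Y \<eta>" using one_param_exists by blast
  have Ad0: "Ad G A (\<gamma> 0) v = v" for v using \<gamma> by (simp add: curve_def Ad_one)
  have "((\<lambda>t. lie_bracket G A (Ad G A (\<gamma> t) Y) (Ad G A (\<gamma> t) Z)) has_vector_derivative
      lie_bracket G A (Ad G A (\<gamma> 0) Y) (lie_bracket G A X Z)
      + lie_bracket G A (lie_bracket G A X Y) (Ad G A (\<gamma> 0) Z)) (at 0)"
    by (rule bounded_bilinear.has_vector_derivative[OF bounded_bilinear_lie_bracket curve_Ad[OF \<gamma>] curve_Ad[OF \<gamma>]])
  then have "((\<lambda>t. Ad G A (\<gamma> t) (lie_bracket G A Y Z)) has_vector_derivative
      lie_bracket G A Y (lie_bracket G A X Z) + lie_bracket G A (lie_bracket G A X Y) Z) (at 0)"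
    by (simp only: Ad_lie_bracket[OF \<eta> curve_closed[OF \<gamma>]] Ad0)
  from vector_derivative_unique_at[OF curve_Ad[OF \<gamma>] this] show ?thesis by (simp add: add.commute)
qed

sublocale lie: complex_lie_algebra "lie_bracket G A"
  by (rule complex_lie_algebra.intro)
    (rule lie_bracket_linear_left lie_bracket_linear_right lie_bracket_self lie_bracket_jacobi)+

text \<open>The function exp (-t c) Ad (\<gamma> t) X has derivative 0. On an eigenvector the
  relation between Ad, exp and ad thus becomes a scalar equation.\<close>

lemma Ad_one_param_eigenvector:
  assumes \<gamma>: "curve H \<gamma>" "\<And>s t. \<gamma> (s + t) = \<gamma> s \<otimes> \<gamma> t" and H: "lie_bracket G A H X = c *s X"
  shows "Ad G A (\<gamma> t) X = exp (of_real t * c) *s X"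
proof -
  define f where "f t = exp (- of_real t * c) *s Ad G A (\<gamma> t) X" for t
  have cl: "\<gamma> t \<in> carrier G" for t by (rule curve_closed[OF \<gamma>(1)])
  have dAd: "((\<lambda>t. Ad G A (\<gamma> t) X) has_vector_derivative c *s Ad G A (\<gamma> t) X) (at t)" for t
  proof -
    have "bounded_linear (Ad G A (\<gamma> t))"
      using Ad_has_derivative[OF cl] by (rule has_derivative_bounded_linear)
    from bounded_linear.has_vector_derivative[OF this curve_Ad[OF \<gamma>(1), of X]]
    have "((\<lambda>s. Ad G A (\<gamma> (t + s)) X) has_vector_derivative Ad G A (\<gamma> t) (c *s X)) (at 0)"
      by (simp add: \<gamma>(2) Ad_mult[OF cl cl] H)
    moreover have "((\<lambda>r. r - t) has_vector_derivative 1) (at t)"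
      by (auto simp: has_real_derivative_iff_has_vector_derivative[symmetric] intro!: derivative_eq_intros)
    ultimately have "((\<lambda>s. Ad G A (\<gamma> (t + s)) X) \<circ> (\<lambda>r. r - t) has_vector_derivative
        1 *\<^sub>R Ad G A (\<gamma> t) (c *s X)) (at t)"
      by (intro vector_diff_chain_at) auto
    then show ?thesis by (simp add: comp_def vec.linear_scale[OF Ad_linear[OF cl]])
  qed
  have "(f has_vector_derivative 0) (at t)" for t
  proof -
    have "((\<lambda>z. exp (- z * c)) has_field_derivative - c * exp (- of_real t * c))
        (at (complex_of_real t))"
      by (auto intro!: derivative_eq_intros)
    then have "((\<lambda>t. exp (- of_real t * c)) has_vector_derivative - c * exp (- of_real t * c))
        (at t)"
      by (rule has_vector_derivative_real_field)
    from bounded_bilinear.has_vector_derivative[OF bounded_bilinear_vec_scale this dAd[of t]]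
    show ?thesis unfolding f_def by (simp add: mult_ac)
  qed
  then have "f t = f 0"
    using has_derivative_zero_unique[of UNIV f 0 t]
    by (simp add: has_vector_derivative_def)
  also have "f 0 = X" using \<gamma>(1) by (simp add: f_def curve_def Ad_one)
  finally have "exp (of_real t * c) *s f t = exp (of_real t * c) *s X" by simp
  then show ?thesis by (simp add: f_def exp_minus)
qed

end

theorem lemma4p2:
  fixes G :: "('a, 'b) monoid_scheme" and T :: "'a topology"
    and A :: "('a, 'n::finite) chart set" and u :: 'a
  assumes "complex_semisimple_lie_group G T A"
    and "unipotent G T A u"
  shows "real_element G u"
proof -
  interpret complex_semisimple_lie_group G T A by fact
  obtain X where X: "lie_nilpotent (lie_bracket G A) X" and u: "u = lie_exp G T A X"
    using assms(2) by (auto simp: unipotent_def)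
  obtain W where W: "lie_bracket G A X W = X"
    using lie.nilpotent_in_range_ad[OF semisimple X] by blast
  \<comment> \<open>The bracket of \<open>W\<close> with \<open>X\<close> is -X, whence the minus
    sign; the factor makes the eigenvalue \<i>\<pi>, so that Ad negates \<open>X\<close> at time
    1.\<close>
  define H where "H = (- (\<i> * of_real pi)) *s W"
  have "lie_bracket G A W X = - X" using lie.br_anti[of W X] W by simp
  then have H: "lie_bracket G A H X = (\<i> * of_real pi) *s X"
    unfolding H_def by (simp add: lie.br_simps)
  obtain \<eta> where \<eta>: "curve H \<eta>" "\<And>s t. \<eta> (s + t) = \<eta> s \<otimes>\<^bsub>G\<^esub> \<eta> t"
    using one_param_exists by blast
  obtain \<gamma> where \<gamma>: "curve X \<gamma>" "\<And>s t. \<gamma> (s + t) = \<gamma> s \<otimes>\<^bsub>G\<^esub> \<gamma> t"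
    using one_param_exists by blast
  define h where "h = \<eta> 1"
  have h: "h \<in> carrier G" unfolding h_def by (rule curve_closed[OF \<eta>(1)])
  have cl: "\<gamma> t \<in> carrier G" for t by (rule curve_closed[OF \<gamma>(1)])
  have \<gamma>0: "\<gamma> 0 = \<one>\<^bsub>G\<^esub>" using \<gamma>(1) by (simp add: curve_def)
  have "Ad G A h X = exp (of_real 1 * (\<i> * of_real pi)) *s X"
    unfolding h_def by (rule Ad_one_param_eigenvector[OF \<eta> H])
  then have "Ad G A h X = - X" by (simp add: mult.commute)
  then have 1: "curve (- X) (\<lambda>t. h \<otimes>\<^bsub>G\<^esub> \<gamma> t \<otimes>\<^bsub>G\<^esub> inv\<^bsub>G\<^esub> h)"
    using curve_conj[OF \<gamma>(1) h] by simp
  have "(uminus has_vector_derivative -1) (at (0::real))"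
    by (auto simp: has_real_derivative_iff_has_vector_derivative[symmetric] intro!: derivative_eq_intros)
  then have "((\<lambda>t. \<phi> (\<gamma> t)) \<circ> uminus has_vector_derivative (-1) *\<^sub>R X) (at 0)"
    by (rule vector_diff_chain_at) (use \<gamma>(1) in \<open>simp add: curve_def\<close>)
  moreover have "continuous_map euclideanreal euclideanreal (uminus :: real \<Rightarrow> real)"
    by (auto intro!: continuous_intros)
  then have "continuous_map euclideanreal T (\<lambda>t. \<gamma> (- t))"
    using continuous_map_compose[of euclideanreal euclideanreal uminus T \<gamma>] \<gamma>(1)
    by (simp add: comp_def curve_def)
  ultimately have 2: "curve (- X) (\<lambda>t. \<gamma> (- t))"
    by (simp add: curve_def comp_def \<gamma>0)
  have "(\<lambda>t. h \<otimes>\<^bsub>G\<^esub> \<gamma> t \<otimes>\<^bsub>G\<^esub> inv\<^bsub>G\<^esub> h) = (\<lambda>t. \<gamma> (- t))"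
  proof (rule one_param_unique[OF 1 _ 2])
    show "h \<otimes>\<^bsub>G\<^esub> \<gamma> (s + t) \<otimes>\<^bsub>G\<^esub> inv\<^bsub>G\<^esub> h
        = h \<otimes>\<^bsub>G\<^esub> \<gamma> s \<otimes>\<^bsub>G\<^esub> inv\<^bsub>G\<^esub> h \<otimes>\<^bsub>G\<^esub> (h \<otimes>\<^bsub>G\<^esub> \<gamma> t \<otimes>\<^bsub>G\<^esub> inv\<^bsub>G\<^esub> h)" for s t
    proof -
      have "inv\<^bsub>G\<^esub> h \<otimes>\<^bsub>G\<^esub> (h \<otimes>\<^bsub>G\<^esub> (\<gamma> t \<otimes>\<^bsub>G\<^esub> inv\<^bsub>G\<^esub> h)) = \<gamma> t \<otimes>\<^bsub>G\<^esub> inv\<^bsub>G\<^esub> h"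
        using h cl by (simp flip: m_assoc)
      then show ?thesis using h cl by (simp add: \<gamma>(2) m_assoc)
    qed
    show "\<gamma> (- (s + t)) = \<gamma> (- s) \<otimes>\<^bsub>G\<^esub> \<gamma> (- t)" for s t
      using \<gamma>(2)[of "- s" "- t"] by (simp add: add.commute)
  qed
  then have "h \<otimes>\<^bsub>G\<^esub> \<gamma> 1 \<otimes>\<^bsub>G\<^esub> inv\<^bsub>G\<^esub> h = \<gamma> (- 1)" by metis
  also have "\<gamma> (- 1) = inv\<^bsub>G\<^esub> (\<gamma> 1)"
    using \<gamma>(2)[of "-1" 1] \<gamma>0 cl by (intro inv_equality[symmetric]) auto
  finally have "h \<otimes>\<^bsub>G\<^esub> \<gamma> 1 \<otimes>\<^bsub>G\<^esub> inv\<^bsub>G\<^esub> h = inv\<^bsub>G\<^esub> (\<gamma> 1)" .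
  moreover have "u = \<gamma> 1"
    unfolding u by (rule lie_exp_eq) (use \<gamma> in \<open>simp add: one_param_subgroup_iff\<close>)
  ultimately show ?thesis using h by (auto simp: real_element_def)
qed

end
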